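(* Let $\{X_n;\,n\ge1\}$ be a sequence of independent copies of a real-valued random variable $X$, $S_n=\sum_{k=1}^nX_k$, and $u_n=\inf\{t:\ \mathbb P(|X|>t)<1/n\}$, $n\ge1$. For $0<p<2$ the following are equivalent: (i) $\sum_{n=1}^\infty \frac1n\left(\frac{|S_n|}{n^{1/p}}\right)<\infty$ almost surely; (ii) if $0<p<1$: $\mathbb E|X|^p<\infty$; if $p=1$: $\mathbb EX=0$, $\sum_{n=1}^\infty \frac{|\mathbb E XI\{|X|\le n\}|}{n}<\infty$, and $\sum_{n=1}^\infty\frac1n\int_{\min\{u_n,n\}}^n\mathbb P(|X|>t)\,dt<\infty$; if $1<p<2$: $\mathbb EX=0$ and $\int_0^\infty \mathbb P^{1/p}(|X|>t)\,dt<\infty$. For $0<p<2$ the following are equivalent: (iii) $\sum_{n=1}^\infty \frac1n\left(\frac{\mathbb E|S_n|}{n^{1/p}}\right)<\infty$; (iv) if $0<p<1$: $\mathbb E|X|<\infty$; if $p=1$: $\mathbb EX=0$ and $\mathbb E|X|\ln(1+|X|)<\infty$; if $1<p<2$: $\mathbb EX=0$ and $\int_0^\infty\mathbb P^{1/p}(|X|>t)\,dt<\infty$. Moreover, for $1<p<2$, statements (i), (ii), (iii) are equivalent and each implies $S_n/n^{1/p}\to0$ almost surely. Finally, for $p=1$, if either $X$ is symmetric with $\mathbb E|X|\ln^\delta(1+|X|)<\infty$ for some $\delta>0$, or $\mathbb EX=0$ and $\mathbb E|X|\ln(1+|X|)<\infty$, then $\sum_{n=1}^\infty\frac1n\left(\frac{|S_n|}{n}\right)<\infty$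 almost surely.
   Context: $\mathbb{P}^{1/p}(A)$ denotes $(\mathbb P(A))^{1/p}$; $I\{\cdot\}$ denotes an indicator. *)

theory Defs
  imports "HOL-Probability.Probability"
begin

definition psum :: "(nat \<Rightarrow> 'a \<Rightarrow> real) \<Rightarrow> nat \<Rightarrow> 'a \<Rightarrow> real" where
  "psum Xs n \<omega> = (\<Sum>k\<in>{1..n}. Xs k \<omega>)"

definition tailp :: "'a measure \<Rightarrow> ('a \<Rightarrow> real) \<Rightarrow> real \<Rightarrow> real" where
  "tailp M X t = measure M {\<omega>\<in>space M. \<bar>X \<omega>\<bar> > t}"

definition uq :: "'a measure \<Rightarrow> ('a \<Rightarrow> real) \<Rightarrow> nat \<Rightarrow> real" where
  "uq M X n = Inf {t. tailp M X t < 1 / real n}"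

definition cond_i :: "'a measure \<Rightarrow> (nat \<Rightarrow> 'a \<Rightarrow> real) \<Rightarrow> real \<Rightarrow> bool" where
  "cond_i M Xs p \<longleftrightarrow>
     (AE \<omega> in M. summable (\<lambda>n. (1 / real n) * (\<bar>psum Xs n \<omega>\<bar> / real n powr (1 / p))))"

definition cond_ii :: "'a measure \<Rightarrow> ('a \<Rightarrow> real) \<Rightarrow> real \<Rightarrow> bool" where
  "cond_ii M X p \<longleftrightarrow>
     (if p < 1 then integrable M (\<lambda>\<omega>. \<bar>X \<omega>\<bar> powr p)
      else if p = 1 then
        integrable M X \<and> integral\<^sup>L M X = 0
        \<and> summable (\<lambda>n. \<bar>integral\<^sup>L M (\<lambda>\<omega>. X \<omega> * indicator {\<omega>. \<bar>X \<omega>\<bar> \<le> real n} \<omega>)\<bar> / real n)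
        \<and> summable (\<lambda>n. (1 / real n) *
              (LINT t:{min (uq M X n) (real n)..real n}|lborel. tailp M X t))
      else
        integrable M X \<and> integral\<^sup>L M X = 0
        \<and> (\<integral>\<^sup>+ t. ennreal (tailp M X t powr (1 / p)) * indicator {0..} t \<partial>lborel) < \<infinity>)"

definition cond_iii :: "'a measure \<Rightarrow> (nat \<Rightarrow> 'a \<Rightarrow> real) \<Rightarrow> real \<Rightarrow> bool" where
  "cond_iii M Xs p \<longleftrightarrow>
     (\<Sum>n. ennreal (1 / real n) * ((\<integral>\<^sup>+ \<omega>. ennreal \<bar>psum Xs n \<omega>\<bar> \<partial>M) / ennreal (real n powr (1 / p)))) < \<infinity>"

definition cond_iv :: "'a measure \<Rightarrow> ('a \<Rightarrow> real) \<Rightarrow> real \<Rightarrow> bool" where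
  "cond_iv M X p \<longleftrightarrow>
     (if p < 1 then integrable M X
      else if p = 1 then
        integrable M X \<and> integral\<^sup>L M X = 0
        \<and> integrable M (\<lambda>\<omega>. \<bar>X \<omega>\<bar> * ln (1 + \<bar>X \<omega>\<bar>))
      else
        integrable M X \<and> integral\<^sup>L M X = 0
        \<and> (\<integral>\<^sup>+ t. ennreal (tailp M X t powr (1 / p)) * indicator {0..} t \<partial>lborel) < \<infinity>)"

end

theory Submission
  imports Defs
begin

text \<open>
  Put a(n) = n^(-1-1/p) and regard the weighted sequence of partial sums as a random walk
  in l1 with independent steps X(j) (a(n) 1{j <= n}).  Because a decreases, the part of the walk
  after time J is dominated in law by the whole walk, so an Ottaviani argument turns almost sure
  finiteness of the norm into boundedness of the maximal norm, which forces E|X|^p < infinity.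
  After truncating X(j) at n^(1/p) in coordinate n the steps have bounded norm, and the
  Hoffmann-Joergensen argument yields integrability.  Hence (i) holds iff E|X|^p is finite and
  the truncated sums satisfy the analogue of (iii).

  Expectations of |S(n)| are compared with tail integrals.  Writing
  X = integral over t >= 0 of sgn(X) 1{|X| > t} and applying Tonelli gives, after centring,
  E|S(n)| <= integral of min(2 n P, sqrt(n P)) with P = P(|X| > t); conversely E|S(n)| controls
  E max |X(j)|, which is at least half the integral of min(1, n P).  Summing over n against a(n)
  produces P^(1/p) for 1 < p < 2 and logarithmic weights for p = 1.
\<close>

subsection \<open>Sums of powers\<close>

text \<open>The ranges of p differ by which powers of n are summable. A value x survives truncation
  in coordinate n iff n \<ge> |x|^p, and \<open>wt p n * real n\<close> is n^(-1/p). For p < 1 the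
  surviving terms n^(-1/p) |x| add up to order |x|^p, so the triangle inequality suffices. For p > 1
  the discarded terms do, so truncation can be undone in mean and (i) yields (iii). At p = 1 the
  first sum diverges and the second carries a logarithm: cancellation must be used, and truncated
  means and the quantiles u_n enter (ii). The truncation level depends on the coordinate n because
  only then is the l1 norm of a single step bounded; Borel-Cantelli still shows that almost surely
  only finitely many coordinates change. For 1 < p < 2 the minimum of 2nP and sqrt(nP) is split at n
  = 1/P. At p = 1 that split would leave a factor ln(1/P), which a moment does not control directly.
  A cut chosen as a function of t gives a weight in t instead, at the price of a remainder that is
  integrable in t.\<close>

lemma powr_diff_lower:
  fixes n :: nat and \<beta> :: real
  assumes "n \<ge> 1" "0 < \<beta>" "\<beta> < 1"
  shows "\<beta> * real (Suc n) powr (\<beta> - 1) \<le> real (Suc n) powr \<beta> - real n powr \<beta>"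
proof -
  have "\<exists>z>real n. z < real (Suc n) \<and>
      real (Suc n) powr \<beta> - real n powr \<beta> = (real (Suc n) - real n) * (\<beta> * z powr (\<beta> - 1))"
    using assms by (intro MVT2) (auto intro!: derivative_eq_intros simp: powr_diff)
  then obtain z where z: "real n < z" "z < real (Suc n)"
    "real (Suc n) powr \<beta> - real n powr \<beta> = \<beta> * z powr (\<beta> - 1)"
    by auto
  have "real (Suc n) powr (\<beta> - 1) \<le> z powr (\<beta> - 1)"
    using z assms by (intro powr_mono2') auto
  with assms z show ?thesis by (simp add: mult_left_mono)
qed

text \<open>Mean value theorem at a point z between n and n + 1; the factor
  \<open>2 powr \<alpha>\<close> pays for z < n + 1 \<le> 2n.\<close>

lemma powr_diff_upper:
  fixes n :: nat and \<alpha> :: real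
  assumes "n \<ge> 1" "1 < \<alpha>"
  shows "real n powr (-\<alpha>) \<le> 2 powr \<alpha> / (\<alpha> - 1) * (real n powr (1 - \<alpha>) - real (Suc n) powr (1 - \<alpha>))"
proof -
  have "\<exists>z>real n. z < real (Suc n) \<and>
      real (Suc n) powr (1-\<alpha>) - real n powr (1-\<alpha>) = (real (Suc n) - real n) * ((1-\<alpha>) * z powr (-\<alpha>))"
    using assms using has_real_derivative_powr[of _ "1 - \<alpha>"] by (intro MVT2) auto
  then obtain z where z: "real n < z" "z < real (Suc n)"
    "real n powr (1-\<alpha>) - real (Suc n) powr (1-\<alpha>) = (\<alpha>-1) * z powr (-\<alpha>)"
    by (auto simp: algebra_simps)
  have "real n powr (-\<alpha>) = 2 powr \<alpha> * (2 * real n) powr (-\<alpha>)"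
    by (simp add: powr_mult powr_minus field_simps)
  also have "... \<le> 2 powr \<alpha> * z powr (-\<alpha>)"
    using z assms by (intro mult_left_mono powr_mono2') auto
  finally show ?thesis unfolding z(3) using assms by simp
qed

lemma suminf_ennreal_le:
  fixes f :: "nat \<Rightarrow> real"
  assumes "\<And>n. 0 \<le> f n" "\<And>k. (\<Sum>n<k. f n) \<le> B"
  shows "(\<Sum>n. ennreal (f n)) \<le> ennreal B"
proof (rule suminf_le_const)
  show "(\<Sum>n<k. ennreal (f n)) \<le> ennreal B" for k
    using assms by (subst sum_ennreal) (auto intro: ennreal_leI)
qed simp

lemma sum_powr_tail:
  fixes \<alpha> y :: real
  assumes "1 < \<alpha>" "0 < y"
  shows "(\<Sum>n. ennreal (real n powr (-\<alpha>) * indicator {y..} (real n)))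
    \<le> ennreal (2 powr \<alpha> / (\<alpha> - 1) * y powr (1 - \<alpha>))"
proof (rule suminf_ennreal_le)
  fix k :: nat
  define m where "m = nat \<lceil>y\<rceil>"
  have m: "m \<ge> 1" "real m \<ge> y" "\<And>n. y \<le> real n \<longleftrightarrow> m \<le> n"
    using assms by (auto simp: m_def nat_le_iff ceiling_le_iff) linarith+
  let ?C = "2 powr \<alpha> / (\<alpha> - 1)"
  have C: "?C \<ge> 0" using assms by simp
  \<comment> \<open>With \<open>max k m\<close> the telescoped bound is 0 until the first index m
    \<ge> y has entered the sum.\<close>
  have "(\<Sum>n<k. real n powr (-\<alpha>) * indicator {y..} (real n))
    \<le> ?C * (real m powr (1-\<alpha>) - real (max k m) powr (1-\<alpha>))"
  proof (induction k)
    case (Suc k)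
    show ?case
    proof (cases "k < m")
      case True
      then have "max (Suc k) m = max k m" by auto
      with True Suc show ?thesis by (simp add: m(3))
    next
      case False
      then have mx: "max (Suc k) m = Suc k" "max k m = k" by auto
      have k: "k \<ge> 1" using False m by auto
      show ?thesis using Suc powr_diff_upper[OF k assms(1)] False
        unfolding mx by (simp add: m(3) algebra_simps)
    qed
  qed simp
  also have "... \<le> ?C * real m powr (1-\<alpha>)"
    using C by (intro mult_left_mono) auto
  also have "... \<le> ?C * y powr (1-\<alpha>)"
    using assms m C by (intro mult_left_mono powr_mono2') auto
  finally show "(\<Sum>n<k. real n powr (-\<alpha>) * indicator {y..} (real n)) \<le> ?C * y powr (1-\<alpha>)" .
qed auto

lemma sum_powr_head:
  fixes \<beta> y :: real
  assumes "0 < \<beta>" "\<beta> < 1" "0 \<le> y"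
  shows "(\<Sum>n. ennreal (real n powr (\<beta> - 1) * indicator {..y} (real n))) \<le> ennreal (1 / \<beta> * y powr \<beta>)"
proof (rule suminf_ennreal_le)
  fix k :: nat
  have le: "(\<Sum>n<Suc j. real n powr (\<beta> - 1)) \<le> 1 / \<beta> * real j powr \<beta>" for j :: nat
  proof (induction j)
    case (Suc j)
    show ?case
    proof (cases "j = 0")
      case True
      then show ?thesis using assms by simp
    next
      case False
      with powr_diff_lower[of j \<beta>] Suc assms show ?thesis by (simp add: field_simps)
    qed
  qed simp
  define m where "m = nat \<lfloor>y\<rfloor>"
  have m: "real m \<le> y" "\<And>n. real n \<le> y \<longleftrightarrow> n \<le> m"
    using assms by (auto simp: m_def le_nat_iff le_floor_iff)
  have "(\<Sum>n<k. real n powr (\<beta> - 1) * indicator {..y} (real n)) = (\<Sum>n\<in>{..<k} \<inter> {..m}. real n powr (\<beta> - 1))"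
    by (rule sum.mono_neutral_cong_right) (auto simp: m(2) indicator_def)
  also have "... \<le> (\<Sum>n<Suc m. real n powr (\<beta> - 1))"
    by (intro sum_mono2) auto
  also have "... \<le> 1 / \<beta> * real m powr \<beta>" by (rule le)
  also have "... \<le> 1 / \<beta> * y powr \<beta>"
    using assms m by (intro mult_left_mono powr_mono2) auto
  finally show "(\<Sum>n<k. real n powr (\<beta> - 1) * indicator {..y} (real n)) \<le> 1 / \<beta> * y powr \<beta>" .
qed auto

lemma inverse_Suc_le_ln:
  assumes "n \<ge> (1::nat)"
  shows "1 / real (Suc n) \<le> ln (real (Suc n)) - ln (real n)"
proof -
  have "ln (real n) - ln (real (Suc n)) = ln (1 + (- 1 / real (Suc n)))"
    using assms by (subst ln_divide_pos[symmetric]) (auto simp: field_simps intro!: arg_cong[of _ _ ln])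
  also have "... \<le> - 1 / real (Suc n)"
    using assms by (intro ln_add_one_self_le_self2) (auto simp: field_simps)
  finally show ?thesis by simp
qed

text \<open>A harmonic block depends only on the ratio of its ends, hence a bound in y alone. The
  upper end uses 1 + t so that this also holds near t = 0.\<close>

lemma sum_inverse_between:
  fixes t y :: real
  assumes "0 \<le> t" "1 \<le> y"
  shows "(\<Sum>n. ennreal (1 / real n * indicator {t<..y * (1 + t)} (real n))) \<le> ennreal (2 * ln (4 * y))"
proof (rule suminf_ennreal_le)
  fix k :: nat
  \<comment> \<open>The first integer beyond t; it is at least 1 and at least t, hence at least (1 +
    t) / 2. Together with N + 1 \<le> 2y(1 + t) this produces the 4 in the logarithm.\<close>
  define m where "m = nat \<lfloor>t\<rfloor> + 1"
  define N where "N = nat \<lfloor>y * (1 + t)\<rfloor>"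
  have yt: "y * (1 + t) \<ge> 1 + t" using assms by (simp add: mult_right_mono[of 1 y "1+t", simplified])
  have m: "m \<ge> 1" "\<And>n. t < real n \<longleftrightarrow> m \<le> n" "real m \<ge> (1 + t) / 2"
    subgoal by (simp add: m_def)
    subgoal using assms unfolding m_def by linarith
    subgoal
    proof -
      have "real m \<ge> 1" "real m \<ge> t" using assms unfolding m_def by linarith+
      then show ?thesis by simp
    qed
    done
  have N: "real N \<le> y * (1 + t)" "\<And>n. real n \<le> y * (1+t) \<longleftrightarrow> n \<le> N"
    using assms yt unfolding N_def by (linarith, linarith)
  have le: "(\<Sum>n=m..<j. 1 / real n) \<le> 2 * (ln (real (max j m)) - ln (real m))" for j
  proof (induction j)
    case (Suc j)
    show ?case
    proof (cases "j < m")
      case True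
      then show ?thesis by (auto simp: max_def)
    next
      case False
      then have j: "j \<ge> 1" "j \<ge> m" using m by auto
      have "1 / real j \<le> 2 / real (Suc j)" using j by (auto simp: field_simps)
      also have "... \<le> 2 * (ln (real (Suc j)) - ln (real j))"
        using inverse_Suc_le_ln[OF j(1)] by simp
      finally show ?thesis using Suc j by (simp add: max_def)
    qed
  qed (use m in auto)
  have "t \<le> y * (1 + t)" using yt by linarith
  then have mN: "m \<le> Suc N" unfolding m_def N_def by (simp add: nat_mono floor_mono)
  have "(\<Sum>n<k. 1 / real n * indicator {t<..y*(1+t)} (real n)) = (\<Sum>n\<in>{..<k} \<inter> {m..<Suc N}. 1 / real n)"
    by (rule sum.mono_neutral_cong_right) (auto simp: m(2) N(2) indicator_def not_le)
  also have "... \<le> (\<Sum>n=m..<Suc N. 1 / real n)" by (intro sum_mono2) auto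
  also have "... \<le> 2 * (ln (real (Suc N)) - ln (real m))" using le[of "Suc N"] mN by (simp add: max_def)
  also have "... = 2 * ln (real (Suc N) / real m)" using m by (simp add: ln_div)
  also have "... \<le> 2 * ln (4 * y)"
  proof -
    have "real (Suc N) \<le> 4 * y * ((1 + t) / 2)" using N(1) yt assms by (simp add: field_simps)
    also have "... \<le> 4 * y * real m" using m assms by (intro mult_left_mono) auto
    finally show ?thesis using m assms by (auto simp: field_simps)
  qed
  finally show "(\<Sum>n<k. 1 / real n * indicator {t<..y*(1+t)} (real n)) \<le> 2 * ln (4 * y)" .
qed auto

lemma ln_le_sum_inverse:
  fixes y :: real
  assumes "1 \<le> y"
  shows "ennreal (ln y) \<le> (\<Sum>n. ennreal (1 / real n * indicator {..y} (real n)))"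
proof -
  have le: "ln (real (Suc j)) \<le> (\<Sum>n<Suc j. 1 / real n)" for j :: nat
  proof (induction j)
    case (Suc j)
    have "ln (real (Suc (Suc j))) - ln (real (Suc j)) = ln (1 + 1 / real (Suc j))"
      by (subst ln_divide_pos[symmetric]) (auto simp: field_simps)
    also have "... \<le> 1 / real (Suc j)" by (intro ln_add_one_self_le_self) auto
    finally show ?case using Suc by simp
  qed simp
  define m where "m = nat \<lfloor>y\<rfloor>"
  have m: "y \<le> real (Suc m)" "\<And>n. real n \<le> y \<longleftrightarrow> n \<le> m"
    using assms unfolding m_def by linarith+
  have "ln y \<le> (\<Sum>n<Suc m. 1 / real n)"
    using le[of m] m(1) assms by (smt (verit) ln_mono)
  also have "... = (\<Sum>n<Suc m. 1 / real n * indicator {..y} (real n))"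
    by (intro sum.cong) (auto simp: m(2))
  finally have "ennreal (ln y) \<le> (\<Sum>n<Suc m. ennreal (1 / real n * indicator {..y} (real n)))"
    by (subst sum_ennreal) (auto intro: ennreal_leI)
  also have "... \<le> (\<Sum>n. ennreal (1 / real n * indicator {..y} (real n)))"
    by (intro sum_le_suminf) auto
  finally show ?thesis .
qed

text \<open>The block {N..2N} has more than N terms, each at least the one at 2N. Such blocks
  recover N^(-r) from the weights and serve for all lower bounds with \<open>wt\<close>.\<close>

lemma powr_block_lower:
  fixes r :: real
  assumes "N \<ge> 1" "r > 0"
  shows "2 powr (-1 - r) * real N powr (-r) \<le> (\<Sum>n=N..2*N. real n powr (-1 - r))"
proof -
  have "2 powr (-1 - r) * real N powr (-r) = real N * (2 * real N) powr (-1 - r)"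
    using assms by (simp add: powr_mult powr_diff powr_minus field_simps)
  also have "... \<le> real (card {N..2*N}) * (2 * real N) powr (-1 - r)"
    by (intro mult_right_mono) auto
  also have "... = (\<Sum>n=N..2*N. (2 * real N) powr (-1 - r))" by simp
  also have "... \<le> (\<Sum>n=N..2*N. real n powr (-1 - r))"
    using assms by (intro sum_mono powr_mono2') auto
  finally show ?thesis .
qed

subsection \<open>Maximal inequalities for weighted partial sums\<close>

abbreviation tint :: "(real \<Rightarrow> ennreal) \<Rightarrow> ennreal" where
  "tint F \<equiv> (\<integral>\<^sup>+t. F t * indicator {0..} t \<partial>lborel)"

text \<open>The l1 norm, over the coordinates in I, of the increment of the walk between times J and
  K; \<open>h n j (x j)\<close> is coordinate n of step j. A single coordinate gives the absolute
  value of an ordinary partial sum, so the maximal inequalities below serve both the l1 walk and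
  real sums.\<close>

definition blk :: "(nat \<Rightarrow> nat \<Rightarrow> real \<Rightarrow> real) \<Rightarrow> nat set \<Rightarrow> (nat \<Rightarrow> real) \<Rightarrow> nat \<Rightarrow> nat \<Rightarrow> real" where
  "blk h I x J K = (\<Sum>n\<in>I. \<bar>\<Sum>j\<in>{J<..K}. h n j (x j)\<bar>)"

lemma blk_nonneg: "0 \<le> blk h I x J K"
  by (simp add: blk_def sum_nonneg)

lemma blk_self [simp]: "blk h I x J J = 0"
  by (simp add: blk_def)

lemma blk_cong: "(\<And>j. J < j \<Longrightarrow> j \<le> K \<Longrightarrow> x j = y j) \<Longrightarrow> blk h I x J K = blk h I y J K"
  by (simp add: blk_def)

lemma sum_greaterThanAtMost_split:
  fixes f :: "nat \<Rightarrow> real"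
  assumes "J \<le> K"
  shows "sum f {0<..K} = sum f {0<..J} + sum f {J<..K}"
proof -
  have "{0<..K} = {0<..J} \<union> {J<..K}" using assms by auto
  then show ?thesis by (simp add: sum.union_disjoint)
qed

lemma blk_triangle:
  assumes "J \<le> K"
  shows "blk h I x 0 K \<le> blk h I x 0 J + blk h I x J K"
    and "blk h I x 0 J \<le> blk h I x 0 K + blk h I x J K"
    and "blk h I x J K \<le> blk h I x 0 J + blk h I x 0 K"
  unfolding blk_def sum.distrib[symmetric]
  by (rule sum_mono, simp add: sum_greaterThanAtMost_split[OF assms])+

lemma blk_Suc:
  "blk h I x 0 (Suc J) \<le> blk h I x 0 J + (\<Sum>n\<in>I. \<bar>h n (Suc J) (x (Suc J))\<bar>)"
  using blk_triangle(1)[of J "Suc J" h I x] by (simp add: blk_def greaterThanAtMost_upt)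

section \<open>First passage and maximal inequalities for walks with independent steps\<close>

locale iid_seq = prob_space M for M :: "'a measure" +
  fixes X :: "'a \<Rightarrow> real" and Xs :: "nat \<Rightarrow> 'a \<Rightarrow> real"
  assumes rv_X [measurable]: "X \<in> borel_measurable M"
    and rv_Xs: "\<And>n. n \<ge> 1 \<Longrightarrow> Xs n \<in> borel_measurable M"
    and indep: "indep_vars (\<lambda>_. borel) Xs {1..}"
    and ident: "\<And>n. n \<ge> 1 \<Longrightarrow> distr M borel (Xs n) = distr M borel X"
begin

abbreviation absE :: "('a \<Rightarrow> real) \<Rightarrow> ennreal" where
  "absE f \<equiv> (\<integral>\<^sup>+w. ennreal \<bar>f w\<bar> \<partial>M)"

abbreviation pX :: "real \<Rightarrow> real" where "pX \<equiv> tailp M X"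

abbreviation path :: "'a \<Rightarrow> nat \<Rightarrow> real" where "path w \<equiv> (\<lambda>j. Xs j w)"

abbreviation exceed :: "(nat \<Rightarrow> nat \<Rightarrow> real \<Rightarrow> real) \<Rightarrow> nat set \<Rightarrow> nat \<Rightarrow> real \<Rightarrow> 'a set" where
  "exceed h I L t \<equiv> {w\<in>space M. \<exists>J\<in>{1..L}. blk h I (path w) 0 J > t}"

lemma rv_comp:
  assumes "f \<in> borel_measurable borel" "j \<ge> 1"
  shows "(\<lambda>w. f (Xs j w)) \<in> borel_measurable M"
  using measurable_compose[OF rv_Xs[OF assms(2)] assms(1)] .

lemma rv_blk:
  assumes "\<And>n j. h n j \<in> borel_measurable borel"
  shows "(\<lambda>w. blk h I (path w) J K) \<in> borel_measurable M"
  unfolding blk_def using assms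
  by (intro borel_measurable_sum borel_measurable_abs rv_comp) auto

lemma PiM_blk:
  assumes "\<And>n j. h n j \<in> borel_measurable borel" "{J<..K} \<subseteq> A"
  shows "(\<lambda>x. blk h I x J K) \<in> borel_measurable (PiM A (\<lambda>_. borel))"
  unfolding blk_def using assms
  by (intro borel_measurable_sum borel_measurable_abs
      measurable_compose[OF measurable_component_singleton]) auto

text \<open>Disjoint index blocks of an independent family are independent as vectors;
  \<open>restrict\<close> places them in the product spaces on which P and Q are measurable.\<close>

lemma prob_split:
  assumes P: "Measurable.pred (PiM {1..J} (\<lambda>_. borel :: real measure)) P"
    and Q: "Measurable.pred (PiM {J<..L} (\<lambda>_. borel :: real measure)) Q"
  shows "\<P>(w in M. P (restrict (path w) {1..J}) \<and> Q (restrict (path w) {J<..L}))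
    = \<P>(w in M. P (restrict (path w) {1..J})) * \<P>(w in M. Q (restrict (path w) {J<..L}))"
proof -
  have iv: "indep_var (PiM {1..J} (\<lambda>_. borel)) (\<lambda>w. restrict (path w) {1..J})
      (PiM {J<..L} (\<lambda>_. borel)) (\<lambda>w. restrict (path w) {J<..L})"
    by (rule indep_var_restrict[OF indep]) auto
  have sp: "restrict (path w) A \<in> space (PiM A (\<lambda>_. borel))" for w A
    by (simp add: space_PiM)
  let ?A = "{x \<in> space (PiM {1..J} (\<lambda>_. borel :: real measure)). P x}"
  let ?B = "{x \<in> space (PiM {J<..L} (\<lambda>_. borel :: real measure)). Q x}"
  have "prob ((\<lambda>w. (restrict (path w) {1..J}, restrict (path w) {J<..L})) -` (?A \<times> ?B) \<inter> space M) =
    prob ((\<lambda>w. restrict (path w) {1..J}) -` ?A \<inter> space M) *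
    prob ((\<lambda>w. restrict (path w) {J<..L}) -` ?B \<inter> space M)"
    using P Q by (intro indep_varD[OF iv]) (auto simp: pred_def)
  moreover have "(\<lambda>w. (restrict (path w) {1..J}, restrict (path w) {J<..L})) -` (?A \<times> ?B) \<inter> space M =
    {w\<in>space M. P (restrict (path w) {1..J}) \<and> Q (restrict (path w) {J<..L})}"
    "(\<lambda>w. restrict (path w) {1..J}) -` ?A \<inter> space M = {w\<in>space M. P (restrict (path w) {1..J})}"
    "(\<lambda>w. restrict (path w) {J<..L}) -` ?B \<inter> space M = {w\<in>space M. Q (restrict (path w) {J<..L})}"
    using sp by auto
  ultimately show ?thesis by simp
qed

text \<open>First passage over level t at time J. These events for J in {1..L} partition
  \<open>exceed h I L t\<close>, and each depends on the first J steps only, so it is independent of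
  every increment after J.\<close>

definition fpass :: "(nat \<Rightarrow> nat \<Rightarrow> real \<Rightarrow> real) \<Rightarrow> nat set \<Rightarrow> real \<Rightarrow> nat \<Rightarrow> 'a set" where
  "fpass h I t J = {w\<in>space M. (\<forall>i\<in>{1..<J}. blk h I (path w) 0 i \<le> t) \<and> blk h I (path w) 0 J > t}"

lemma fpass_sets:
  assumes [measurable]: "\<And>n j. h n j \<in> borel_measurable borel"
  shows "fpass h I t J \<in> sets M"
proof -
  note rv_blk[OF assms, measurable]
  show ?thesis unfolding fpass_def by measurable
qed

lemma disjoint_fpass: "disjoint_family_on (fpass h I t) {1..L}"
  unfolding disjoint_family_on_def
proof (intro ballI impI)
  fix m n assume *: "m \<in> {1..L}" "n \<in> {1..L}" "m \<noteq> n"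
  show "fpass h I t m \<inter> fpass h I t n = {}"
  proof (cases "m < n")
    case True
    with * show ?thesis by (force simp: fpass_def)
  next
    case False
    with * have "n < m" by auto
    with * show ?thesis by (force simp: fpass_def)
  qed
qed

lemma UN_fpass:
  "(\<Union>J\<in>{1..L}. fpass h I t J) = exceed h I L t" (is "?A = ?B")
proof
  show "?A \<subseteq> ?B" by (auto simp: fpass_def)
  show "?B \<subseteq> ?A"
  proof
    fix w assume w: "w \<in> ?B"
    let ?P = "\<lambda>J. J \<in> {1..L} \<and> blk h I (path w) 0 J > t"
    have "\<exists>J. ?P J" using w by auto
    then obtain J where J: "?P J" and least: "\<And>i. i < J \<Longrightarrow> \<not> ?P i"
      using exists_least_iff[of ?P] by blast
    have "blk h I (path w) 0 i \<le> t" if "i \<in> {1..<J}" for i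
      using least[of i] that J by auto
    with J w have "w \<in> fpass h I t J" by (auto simp: fpass_def)
    with J show "w \<in> ?A" by blast
  qed
qed

lemma prob_UN_fpass:
  assumes "\<And>n j. h n j \<in> borel_measurable borel"
  shows "prob (exceed h I L t) = (\<Sum>J=1..L. prob (fpass h I t J))"
  unfolding UN_fpass[symmetric] using fpass_sets[OF assms]
  by (intro finite_measure_finite_Union disjoint_fpass) auto

lemma sum_prob_fpass_le:
  assumes h: "\<And>n j. h n j \<in> borel_measurable borel" and B: "B \<in> sets M"
  shows "(\<Sum>J=1..L. prob (fpass h I t J \<inter> B)) \<le> prob B"
proof -
  have "(\<Sum>J=1..L. prob (fpass h I t J \<inter> B)) = prob (\<Union>J\<in>{1..L}. fpass h I t J \<inter> B)"
    using disjoint_fpass[of h I t L] B fpass_sets[OF h]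
    by (intro finite_measure_finite_Union[symmetric]) (auto simp: disjoint_family_on_def)
  also have "... \<le> prob B" using B by (intro finite_measure_mono) auto
  finally show ?thesis .
qed

text \<open>A set \<open>Ks\<close> of later times is allowed so that one statement serves both
  maximal inequalities: Ottaviani uses {L}, Hoffmann-Joergensen uses {J..L}.\<close>

lemma fpass_indep:
  assumes h: "\<And>n j. h n j \<in> borel_measurable borel" and J: "J \<ge> 1" and Ks: "Ks \<subseteq> {J..L}"
  shows "prob (fpass h I t J \<inter> {w\<in>space M. \<exists>K\<in>Ks. blk h I (path w) J K > s})
    = prob (fpass h I t J) * \<P>(w in M. \<exists>K\<in>Ks. blk h I (path w) J K > s)"
proof -
  let ?P = "\<lambda>x. (\<forall>i\<in>{1..<J}. blk h I x 0 i \<le> t) \<and> blk h I x 0 J > t"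
  let ?Q = "\<lambda>x. \<exists>K\<in>Ks. blk h I x J K > s"
  have fin: "finite Ks" using Ks finite_subset by blast
  have 1: "Measurable.pred (PiM {1..J} (\<lambda>_. borel)) ?P"
    unfolding not_less[symmetric]
    by (intro pred_intros_logic pred_intros_finite borel_measurable_pred_less
        PiM_blk h measurable_const) auto
  have 2: "Measurable.pred (PiM {J<..L} (\<lambda>_. borel)) ?Q"
    using fin Ks by (intro pred_intros_finite borel_measurable_pred_less PiM_blk h measurable_const) auto
  have b1: "blk h I (restrict (path w) {1..J}) 0 i = blk h I (path w) 0 i" if "i \<le> J" for i w
    using that by (intro blk_cong) auto
  have P: "?P (restrict (path w) {1..J}) \<longleftrightarrow> ?P (path w)" for w
    using b1 J by auto
  have Q: "?Q (restrict (path w) {J<..L}) \<longleftrightarrow> ?Q (path w)" for w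
    using Ks by (intro bex_cong refl arg_cong2[where f="(<)"] blk_cong) auto
  show ?thesis
  proof -
    have "fpass h I t J \<inter> {w\<in>space M. ?Q (path w)} = {w\<in>space M. ?P (path w) \<and> ?Q (path w)}"
      by (auto simp: fpass_def)
    then show ?thesis using prob_split[OF 1 2] unfolding P Q fpass_def by simp
  qed
qed

text \<open>After the first passage over t + s at time J, the final norm still exceeds t unless the
  increment from J to L exceeds s. That exception is independent of the passage and has probability
  at most q; summing over J gives the claim.\<close>

lemma ottaviani:
  assumes h: "\<And>n j. h n j \<in> borel_measurable borel"
    and q: "\<And>J. J \<in> {1..L} \<Longrightarrow> \<P>(w in M. blk h I (path w) J L > s) \<le> q"
  shows "(1 - q) * prob (exceed h I L (t + s))
    \<le> \<P>(w in M. blk h I (path w) 0 L > t)"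
proof -
  note rv_blk[OF h, measurable] fpass_sets[OF h, measurable]
  let ?B = "{w\<in>space M. blk h I (path w) 0 L > t}"
  let ?E = "\<lambda>J. fpass h I (t + s) J"
  have *: "(1 - q) * prob (?E J) \<le> prob (?E J \<inter> ?B)" if J: "J \<in> {1..L}" for J
  proof -
    let ?R = "{w\<in>space M. \<exists>K\<in>{L}. blk h I (path w) J K > s}"
    have R: "prob ?R \<le> q" using q[OF J] by simp
    have "(1 - q) * prob (?E J) \<le> (1 - prob ?R) * prob (?E J)"
      using R by (intro mult_right_mono) auto
    also have "... = prob (?E J) - prob (?E J \<inter> ?R)"
      using fpass_indep[OF h, of J "{L}" L] J by (simp add: algebra_simps)
    also have "... = prob (?E J - ?R)"
    proof -
      have "?R \<in> events" by measurable
      then have "prob (?E J - ?R) = prob (?E J) - prob (?E J \<inter> ?R)"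
        by (intro finite_measure_Diff' fpass_sets h)
      then show ?thesis by simp
    qed
    also have "... \<le> prob (?E J \<inter> ?B)"
    proof (rule finite_measure_mono)
      show "?E J - ?R \<subseteq> ?E J \<inter> ?B"
      proof
        fix w assume "w \<in> ?E J - ?R"
        then have "w \<in> ?E J" "w \<in> space M" "blk h I (path w) 0 J > t + s" "blk h I (path w) J L \<le> s"
          by (auto simp: fpass_def)
        then show "w \<in> ?E J \<inter> ?B" using blk_triangle(2)[of J L h I "path w"] J by auto
      qed
      show "?E J \<inter> ?B \<in> events" by measurable
    qed
    finally show ?thesis .
  qed
  have "(1 - q) * prob (exceed h I L (t + s))
    = (\<Sum>J=1..L. (1 - q) * prob (?E J))"
    unfolding prob_UN_fpass[OF h] by (simp add: sum_distrib_left)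
  also have "... \<le> (\<Sum>J=1..L. prob (?E J \<inter> ?B))" by (intro sum_mono *) auto
  also have "... \<le> prob ?B" by (intro sum_prob_fpass_le h) measurable
  finally show ?thesis .
qed

text \<open>Before the first passage over t the norm is at most t, and the passing step adds at most
  c. Reaching t + c + 2m therefore needs a later increment above 2m, which forces the norm above m
  at one of its two ends. This has probability at most q and is independent of the passage.\<close>

lemma hoffmann_jorgensen_step:
  assumes h: "\<And>n j. h n j \<in> borel_measurable borel"
    and c: "\<And>j x. (\<Sum>n\<in>I. \<bar>h n j x\<bar>) \<le> c" and t: "0 \<le> t" and m: "0 \<le> m"
    and q: "prob (exceed h I L m) \<le> q"
  shows "prob (exceed h I L (t + (c + 2 * m)))
    \<le> q * prob (exceed h I L t)"
proof -
  note rv_blk[OF h, measurable] fpass_sets[OF h, measurable]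
  let ?B = "(exceed h I L (t + (c + 2 * m)))"
  let ?E = "\<lambda>J. fpass h I t J"
  have "c \<ge> 0" using order_trans[OF sum_nonneg c] by auto
  have *: "prob (?E J \<inter> ?B) \<le> q * prob (?E J)" if J: "J \<in> {1..L}" for J
  proof -
    let ?R = "{w\<in>space M. \<exists>K\<in>{J..L}. blk h I (path w) J K > 2 * m}"
    have "prob ?R \<le> prob (exceed h I L m)"
    proof (rule finite_measure_mono)
      show "?R \<subseteq> (exceed h I L m)"
      proof
        fix w assume "w \<in> ?R"
        then obtain K where K: "w \<in> space M" "K \<in> {J..L}" "blk h I (path w) J K > 2 * m" by auto
        with blk_triangle(3)[of J K h I "path w"]
        have "blk h I (path w) 0 J > m \<or> blk h I (path w) 0 K > m" by auto
        with K J show "w \<in> (exceed h I L m)" by auto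
      qed
    qed measurable
    then have R: "prob ?R \<le> q" using q by simp
    have "prob (?E J \<inter> ?B) \<le> prob (?E J \<inter> ?R)"
    proof (rule finite_measure_mono)
      show "?E J \<inter> ?B \<subseteq> ?E J \<inter> ?R"
      proof
        fix w assume "w \<in> ?E J \<inter> ?B"
        then obtain K where w: "w \<in> ?E J" "w \<in> space M" "K \<in> {1..L}" "blk h I (path w) 0 K > t + (c + 2 * m)"
          and f: "\<And>i. i \<in> {1..<J} \<Longrightarrow> blk h I (path w) 0 i \<le> t"
          by (auto simp: fpass_def)
        have "w \<in> ?R"
        proof -
          have JK: "J \<le> K"
          proof (rule ccontr)
            assume "\<not> J \<le> K"
            then have "blk h I (path w) 0 K \<le> t" using w by (intro f) auto
            then show False using w m \<open>c \<ge> 0\<close> by linarith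
          qed
          obtain J' where J': "J = Suc J'" using J by (cases J) auto
          \<comment> \<open>At J' = 0 no earlier time is available: the walk is at the origin and
            \<open>0 \<le> t\<close> is what counts.\<close>
          have "blk h I (path w) 0 J' \<le> t" using f[of J'] t J' by (cases "J' = 0") auto
          then have "blk h I (path w) 0 J \<le> t + c"
            using blk_Suc[of h I "path w" J'] c[of "Suc J'" "Xs (Suc J') w"] J' by auto
          then have "blk h I (path w) J K > 2 * m"
            using w blk_triangle(1)[OF JK, of h I "path w"] by linarith
          then show ?thesis using JK w by auto
        qed
        then show "w \<in> ?E J \<inter> ?R" using w by blast
      qed
    qed measurable
    also have "... = prob (?E J) * prob ?R" using fpass_indep[OF h, of J "{J..L}" L] J by simp
    also have "... \<le> prob (?E J) * q" using R by (intro mult_left_mono) auto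
    finally show ?thesis by (simp add: mult.commute)
  qed
  have "?B \<subseteq> (\<Union>J\<in>{1..L}. ?E J)"
  proof
    fix w assume "w \<in> ?B"
    then show "w \<in> (\<Union>J\<in>{1..L}. ?E J)" unfolding UN_fpass using m \<open>c \<ge> 0\<close> by force
  qed
  then have c2: "?B \<subseteq> (\<Union>J\<in>{1..L}. ?E J \<inter> ?B)" by auto
    have "prob ?B \<le> prob (\<Union>J\<in>{1..L}. ?E J \<inter> ?B)"
      using c2 by (intro finite_measure_mono) auto
    also have "... \<le> (\<Sum>J=1..L. prob (?E J \<inter> ?B))"
      by (intro finite_measure_subadditive_finite) auto
    also have "... \<le> (\<Sum>J=1..L. q * prob (?E J))" by (intro sum_mono *) auto
    also have "... = q * prob (exceed h I L t)"
      unfolding prob_UN_fpass[OF h] by (simp add: sum_distrib_left)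
    finally show ?thesis .
qed

text \<open>Iterating the step with d = c + 2m shows that level k d is exceeded with probability at
  most 4^(-k). The geometric series makes the mean at most 4d/3, rounded up to 2d. The bound
  involves neither L nor the number of coordinates.\<close>

lemma hoffmann_jorgensen:
  assumes h: "\<And>n j. h n j \<in> borel_measurable borel"
    and c: "\<And>j x. (\<Sum>n\<in>I. \<bar>h n j x\<bar>) \<le> c" and m: "0 < m"
    and q: "prob (exceed h I L m) \<le> 1 / 4"
  shows "(\<integral>\<^sup>+w. ennreal (blk h I (path w) 0 L) \<partial>M) \<le> ennreal (2 * (c + 2 * m))"
proof (cases "L = 0")
  case False
  note rv_blk[OF h, measurable]
  define d where "d = c + 2 * m"
  have "c \<ge> 0" using order_trans[OF sum_nonneg c] by auto
  then have d: "d > 0" using m by (simp add: d_def)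
  define A where "A k = (exceed h I L (real k * d))" for k :: nat
  have [measurable]: "A k \<in> events" for k unfolding A_def by measurable
  have A: "prob (A k) \<le> (1/4) ^ k" for k
  proof (induction k)
    case (Suc k)
    have "prob (A (Suc k)) \<le> 1 / 4 * prob (A k)"
    proof -
      have e: "real (Suc k) * d = real k * d + (c + 2 * m)" by (simp add: d_def algebra_simps)
      show ?thesis unfolding A_def e using m d by (intro hoffmann_jorgensen_step[OF h c _ _ q]) auto
    qed
    with Suc show ?case by simp
  qed simp
  \<comment> \<open>The final norm is at most d times the number of levels k d that it exceeds;
    \<open>k0\<close> is that number.\<close>
  have pw: "ennreal (blk h I (path w) 0 L) \<le> (\<Sum>k. ennreal d * indicator (A k) w)" if w: "w \<in> space M" for w
  proof -
    define b where "b = blk h I (path w) 0 L"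
    define k0 where "k0 = nat \<lceil>b / d\<rceil>"
    have b: "b \<ge> 0" by (simp add: b_def blk_nonneg)
    have lt: "real k * d < b" if "k < k0" for k
      using that d unfolding k0_def by (simp add: pos_less_divide_eq[symmetric]) linarith
    \<comment> \<open>The end point J = L witnesses the exceedance, which is where L \<noteq> 0
      enters.\<close>
    have inA: "w \<in> A k" if "k < k0" for k
      using lt[OF that] w False by (auto simp: A_def b_def intro!: bexI[of _ L])
    have "b / d \<le> real k0" using b d unfolding k0_def by (intro real_nat_ceiling_ge)
    then have "b \<le> real k0 * d" using d by (simp add: field_simps)
    then have "ennreal b \<le> (\<Sum>k<k0. ennreal d)"
      using d by (auto simp: ennreal_of_nat_eq_real_of_nat ennreal_mult[symmetric] intro: ennreal_leI)
    also have "... = (\<Sum>k<k0. ennreal d * indicator (A k) w)" using inA by (intro sum.cong) auto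
    also have "... \<le> (\<Sum>k. ennreal d * indicator (A k) w)" by (intro sum_le_suminf) auto
    finally show ?thesis unfolding b_def .
  qed
  have "(\<integral>\<^sup>+w. ennreal (blk h I (path w) 0 L) \<partial>M) \<le> (\<integral>\<^sup>+w. (\<Sum>k. ennreal d * indicator (A k) w) \<partial>M)"
    by (intro nn_integral_mono pw)
  also have "... = (\<Sum>k. ennreal d * emeasure M (A k))"
    by (subst nn_integral_suminf) (auto simp: nn_integral_cmult)
  also have "... = (\<Sum>k. ennreal (d * prob (A k)))"
    using d by (simp add: emeasure_eq_measure ennreal_mult)
  also have "... \<le> ennreal (2 * d)"
  proof (rule suminf_ennreal_le)
    fix K :: nat
    have "(\<Sum>k<K. d * prob (A k)) \<le> (\<Sum>k<K. d * (1/4) ^ k)"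
      using d A by (intro sum_mono mult_left_mono) auto
    also have "... = d * (\<Sum>k<K. (1/4) ^ k)" by (simp add: sum_distrib_left)
    also have "(\<Sum>k<K. (1/4) ^ k) = (4/3) * (1 - (1/4::real) ^ K)"
      by (induction K) auto
    also have "d * ... \<le> d * 2"
    proof (rule mult_left_mono)
      have *: "4 / 3 * (1 - z) \<le> 2" if "z \<ge> 0" for z :: real using that by simp
      show "4 / 3 * (1 - (1/4::real) ^ K) \<le> 2" by (rule *, rule zero_le_power) simp
    qed (use d in simp)
    finally show "(\<Sum>k<K. d * prob (A k)) \<le> 2 * d" by simp
  qed (use d in auto)
  finally show ?thesis by (simp add: d_def)
qed simp

section \<open>Shift invariance of the law of the path\<close>

lemma law_path:
  assumes "A \<subseteq> {1..}" "A \<noteq> {}"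
  shows "distr M (PiM A (\<lambda>_. borel)) (\<lambda>w. restrict (path w) A) = PiM A (\<lambda>_. distr M borel X)"
proof -
  have "indep_vars (\<lambda>_. borel) Xs A" using indep assms(1) by (rule indep_vars_subset)
  then have "distr M (PiM A (\<lambda>_. borel)) (\<lambda>w. restrict (path w) A) = PiM A (\<lambda>i. distr M borel (Xs i))"
    using assms rv_Xs by (subst (asm) indep_vars_iff_distr_eq_PiM') auto
  also have "... = PiM A (\<lambda>_. distr M borel X)"
    using assms ident by (intro PiM_cong) auto
  finally show ?thesis .
qed

text \<open>Both sides are the m-fold product of the law of X: the shifted block is a block
  {J+1..J+m} of the path, and relabelling the factors of a product of equal measures does not change
  it.\<close>

lemma law_shift:
  assumes "m \<ge> 1"
  shows "distr M (PiM {1..m} (\<lambda>_. borel)) (\<lambda>w. \<lambda>i\<in>{1..m}. Xs (J + i) w)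
    = distr M (PiM {1..m} (\<lambda>_. borel)) (\<lambda>w. restrict (path w) {1..m})"
proof -
  let ?\<mu> = "distr M borel X"
  let ?K = "{J + 1..J + m}"
  let ?f = "\<lambda>x :: nat \<Rightarrow> real. \<lambda>i\<in>{1..m}. x (J + i)"
  interpret \<mu>: prob_space ?\<mu> by (rule prob_space_distr) measurable
  have f: "?f \<in> measurable (PiM ?K (\<lambda>_. borel)) (PiM {1..m} (\<lambda>_. borel))"
    by (intro measurable_restrict measurable_component_singleton) auto
  have r: "(\<lambda>w. restrict (path w) ?K) \<in> measurable M (PiM ?K (\<lambda>_. borel))"
    by (intro measurable_restrict rv_Xs) auto
  have "distr M (PiM {1..m} (\<lambda>_. borel)) (\<lambda>w. \<lambda>i\<in>{1..m}. Xs (J + i) w)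
    = distr M (PiM {1..m} (\<lambda>_. borel)) (?f \<circ> (\<lambda>w. restrict (path w) ?K))"
    by (intro distr_cong) (auto simp: fun_eq_iff)
  also have "... = distr (distr M (PiM ?K (\<lambda>_. borel)) (\<lambda>w. restrict (path w) ?K)) (PiM {1..m} (\<lambda>_. borel)) ?f"
    by (rule distr_distr[symmetric, OF f r])
  also have "... = distr (PiM ?K (\<lambda>_. ?\<mu>)) (PiM {1..m} (\<lambda>_. borel)) ?f"
    using assms by (subst law_path) auto
  also have "... = distr (PiM ?K (\<lambda>_. ?\<mu>)) (PiM {1..m} (\<lambda>_. ?\<mu>)) ?f"
    by (intro distr_cong refl sets_PiM_cong) auto
  also have "... = PiM {1..m} (\<lambda>_. ?\<mu>)"
    by (rule distr_PiM_reindex) (auto intro: inj_onI \<mu>.prob_space_axioms)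
  also have "... = distr M (PiM {1..m} (\<lambda>_. borel)) (\<lambda>w. restrict (path w) {1..m})"
    using assms by (intro law_path[symmetric]) auto
  finally show ?thesis .
qed

lemma prob_shift:
  assumes "m \<ge> 1" and Q: "Measurable.pred (PiM {1..m} (\<lambda>_. borel :: real measure)) Q"
  shows "\<P>(w in M. Q (\<lambda>i\<in>{1..m}. Xs (J + i) w)) = \<P>(w in M. Q (restrict (path w) {1..m}))"
proof -
  let ?P = "PiM {1..m} (\<lambda>_. borel :: real measure)"
  let ?S = "{x \<in> space ?P. Q x}"
  have S: "?S \<in> sets ?P" using Q by (simp add: pred_def)
  have 1: "(\<lambda>w. \<lambda>i\<in>{1..m}. Xs (J + i) w) \<in> measurable M ?P"
    by (intro measurable_restrict rv_Xs) auto
  have 2: "(\<lambda>w. restrict (path w) {1..m}) \<in> measurable M ?P"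
    by (intro measurable_restrict rv_Xs) auto
  have "measure (distr M ?P (\<lambda>w. \<lambda>i\<in>{1..m}. Xs (J + i) w)) ?S = measure (distr M ?P (\<lambda>w. restrict (path w) {1..m})) ?S"
    using law_shift[OF assms(1), of J] by simp
  then have "prob ((\<lambda>w. \<lambda>i\<in>{1..m}. Xs (J + i) w) -` ?S \<inter> space M) = prob ((\<lambda>w. restrict (path w) {1..m}) -` ?S \<inter> space M)"
    using S 1 2 by (simp add: measure_distr)
  moreover have "(\<lambda>w. \<lambda>i\<in>{1..m}. Xs (J + i) w) -` ?S \<inter> space M = {w\<in>space M. Q (\<lambda>i\<in>{1..m}. Xs (J + i) w)}"
    "(\<lambda>w. restrict (path w) {1..m}) -` ?S \<inter> space M = {w\<in>space M. Q (restrict (path w) {1..m})}"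
    by (auto simp: space_PiM)
  ultimately show ?thesis by simp
qed

text \<open>The tail of the weighted sequence of partial sums after time J is dominated in law by the
  whole sequence because the weights decrease.\<close>

lemma weighted_tail_prob_le:
  assumes a: "\<And>n. 0 \<le> a n" and dec: "\<And>n m. 1 \<le> n \<Longrightarrow> n \<le> m \<Longrightarrow> a m \<le> a n"
  defines "h \<equiv> (\<lambda>n j x. if j \<le> n then a n * x else 0)"
  assumes J: "J \<in> {1..L}" and s: "0 \<le> s"
  shows "\<P>(w in M. blk h {1..L} (path w) J L > s) \<le> \<P>(w in M. blk h {1..L} (path w) 0 L > s)"
proof (cases "J = L")
  case True
  then show ?thesis using s by simp
next
  case False
  define m where "m = L - J"
  have m: "m \<ge> 1" "L = J + m" using J False by (auto simp: m_def)
  have meas: "\<And>n j. h n j \<in> borel_measurable borel" unfolding h_def by measurable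
  \<comment> \<open>At time J a fresh walk starts. Coordinates n \<le> J no longer move, and
    coordinate J + n sees the first n new steps, still with its own weight a(J + n). Replacing that
    weight by a(n) gives the norm of the whole walk cut down to m coordinates.\<close>
  define g where "g x = (\<Sum>n\<in>{1..m}. a (J + n) * \<bar>\<Sum>j\<in>{1..n}. x j\<bar>)" for x :: "nat \<Rightarrow> real"
  have row: "\<bar>\<Sum>j\<in>{J<..L}. h n j (x j)\<bar> = a n * \<bar>\<Sum>j\<in>{J<..n}. x j\<bar>" if "n \<le> L" for n x J
  proof -
    have "(\<Sum>j\<in>{J<..L}. h n j (x j)) = (\<Sum>j\<in>{J<..n}. a n * x j)"
      using that by (intro sum.mono_neutral_cong_right) (auto simp: h_def)
    then show ?thesis using a by (simp add: sum_distrib_left[symmetric] abs_mult)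
  qed
  have 1: "blk h {1..L} x J L = g (\<lambda>i. x (J + i))" for x
  proof -
    have "blk h {1..L} x J L = (\<Sum>n\<in>{1..L}. a n * \<bar>\<Sum>j\<in>{J<..n}. x j\<bar>)"
      unfolding blk_def by (intro sum.cong row) auto
    also have "... = (\<Sum>n\<in>{J+1..J+m}. a n * \<bar>\<Sum>j\<in>{J<..n}. x j\<bar>)"
      using m by (intro sum.mono_neutral_right) auto
    also have "... = (\<Sum>n\<in>{1..m}. a (J + n) * \<bar>\<Sum>j\<in>{J<..J + n}. x j\<bar>)"
      by (rule sum.reindex_bij_witness[of _ "\<lambda>n. J + n" "\<lambda>n. n - J"]) auto
    also have "... = g (\<lambda>i. x (J + i))"
      unfolding g_def
      by (intro sum.cong arg_cong2[where f="(*)"] arg_cong[of _ _ abs] refl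
        sum.reindex_bij_witness[of _ "\<lambda>n. J + n" "\<lambda>n. n - J"]) auto
    finally show ?thesis .
  qed
  have 2: "g x \<le> blk h {1..L} x 0 L" for x
  proof -
    have "g x \<le> (\<Sum>n\<in>{1..m}. a n * \<bar>\<Sum>j\<in>{1..n}. x j\<bar>)"
      unfolding g_def by (intro sum_mono mult_right_mono dec) auto
    also have "... \<le> (\<Sum>n\<in>{1..L}. a n * \<bar>\<Sum>j\<in>{1..n}. x j\<bar>)"
      using m a by (intro sum_mono2) auto
    also have "... = blk h {1..L} x 0 L"
      unfolding blk_def by (intro sum.cong refl, subst row) (auto intro!: sum.cong arg_cong2[where f="(*)"] arg_cong[of _ _ abs])
    finally show ?thesis .
  qed
  have gcong: "g (restrict x {1..m}) = g x" for x
    unfolding g_def by (intro sum.cong arg_cong2[where f="(*)"] arg_cong[of _ _ abs] refl) auto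
  have g: "g \<in> borel_measurable (PiM {1..m} (\<lambda>_. borel))"
    unfolding g_def by (intro borel_measurable_sum borel_measurable_times borel_measurable_abs
      borel_measurable_const measurable_component_singleton) auto
  then have P: "Measurable.pred (PiM {1..m} (\<lambda>_. borel)) (\<lambda>x. s < g x)"
    by measurable
  have "\<P>(w in M. blk h {1..L} (path w) J L > s) = \<P>(w in M. s < g (\<lambda>i\<in>{1..m}. Xs (J + i) w))"
    unfolding 1 gcong ..
  also have "... = \<P>(w in M. s < g (restrict (path w) {1..m}))"
    by (rule prob_shift[OF m(1) P])
  also have "... \<le> \<P>(w in M. blk h {1..L} (path w) 0 L > s)"
  proof (rule finite_measure_mono)
    show "{w\<in>space M. s < g (restrict (path w) {1..m})} \<subseteq> {w\<in>space M. blk h {1..L} (path w) 0 L > s}"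
      unfolding gcong using 2 by (auto intro: less_le_trans)
    show "{w\<in>space M. blk h {1..L} (path w) 0 L > s} \<in> events"
      using rv_blk[OF meas, measurable] by measurable
  qed
  finally show ?thesis .
qed

end

subsection \<open>Truncation and moments\<close>

text \<open>The two factors of the series merged into one power. At n = 0 it is 0, in agreement with
  the value of \<open>1 / real 0\<close>, so the index 0 drops out of every series.\<close>

definition wt :: "real \<Rightarrow> nat \<Rightarrow> real" where
  "wt p n = real n powr (-1 - 1 / p)"

definition trunc :: "real \<Rightarrow> nat \<Rightarrow> real \<Rightarrow> real" where
  "trunc p n x = x * indicator {y. \<bar>y\<bar> \<le> real n powr (1 / p)} x"

lemma wt_nonneg [simp]: "0 \<le> wt p n" and wt_0 [simp]: "wt p 0 = 0"
  by (simp_all add: wt_def)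

lemma wt_antimono: "0 < p \<Longrightarrow> 1 \<le> n \<Longrightarrow> n \<le> m \<Longrightarrow> wt p m \<le> wt p n"
proof -
  assume a: "0 < p" "1 \<le> n" "n \<le> m"
  then have "0 \<le> 1 / p" by simp
  then have "- 1 - 1 / p \<le> 0" by linarith
  then show ?thesis unfolding wt_def using a by (intro powr_mono2') auto
qed

lemma wt_eq: "1 / real n * (x / real n powr (1 / p)) = wt p n * x"
  by (cases "n = 0") (simp_all add: wt_def powr_diff powr_minus field_simps)

lemma trunc_measurable [measurable]: "trunc p n \<in> borel_measurable borel"
  unfolding trunc_def by measurable

lemma root_le_iff:
  fixes a b :: real
  assumes "0 < p" "0 \<le> a" "0 \<le> b"
  shows "a \<le> b powr (1 / p) \<longleftrightarrow> a powr p \<le> b"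
proof
  assume "a \<le> b powr (1 / p)"
  then have "a powr p \<le> (b powr (1 / p)) powr p" using assms by (intro powr_mono2) auto
  then show "a powr p \<le> b" using assms by (simp add: powr_powr)
next
  assume "a powr p \<le> b"
  then have "(a powr p) powr (1 / p) \<le> b powr (1 / p)" using assms by (intro powr_mono2) auto
  then show "a \<le> b powr (1 / p)" using assms by (simp add: powr_powr)
qed

text \<open>For fixed x the truncation becomes a threshold |x|^p \<le> n on the index, so sums over
  n turn into heads or tails of power sums.\<close>

lemma trunc_eq:
  assumes "0 < p"
  shows "trunc p n x = x * indicator {..real n} (\<bar>x\<bar> powr p)"
  using root_le_iff[of p "\<bar>x\<bar>" "real n"] assms by (auto simp: trunc_def indicator_def)

text \<open>The bound c on a single step that Hoffmann-Joergensen needs. Only n \<ge> |x|^p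
  contribute, and the tail of n^(-1-1/p) from there is of order p / |x|, which cancels the factor
  |x|.\<close>

lemma sum_wt_trunc_le:
  assumes "0 < p" "finite I"
  shows "(\<Sum>n\<in>I. wt p n * \<bar>trunc p n x\<bar>) \<le> 2 powr (1 + 1 / p) * p"
proof (cases "x = 0")
  case False
  define y where "y = \<bar>x\<bar> powr p"
  have y: "y > 0" using False by (simp add: y_def)
  have yr: "y powr - (1 / p) = 1 / \<bar>x\<bar>"
  proof -
    have "y powr - (1 / p) = \<bar>x\<bar> powr (p * - (1 / p))" unfolding y_def by (rule powr_powr)
    also have "p * - (1 / p) = - 1" using assms(1) by simp
    also have "\<bar>x\<bar> powr - 1 = 1 / \<bar>x\<bar>" using False by (intro powr_neg_one) simp
    finally show ?thesis .
  qed
  have row: "wt p n * \<bar>trunc p n x\<bar> = \<bar>x\<bar> * (wt p n * indicator {y..} (real n))" for n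
    using trunc_eq[OF assms(1), of n x] by (simp add: abs_mult y_def indicator_def)
  have "ennreal (\<Sum>n\<in>I. wt p n * \<bar>trunc p n x\<bar>)
    = ennreal (\<bar>x\<bar> * (\<Sum>n\<in>I. wt p n * indicator {y..} (real n)))"
    unfolding row sum_distrib_left ..
  also have "... = ennreal \<bar>x\<bar> * (\<Sum>n\<in>I. ennreal (wt p n * indicator {y..} (real n)))"
  proof -
    have "(\<Sum>n\<in>I. ennreal (wt p n * indicator {y..} (real n))) = ennreal (\<Sum>n\<in>I. wt p n * indicator {y..} (real n))"
      by (rule sum_ennreal) simp
    then show ?thesis by (simp only:) (rule ennreal_mult, simp_all add: sum_nonneg)
  qed
  also have "... \<le> ennreal \<bar>x\<bar> * (\<Sum>n. ennreal (wt p n * indicator {y..} (real n)))"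
    using assms(2) by (intro mult_left_mono sum_le_suminf) simp_all
  also have "... \<le> ennreal \<bar>x\<bar> * ennreal (2 powr (1 + 1 / p) / (1 / p) * y powr - (1 / p))"
  proof (rule mult_left_mono)
    have w: "wt p n = real n powr - (1 + 1 / p)" for n by (simp add: wt_def)
    have e: "(1 + 1 / p) - 1 = 1 / p" "1 - (1 + 1 / p) = - (1 / p)" by simp_all
    have "1 < 1 + 1 / p" using assms(1) by simp
    from sum_powr_tail[OF this y]
    show "(\<Sum>n. ennreal (wt p n * indicator {y..} (real n)))
      \<le> ennreal (2 powr (1 + 1 / p) / (1 / p) * y powr - (1 / p))"
      unfolding w e .
  qed simp
  also have "... = ennreal (\<bar>x\<bar> * (2 powr (1 + 1 / p) / (1 / p) * y powr - (1 / p)))"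
    by (rule ennreal_mult[symmetric]) (use assms(1) in simp_all)
  also have "\<bar>x\<bar> * (2 powr (1 + 1 / p) / (1 / p) * y powr - (1 / p)) = 2 powr (1 + 1 / p) * p"
    using False unfolding yr by simp
  finally show ?thesis
    by (rule ennreal_le_iff[THEN iffD1, rotated]) (use assms(1) in simp)
qed (use assms in \<open>simp add: trunc_def\<close>)

section \<open>Almost sure summability versus the p-th moment and truncated sums\<close>

context iid_seq begin

lemma ident_prob:
  assumes "j \<ge> 1" "Measurable.pred borel P"
  shows "\<P>(w in M. P (Xs j w)) = \<P>(w in M. P (X w))"
proof -
  have "measure (distr M borel (Xs j)) {x\<in>space borel. P x} = measure (distr M borel X) {x\<in>space borel. P x}"
    using ident[OF assms(1)] by simp
  then show ?thesis using assms(2) rv_Xs[OF assms(1)]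
    by (simp add: measure_distr pred_def vimage_def Int_def conj_commute)
qed

lemma ident_nn:
  assumes "j \<ge> 1" "f \<in> borel_measurable borel"
  shows "(\<integral>\<^sup>+w. f (Xs j w) \<partial>M) = (\<integral>\<^sup>+w. f (X w) \<partial>M)"
proof -
  have "(\<integral>\<^sup>+x. f x \<partial>distr M borel (Xs j)) = (\<integral>\<^sup>+x. f x \<partial>distr M borel X)"
    using ident[OF assms(1)] by simp
  then show ?thesis using assms(2) rv_Xs[OF assms(1)] by (simp add: nn_integral_distr)
qed

lemma rv_psum: "(\<lambda>w. psum Xs n w) \<in> borel_measurable M"
  unfolding psum_def by (intro borel_measurable_sum rv_Xs) auto

definition tsum :: "real \<Rightarrow> nat \<Rightarrow> 'a \<Rightarrow> real" where
  "tsum p n w = (\<Sum>j\<in>{1..n}. trunc p n (Xs j w))"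

abbreviation tsumE :: "real \<Rightarrow> nat \<Rightarrow> ennreal" where
  "tsumE p n \<equiv> (\<integral>\<^sup>+w. ennreal (wt p n * \<bar>tsum p n w\<bar>) \<partial>M)"

lemma rv_tsum: "(\<lambda>w. tsum p n w) \<in> borel_measurable M"
  unfolding tsum_def by (intro borel_measurable_sum rv_comp) auto

text \<open>The events G > k decrease to the event G = \<infinity>, which is null, so continuity
  from above applies.\<close>

lemma tight:
  assumes G: "G \<in> borel_measurable M" and fin: "AE w in M. G w < (\<infinity> :: ennreal)" and e: "0 < e"
  shows "\<exists>s>0. \<P>(w in M. G w > ennreal s) \<le> e"
proof -
  note G[measurable]
  define A where "A k = {w\<in>space M. G w > of_nat k}" for k :: nat
  have [measurable]: "A k \<in> events" for k unfolding A_def by measurable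
  have "decseq A" unfolding A_def decseq_def
    by (auto elim!: le_less_trans[rotated] simp: of_nat_mono)
  then have "(\<lambda>k. prob (A k)) \<longlonglongrightarrow> prob (\<Inter>k. A k)"
    by (intro finite_Lim_measure_decseq) auto
  also have "prob (\<Inter>k. A k) = 0"
  proof (rule AE_iff_measurable[THEN iffD1, THEN measure_eq_emeasure_eq_ennreal[of 0, simplified], rotated 2])
    show "AE w in M. w \<notin> (\<Inter>k. A k)"
    proof (use fin in eventually_elim)
      case (elim w)
      then obtain k :: nat where "G w < of_nat k" by (metis ennreal_Ex_less_of_nat infinity_ennreal_def)
      then show ?case by (auto simp: A_def intro!: exI[of _ k])
    qed
  qed (auto simp: A_def)
  finally have "eventually (\<lambda>k. prob (A k) < e) sequentially" using e by (intro order_tendstoD)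
  then obtain k where k: "\<And>j. j \<ge> k \<Longrightarrow> prob (A j) < e" by (auto simp: eventually_sequentially)
  have "prob (A (Suc k)) < e" by (rule k) simp
  then show ?thesis
    by (intro exI[of _ "real (Suc k)"]) (auto simp: A_def ennreal_of_nat_eq_real_of_nat)
qed

lemma prob_all:
  assumes "\<And>j. j \<in> {1..n} \<Longrightarrow> B j \<in> sets borel"
  shows "\<P>(w in M. \<forall>j\<in>{1..n}. Xs j w \<in> B j) = (\<Prod>j=1..n. \<P>(w in M. X w \<in> B j))"
proof (cases "n = 0")
  case True
  then show ?thesis by (simp add: prob_space)
next
  case False
  have "prob (\<Inter>j\<in>{1..n}. Xs j -` B j \<inter> space M) = (\<Prod>j=1..n. prob (Xs j -` B j \<inter> space M))"
    using assms False by (intro indep_varsD[OF indep]) auto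
  moreover have "(\<Inter>j\<in>{1..n}. Xs j -` B j \<inter> space M) = {w\<in>space M. \<forall>j\<in>{1..n}. Xs j w \<in> B j}"
    using False by auto
  moreover have "prob (Xs j -` B j \<inter> space M) = \<P>(w in M. X w \<in> B j)" if "j \<in> {1..n}" for j
    using ident_prob[of j "\<lambda>x. x \<in> B j"] assms[OF that] that
    by (simp add: vimage_def Int_def conj_commute)
  ultimately show ?thesis by simp
qed

text \<open>By independence the complement is a product of factors 1 - q \<le> exp(-q). This is a
  quantitative second Borel-Cantelli lemma: a union of small probability forces a bounded sum of
  probabilities.\<close>

lemma prob_ex:
  assumes "\<And>j. j \<in> {1..n} \<Longrightarrow> B j \<in> sets borel"
  shows "1 - exp (- (\<Sum>j=1..n. \<P>(w in M. X w \<in> B j)))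
    \<le> \<P>(w in M. \<exists>j\<in>{1..n}. Xs j w \<in> B j)"
proof -
  let ?q = "\<lambda>j. \<P>(w in M. X w \<in> B j)"
  have E: "{w\<in>space M. \<forall>j\<in>{1..n}. Xs j w \<in> - B j} \<in> events"
  proof (intro sets.sets_Collect_finite_All)
    fix j assume "j \<in> {1..n}"
    then show "{w\<in>space M. Xs j w \<in> - B j} \<in> events"
      using measurable_sets[OF rv_Xs, of j "- B j"] assms[of j] by (simp add: vimage_def Int_def conj_commute)
  qed simp
  have "\<P>(w in M. X w \<in> - B j) = 1 - ?q j" if "j \<in> {1..n}" for j
  proof -
    have "{w\<in>space M. X w \<in> B j} \<in> events" using assms[OF that] by measurable
    from prob_compl[OF this] show ?thesis
      by (simp add: set_diff_eq conj_commute cong: conj_cong)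
  qed
  then have "\<P>(w in M. \<forall>j\<in>{1..n}. Xs j w \<in> - B j) = (\<Prod>j=1..n. 1 - ?q j)"
    using assms by (subst prob_all) auto
  also have "... \<le> (\<Prod>j=1..n. exp (- ?q j))"
    using exp_ge_add_one_self[of "- ?q _"] by (intro prod_mono) auto
  also have "... = exp (- (\<Sum>j=1..n. ?q j))" by (simp add: exp_sum sum_negf[symmetric])
  finally have "\<P>(w in M. \<forall>j\<in>{1..n}. Xs j w \<in> - B j) \<le> exp (- (\<Sum>j=1..n. ?q j))" .
  moreover have "{w\<in>space M. \<exists>j\<in>{1..n}. Xs j w \<in> B j} = space M - {w\<in>space M. \<forall>j\<in>{1..n}. Xs j w \<in> - B j}"
    by auto
  ultimately show ?thesis using prob_compl[OF E] by simp
qed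

text \<open>With v = (|X| / C)^p, the number of integers j \<ge> 1 below v is at least v - 1, and j
  < v says exactly that |X| exceeds C j^(1/p).\<close>

lemma moment_from_tail_sum:
  assumes p: "0 < p" and C: "0 < C"
    and b: "\<And>J. (\<Sum>j=1..J. \<P>(w in M. \<bar>X w\<bar> > C * real j powr (1 / p))) \<le> B"
  shows "(\<integral>\<^sup>+w. ennreal (\<bar>X w\<bar> powr p) \<partial>M) < \<infinity>"
proof -
  define A where "A j = {w\<in>space M. \<bar>X w\<bar> > C * real (Suc j) powr (1 / p)}" for j :: nat
  have [measurable]: "A j \<in> events" for j unfolding A_def by measurable
  have pw: "ennreal (\<bar>X w\<bar> powr p) \<le> ennreal (C powr p) * (1 + (\<Sum>j. indicator (A j) w))" if "w \<in> space M" for w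
  proof -
    define v where "v = (\<bar>X w\<bar> / C) powr p"
    \<comment> \<open>The number of j \<ge> 1 with j < v; at v = 0 the conversion by
      \<open>nat\<close> makes it 0.\<close>
    define k where "k = nat (\<lceil>v\<rceil> - 1)"
    have v: "v \<ge> 0" by (simp add: v_def)
    have inA: "w \<in> A j" if "j < k" for j
    proof -
      have "real (Suc j) < v" using that unfolding k_def by linarith
      then have "\<not> \<bar>X w\<bar> / C \<le> real (Suc j) powr (1 / p)"
        using root_le_iff[of p "\<bar>X w\<bar> / C" "real (Suc j)"] p C by (simp add: v_def)
      then show ?thesis using C \<open>w \<in> space M\<close> by (simp add: A_def field_simps)
    qed
    have "v \<le> 1 + real k" unfolding k_def by linarith
    then have "\<bar>X w\<bar> powr p \<le> C powr p * (1 + real k)"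
      using C p by (simp add: v_def powr_divide field_simps)
    then have "ennreal (\<bar>X w\<bar> powr p) \<le> ennreal (C powr p) * (1 + (\<Sum>j<k. 1))"
      by (simp add: ennreal_of_nat_eq_real_of_nat ennreal_mult[symmetric] ennreal_plus[symmetric] ennreal_leI
        flip: ennreal_1 del: ennreal_plus)
    also have "(\<Sum>j<k. 1) = (\<Sum>j<k. indicator (A j) w :: ennreal)" using inA by (intro sum.cong) auto
    also have "... \<le> (\<Sum>j. indicator (A j) w)" by (intro sum_le_suminf) auto
    finally show ?thesis by (simp add: mult_left_mono add_left_mono)
  qed
  have "(\<integral>\<^sup>+w. ennreal (\<bar>X w\<bar> powr p) \<partial>M) \<le> (\<integral>\<^sup>+w. ennreal (C powr p) * (1 + (\<Sum>j. indicator (A j) w)) \<partial>M)"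
    by (intro nn_integral_mono pw)
  also have "... = ennreal (C powr p) * (1 + (\<Sum>j. ennreal (prob (A j))))"
    by (simp add: nn_integral_cmult nn_integral_add nn_integral_suminf emeasure_eq_measure prob_space)
  also have "(\<Sum>j. ennreal (prob (A j))) \<le> ennreal B"
  proof (rule suminf_ennreal_le)
    fix k :: nat
    have "(\<Sum>j<k. prob (A j)) = (\<Sum>j=1..k. \<P>(w in M. \<bar>X w\<bar> > C * real j powr (1 / p)))"
      unfolding A_def by (rule sum.reindex_bij_witness[of _ "\<lambda>j. j - 1" Suc]) auto
    then show "(\<Sum>j<k. prob (A j)) \<le> B" using b[of k] by simp
  qed simp
  finally show ?thesis
    by (simp add: mult_left_mono add_left_mono ennreal_mult_less_top order.strict_trans1)
qed

lemma tail_sum_le_moment: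
  assumes p: "0 < p"
  shows "(\<Sum>j. ennreal (\<P>(w in M. \<bar>X w\<bar> powr p > real (Suc j)))) \<le> (\<integral>\<^sup>+w. ennreal (\<bar>X w\<bar> powr p) \<partial>M)"
proof -
  define A where "A j = {w\<in>space M. \<bar>X w\<bar> powr p > real (Suc j)}" for j :: nat
  have [measurable]: "A j \<in> events" for j unfolding A_def by measurable
  have "(\<Sum>j. ennreal (prob (A j))) = (\<integral>\<^sup>+w. (\<Sum>j. indicator (A j) w) \<partial>M)"
    by (simp add: nn_integral_suminf emeasure_eq_measure)
  also have "... \<le> (\<integral>\<^sup>+w. ennreal (\<bar>X w\<bar> powr p) \<partial>M)"
  proof (rule nn_integral_mono)
    fix w
    define v where "v = \<bar>X w\<bar> powr p"
    have "(\<Sum>j. ennreal (indicator (A j) w)) \<le> ennreal v"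
    proof (rule suminf_ennreal_le)
      fix k :: nat
      have "(\<Sum>j<k. indicator (A j) w :: real) \<le> (\<Sum>j\<in>{..<k} \<inter> {j. real (Suc j) < v}. 1)"
        by (subst sum.inter_restrict, simp) (intro sum_mono, auto simp: A_def v_def indicator_def)
      also have "... \<le> (\<Sum>j<nat \<lfloor>v\<rfloor>. 1)"
        by (intro sum_mono2) (auto, linarith)
      also have "... \<le> v" by (simp add: v_def)
      finally show "(\<Sum>j<k. indicator (A j) w) \<le> v" .
    qed auto
    then show "(\<Sum>j. indicator (A j) w) \<le> ennreal (\<bar>X w\<bar> powr p)"
      by (simp add: v_def ennreal_indicator)
  qed
  finally show ?thesis by (simp add: A_def)
qed

text \<open>Borel-Cantelli gives |X(j)|^p \<le> j for all large j, and j \<le> n turns this into the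
  bound n. The finitely many remaining j are covered once n exceeds the sum of their p-th
  powers.\<close>

lemma eventually_trunc_trivial:
  assumes p: "0 < p" and m: "(\<integral>\<^sup>+w. ennreal (\<bar>X w\<bar> powr p) \<partial>M) < \<infinity>"
  shows "AE w in M. \<exists>K. \<forall>n\<ge>K. \<forall>j\<in>{1..n}. trunc p n (Xs j w) = Xs j w"
proof -
  define A where "A j = {w\<in>space M. \<bar>Xs (Suc j) w\<bar> powr p > real (Suc j)}" for j :: nat
  have [measurable]: "Xs (Suc j) \<in> borel_measurable M" for j by (rule rv_Xs) simp
  have [measurable]: "A j \<in> events" for j unfolding A_def by measurable
  have "(\<Sum>j. ennreal (prob (A j))) = (\<Sum>j. ennreal (\<P>(w in M. \<bar>X w\<bar> powr p > real (Suc j))))"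
    unfolding A_def by (subst ident_prob) auto
  also have "... < \<infinity>" using tail_sum_le_moment[OF p] m by (rule order.strict_trans1)
  finally have "summable (\<lambda>j. prob (A j))" by (intro summable_suminf_not_top) auto
  then have "AE w in M. eventually (\<lambda>j. w \<in> space M - A j) sequentially"
    by (intro borel_cantelli_AE1) (auto simp: less_top[symmetric])
  then show ?thesis
  proof eventually_elim
    case (elim w)
    then obtain N where N: "\<And>j. j \<ge> N \<Longrightarrow> w \<in> space M - A j" by (auto simp: eventually_sequentially)
    have Nb: "\<bar>Xs j w\<bar> powr p \<le> real j" if "j \<ge> Suc N" for j
      using N[of "j - 1"] that by (cases j) (auto simp: A_def)
    define K where "K = nat \<lceil>\<Sum>j\<in>{1..N}. \<bar>Xs j w\<bar> powr p\<rceil>"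
    have Kb: "\<bar>Xs j w\<bar> powr p \<le> real K" if "j \<in> {1..N}" for j
    proof -
      have "\<bar>Xs j w\<bar> powr p \<le> (\<Sum>j\<in>{1..N}. \<bar>Xs j w\<bar> powr p)"
        using that by (intro member_le_sum) auto
      then show ?thesis unfolding K_def by linarith
    qed
    show ?case
    proof (intro exI[of _ K] allI impI ballI)
      fix n j assume n: "K \<le> n" and j: "j \<in> {1..n}"
      have "\<bar>Xs j w\<bar> powr p \<le> real n"
      proof (cases "j \<le> N")
        case True
        then show ?thesis using Kb[of j] j n by force
      next
        case False
        then show ?thesis using Nb[of j] j n by force
      qed
      then show "trunc p n (Xs j w) = Xs j w" using p by (simp add: trunc_eq)
    qed
  qed
qed

text \<open>Tonelli makes the truncated series almost surely finite, and from a random index on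
  truncated and full sums coincide.\<close>

lemma cond_i_of_tsum:
  assumes p: "0 < p" and m: "(\<integral>\<^sup>+w. ennreal (\<bar>X w\<bar> powr p) \<partial>M) < \<infinity>"
    and s: "(\<Sum>n. tsumE p n) < \<infinity>"
  shows "cond_i M Xs p"
proof -
  note rv_tsum[measurable]
  have "(\<integral>\<^sup>+w. (\<Sum>n. ennreal (wt p n * \<bar>tsum p n w\<bar>)) \<partial>M) \<noteq> \<infinity>"
    using s by (subst nn_integral_suminf) auto
  then have "AE w in M. (\<Sum>n. ennreal (wt p n * \<bar>tsum p n w\<bar>)) \<noteq> \<infinity>"
    by (intro nn_integral_PInf_AE) measurable
  then have "AE w in M. summable (\<lambda>n. wt p n * \<bar>psum Xs n w\<bar>)"
    using eventually_trunc_trivial[OF p m]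
  proof eventually_elim
    case (elim w)
    then obtain K where K: "\<And>n j. n \<ge> K \<Longrightarrow> j \<in> {1..n} \<Longrightarrow> trunc p n (Xs j w) = Xs j w" by blast
    have "summable (\<lambda>n. wt p n * \<bar>tsum p n w\<bar>)"
      using elim(1) by (intro summable_suminf_not_top) auto
    moreover have "eventually (\<lambda>n. wt p n * \<bar>tsum p n w\<bar> = wt p n * \<bar>psum Xs n w\<bar>) sequentially"
      using eventually_ge_at_top[of K]
      by eventually_elim (auto simp: tsum_def psum_def K)
    ultimately show ?case by (rule summable_cong[THEN iffD1, rotated])
  qed
  then show ?thesis unfolding cond_i_def wt_eq .
qed


text \<open>One level s works for every L because all finite sections lie below the almost surely
  finite full series.\<close>

lemma psum_tight:
  assumes p: "0 < p" and i: "cond_i M Xs p" and e: "0 < e"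
  shows "\<exists>s>0. \<forall>L. \<P>(w in M. (\<Sum>n\<in>{1..L}. wt p n * \<bar>psum Xs n w\<bar>) > s) \<le> e"
proof -
  note rv_psum[measurable]
  define G where "G w = (\<Sum>n. ennreal (wt p n * \<bar>psum Xs n w\<bar>))" for w
  have [measurable]: "G \<in> borel_measurable M" unfolding G_def by measurable
  have "AE w in M. summable (\<lambda>n. wt p n * \<bar>psum Xs n w\<bar>)"
    using i unfolding cond_i_def wt_eq .
  then have "AE w in M. G w < \<infinity>"
    by eventually_elim (simp add: G_def suminf_ennreal2)
  from tight[OF _ this e] obtain s where s: "s > 0" "\<P>(w in M. G w > ennreal s) \<le> e" by auto
  show ?thesis
  proof (intro exI[of _ s] conjI allI s)
    fix L
    have "\<P>(w in M. (\<Sum>n\<in>{1..L}. wt p n * \<bar>psum Xs n w\<bar>) > s) \<le> \<P>(w in M. G w > ennreal s)"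
    proof (rule finite_measure_mono)
      show "{w\<in>space M. (\<Sum>n\<in>{1..L}. wt p n * \<bar>psum Xs n w\<bar>) > s} \<subseteq> {w\<in>space M. G w > ennreal s}"
      proof safe
        fix w assume "s < (\<Sum>n\<in>{1..L}. wt p n * \<bar>psum Xs n w\<bar>)"
        then have "ennreal s < ennreal (\<Sum>n\<in>{1..L}. wt p n * \<bar>psum Xs n w\<bar>)"
          using s by (intro ennreal_lessI) auto
        also have "... = (\<Sum>n\<in>{1..L}. ennreal (wt p n * \<bar>psum Xs n w\<bar>))" by (subst sum_ennreal) auto
        also have "... \<le> G w" unfolding G_def by (intro sum_le_suminf) auto
        finally show "ennreal s < G w" .
      qed
    qed measurable
    then show "\<P>(w in M. (\<Sum>n\<in>{1..L}. wt p n * \<bar>psum Xs n w\<bar>) > s) \<le> e" using s by linarith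
  qed
qed

text \<open>Step j as a vector: X(j) belongs to S(n) exactly when j \<le> n. At time L the walk
  restricted to coordinates {1..L} thus consists of the weighted partial sums.\<close>

definition hfull :: "real \<Rightarrow> nat \<Rightarrow> nat \<Rightarrow> real \<Rightarrow> real" where
  "hfull p n j x = (if j \<le> n then wt p n * x else 0)"

definition htrunc :: "real \<Rightarrow> nat \<Rightarrow> nat \<Rightarrow> real \<Rightarrow> real" where
  "htrunc p n j x = (if j \<le> n then wt p n * trunc p n x else 0)"

lemma hfull_measurable: "hfull p n j \<in> borel_measurable borel"
  unfolding hfull_def by measurable

lemma htrunc_measurable: "htrunc p n j \<in> borel_measurable borel"
  unfolding htrunc_def by measurable

lemma blk_hfull: "blk (hfull p) {1..L} (path w) 0 L = (\<Sum>n\<in>{1..L}. wt p n * \<bar>psum Xs n w\<bar>)"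
  unfolding blk_def
proof (rule sum.cong[OF refl])
  fix n assume n: "n \<in> {1..L}"
  have "(\<Sum>j\<in>{0<..L}. hfull p n j (Xs j w)) = (\<Sum>j\<in>{1..n}. wt p n * Xs j w)"
    using n by (intro sum.mono_neutral_cong_right) (auto simp: hfull_def)
  then show "\<bar>\<Sum>j\<in>{0<..L}. hfull p n j (Xs j w)\<bar> = wt p n * \<bar>psum Xs n w\<bar>"
    by (simp add: psum_def sum_distrib_left[symmetric] abs_mult)
qed

lemma blk_htrunc: "blk (htrunc p) {1..L} (path w) 0 L = (\<Sum>n\<in>{1..L}. wt p n * \<bar>tsum p n w\<bar>)"
  unfolding blk_def
proof (rule sum.cong[OF refl])
  fix n assume n: "n \<in> {1..L}"
  have "(\<Sum>j\<in>{0<..L}. htrunc p n j (Xs j w)) = (\<Sum>j\<in>{1..n}. wt p n * trunc p n (Xs j w))"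
    using n by (intro sum.mono_neutral_cong_right) (auto simp: htrunc_def)
  then show "\<bar>\<Sum>j\<in>{0<..L}. htrunc p n j (Xs j w)\<bar> = wt p n * \<bar>tsum p n w\<bar>"
    by (simp add: tsum_def sum_distrib_left[symmetric] abs_mult)
qed

text \<open>Ottaviani asks for control of the increments after J; domination in law reduces these to
  the whole walk. The value q = 1/9 is chosen because q / (1 - q) = 1/8.\<close>

lemma maximal_tight:
  assumes p: "0 < p" and i: "cond_i M Xs p"
  shows "\<exists>s>0. \<forall>L. prob (exceed (hfull p) {1..L} L s) \<le> 1 / 8"
proof -
  obtain s where s: "s > 0"
    "\<And>L. \<P>(w in M. (\<Sum>n\<in>{1..L}. wt p n * \<bar>psum Xs n w\<bar>) > s) \<le> 1 / 9"
    using psum_tight[OF p i, of "1 / 9"] by auto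
  have "prob (exceed (hfull p) {1..L} L (2 * s)) \<le> 1 / 8" for L
  proof -
    have "\<P>(w in M. blk (hfull p) {1..L} (path w) J L > s) \<le> 1 / 9" if J: "J \<in> {1..L}" for J
    proof -
      have "\<P>(w in M. blk (hfull p) {1..L} (path w) J L > s)
        \<le> \<P>(w in M. blk (hfull p) {1..L} (path w) 0 L > s)"
        using weighted_tail_prob_le[of "wt p" J L s] wt_antimono[OF p] J s
        unfolding hfull_def by simp
      then show ?thesis using s(2)[of L] unfolding blk_hfull by linarith
    qed
    from ottaviani[where h="hfull p" and L=L and I="{1..L}" and s=s and q="1 / 9" and t=s, OF hfull_measurable this]
    have "(1 - 1 / 9) * prob (exceed (hfull p) {1..L} L (s + s))
      \<le> \<P>(w in M. blk (hfull p) {1..L} (path w) 0 L > s)" by simp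
    moreover have "P \<le> 1 / 8" if "(1 - 1 / 9) * P \<le> r" "r \<le> 1 / 9" for P r :: real
      using that by simp
    ultimately show ?thesis using s(2)[of L] unfolding blk_hfull mult_2 by blast
  qed
  then show ?thesis using s(1) by (intro exI[of _ "2 * s"]) auto
qed

text \<open>A value |X(j)| > C j^(1/p) moves coordinates j..2j by more than 2s in total norm, so the
  walk lies outside the ball of radius s at time j - 1 or at time j. Since that has probability at
  most 1/8, \<open>prob_ex\<close> bounds the tail sum by 1/7.\<close>

lemma cond_i_moment:
  assumes p: "0 < p" and i: "cond_i M Xs p"
  shows "(\<integral>\<^sup>+w. ennreal (\<bar>X w\<bar> powr p) \<partial>M) < \<infinity>"
proof -
  obtain s where s: "s > 0"
    "\<And>L. prob (exceed (hfull p) {1..L} L s) \<le> 1 / 8"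
    using maximal_tight[OF p i] by auto
  define c where "c = 2 powr (-1 - 1 / p)"
  have c: "c > 0" by (simp add: c_def)
  \<comment> \<open>Here c is the constant of \<open>powr_block_lower\<close>; C is scaled so that
    the jump has norm above 2s.\<close>
  define C where "C = 2 * s / c"
  have C: "C > 0" using s c by (simp add: C_def)
  note rv_blk[OF hfull_measurable, measurable]
  show ?thesis
  proof (rule moment_from_tail_sum[OF p C])
    fix J :: nat
    define q where "q j = \<P>(w in M. \<bar>X w\<bar> > C * real j powr (1 / p))" for j :: nat
    have "1 - exp (- (\<Sum>j=1..J. \<P>(w in M. X w \<in> {x. \<bar>x\<bar> > C * real j powr (1 / p)})))
      \<le> \<P>(w in M. \<exists>j\<in>{1..J}. Xs j w \<in> {x. \<bar>x\<bar> > C * real j powr (1 / p)})"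
      by (rule prob_ex) measurable
    \<comment> \<open>The horizon is 2J so that the block {j..2j} lies within the coordinates for
      every j \<le> J.\<close>
    also have "... \<le> \<P>(w in M. \<exists>J'\<in>{1..2*J}. blk (hfull p) {1..2*J} (path w) 0 J' > s)"
    proof (rule finite_measure_mono)
      show "{w\<in>space M. \<exists>j\<in>{1..J}. Xs j w \<in> {x. \<bar>x\<bar> > C * real j powr (1 / p)}}
        \<subseteq> {w\<in>space M. \<exists>J'\<in>{1..2*J}. blk (hfull p) {1..2*J} (path w) 0 J' > s}"
      proof safe
        fix w j assume w: "w \<in> space M" and j: "j \<in> {1..J}" and big: "C * real j powr (1 / p) < \<bar>Xs j w\<bar>"
        have "2 * s = C * real j powr (1 / p) * (c * real j powr (- (1 / p)))"
          using c j by (simp add: C_def powr_minus field_simps)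
        also have "... < \<bar>Xs j w\<bar> * (c * real j powr (- (1 / p)))"
          using big c j by (intro mult_strict_right_mono) auto
        also have "... \<le> \<bar>Xs j w\<bar> * (\<Sum>n=j..2*j. wt p n)"
          using powr_block_lower[of j "1 / p"] j p by (intro mult_left_mono) (auto simp: wt_def c_def)
        also have "... \<le> \<bar>Xs j w\<bar> * (\<Sum>n\<in>{j..2*J}. wt p n)"
          using j by (intro mult_left_mono sum_mono2) auto
        also have "... = (\<Sum>n\<in>{1..2*J}. \<bar>hfull p n j (Xs j w)\<bar>)"
          unfolding sum_distrib_left using j
          by (intro sum.mono_neutral_cong_left) (auto simp: hfull_def abs_mult)
        also have "... = blk (hfull p) {1..2*J} (path w) (j - 1) j"
        proof -
          have "{j - 1<..j} = {j}" using j by auto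
          then show ?thesis by (simp add: blk_def)
        qed
        also have "... \<le> blk (hfull p) {1..2*J} (path w) 0 (j - 1) + blk (hfull p) {1..2*J} (path w) 0 j"
          by (rule blk_triangle) simp
        finally have "blk (hfull p) {1..2*J} (path w) 0 (j - 1) > s \<or> blk (hfull p) {1..2*J} (path w) 0 j > s"
          by linarith
        then show "\<exists>J'\<in>{1..2*J}. blk (hfull p) {1..2*J} (path w) 0 J' > s"
        proof
          assume a: "blk (hfull p) {1..2*J} (path w) 0 (j - 1) > s"
          \<comment> \<open>Time 0 is not among the admissible times, but the walk starts at the
            origin and cannot exceed s there.\<close>
          then have "j - 1 \<noteq> 0" using s(1) by (intro notI) simp
          then show ?thesis using j a by (intro bexI[of _ "j - 1"]) auto
        next
          assume a: "blk (hfull p) {1..2*J} (path w) 0 j > s"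
          then show ?thesis using j by (intro bexI[of _ j]) auto
        qed
      qed
    qed measurable
    also have "... \<le> 1 / 8" by (rule s(2))
    finally have "7 / 8 \<le> exp (- (\<Sum>j=1..J. q j))" by (simp add: q_def)
    moreover have "exp (- (\<Sum>j=1..J. q j)) \<le> 1 / (1 + (\<Sum>j=1..J. q j))"
    proof -
      have "0 \<le> (\<Sum>j=1..J. q j)" by (auto intro: sum_nonneg simp: q_def)
      then show ?thesis using exp_ge_add_one_self[of "\<Sum>j=1..J. q j"]
        by (simp add: exp_minus inverse_eq_divide frac_le)
    qed
    moreover have "0 \<le> (\<Sum>j=1..J. q j)" by (auto intro: sum_nonneg simp: q_def)
    ultimately have "7 / 8 \<le> 1 / (1 + (\<Sum>j=1..J. q j))" "0 \<le> (\<Sum>j=1..J. q j)" by linarith+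
    then show "(\<Sum>j=1..J. \<P>(w in M. \<bar>X w\<bar> > C * real j powr (1 / p))) \<le> 1"
      unfolding q_def[symmetric] by (simp add: field_simps)
  qed
qed

text \<open>Full and truncated walks differ in norm by at most Z at all times, and Z is almost
  surely finite because only finitely many coordinates are ever truncated. The maximal norm of the
  truncated walk thus exceeds s + z with probability at most 1/8 + 1/8, the 1/4 required by
  \<open>hoffmann_jorgensen\<close>.\<close>

lemma cond_i_tsum:
  assumes p: "0 < p" and i: "cond_i M Xs p"
  shows "(\<Sum>n. tsumE p n) < \<infinity>"
proof -
  obtain s where s: "s > 0"
    "\<And>L. prob (exceed (hfull p) {1..L} L s) \<le> 1 / 8"
    using maximal_tight[OF p i] by auto
  note rv_blk[OF hfull_measurable, measurable] rv_blk[OF htrunc_measurable, measurable] rv_tsum[measurable]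
  \<comment> \<open>Absolute values are taken step by step, so that D n dominates the discrepancy in
    coordinate n at every time, not only at the end.\<close>
  define D where "D n w = wt p n * (\<Sum>j\<in>{1..n}. \<bar>trunc p n (Xs j w) - Xs j w\<bar>)" for n w
  have [measurable]: "D n \<in> borel_measurable M" for n
    unfolding D_def
    by (intro borel_measurable_times borel_measurable_sum borel_measurable_abs borel_measurable_diff rv_comp rv_Xs) auto
  have D0: "0 \<le> D n w" for n w by (simp add: D_def sum_nonneg)
  define Z where "Z w = (\<Sum>n. ennreal (D n w))" for w
  have [measurable]: "Z \<in> borel_measurable M" unfolding Z_def by measurable
  have "AE w in M. Z w < \<infinity>"
    using eventually_trunc_trivial[OF p cond_i_moment[OF p i]]
  proof eventually_elim
    case (elim w)
    then obtain K where K: "\<And>n j. n \<ge> K \<Longrightarrow> j \<in> {1..n} \<Longrightarrow> trunc p n (Xs j w) = Xs j w" by blast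
    then have "D n w = 0" if "n \<ge> K" for n using that by (simp add: D_def)
    then have "Z w = (\<Sum>n<K. ennreal (D n w))"
      unfolding Z_def by (intro suminf_finite) auto
    then show ?case by simp
  qed
  from tight[OF _ this, of "1 / 8"] obtain z where z: "z > 0" "\<P>(w in M. Z w > ennreal z) \<le> 1 / 8" by auto
  define m where "m = s + z"
  define c where "c = 2 powr (1 + 1 / p) * p"
  have B: "(\<integral>\<^sup>+w. ennreal (blk (htrunc p) {1..L} (path w) 0 L) \<partial>M) \<le> ennreal (2 * (c + 2 * m))" for L
  proof (rule hoffmann_jorgensen)
    show "(\<Sum>n\<in>{1..L}. \<bar>htrunc p n j x\<bar>) \<le> c" for j x
    proof -
      have "(\<Sum>n\<in>{1..L}. \<bar>htrunc p n j x\<bar>) \<le> (\<Sum>n\<in>{1..L}. wt p n * \<bar>trunc p n x\<bar>)"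
        by (intro sum_mono) (auto simp: htrunc_def abs_mult)
      also have "... \<le> c" unfolding c_def by (intro sum_wt_trunc_le p) auto
      finally show ?thesis .
    qed
    show "0 < m" using s z by (simp add: m_def)
    have "prob (exceed (htrunc p) {1..L} L m)
      \<le> prob ((exceed (hfull p) {1..L} L s) \<union> {w\<in>space M. Z w > ennreal z})"
    proof (rule finite_measure_mono)
      show "(exceed (htrunc p) {1..L} L m) \<subseteq>
        (exceed (hfull p) {1..L} L s) \<union> {w\<in>space M. Z w > ennreal z}"
      proof
        fix w assume "w \<in> (exceed (htrunc p) {1..L} L m)"
        then obtain J where w: "w \<in> space M" and J: "J \<in> {1..L}" "blk (htrunc p) {1..L} (path w) 0 J > m" by auto
        have "blk (htrunc p) {1..L} (path w) 0 J - blk (hfull p) {1..L} (path w) 0 J \<le> (\<Sum>n\<in>{1..L}. D n w)"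
          unfolding blk_def sum_subtractf[symmetric]
        proof (rule sum_mono)
          fix n assume n: "n \<in> {1..L}"
          have "\<bar>\<Sum>j\<in>{0<..J}. htrunc p n j (Xs j w)\<bar> - \<bar>\<Sum>j\<in>{0<..J}. hfull p n j (Xs j w)\<bar>
            \<le> \<bar>\<Sum>j\<in>{0<..J}. htrunc p n j (Xs j w) - hfull p n j (Xs j w)\<bar>"
            by (simp add: sum_subtractf abs_triangle_ineq2)
          also have "... \<le> (\<Sum>j\<in>{0<..J}. \<bar>htrunc p n j (Xs j w) - hfull p n j (Xs j w)\<bar>)" by (rule sum_abs)
          also have "... = (\<Sum>j\<in>{0<..J} \<inter> {..n}. wt p n * \<bar>trunc p n (Xs j w) - Xs j w\<bar>)"
            by (intro sum.mono_neutral_cong_right)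
              (auto simp: htrunc_def hfull_def right_diff_distrib[symmetric] abs_mult)
          also have "... \<le> (\<Sum>j\<in>{1..n}. wt p n * \<bar>trunc p n (Xs j w) - Xs j w\<bar>)"
            by (intro sum_mono2) auto
          also have "... = D n w" by (simp add: D_def sum_distrib_left)
          finally show "\<bar>\<Sum>j\<in>{0<..J}. htrunc p n j (Xs j w)\<bar> - \<bar>\<Sum>j\<in>{0<..J}. hfull p n j (Xs j w)\<bar> \<le> D n w" .
        qed
        moreover have "(\<Sum>n\<in>{1..L}. D n w) \<le> z" if "\<not> Z w > ennreal z"
        proof -
          have "ennreal (\<Sum>n\<in>{1..L}. D n w) = (\<Sum>n\<in>{1..L}. ennreal (D n w))"
            by (subst sum_ennreal) (auto simp: D0)
          also have "... \<le> Z w" unfolding Z_def by (intro sum_le_suminf) auto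
          also have "... \<le> ennreal z" using that by simp
          finally show ?thesis using z by (subst (asm) ennreal_le_iff) auto
        qed
        ultimately show "w \<in> (exceed (hfull p) {1..L} L s) \<union> {w\<in>space M. Z w > ennreal z}"
          using w J by (force simp: m_def)
      qed
    qed measurable
    also have "... \<le> prob (exceed (hfull p) {1..L} L s) + \<P>(w in M. Z w > ennreal z)"
      by (rule measure_Un_le) measurable
    also have "... \<le> 1 / 4" using s(2)[of L] z by linarith
    finally show "prob (exceed (htrunc p) {1..L} L m) \<le> 1 / 4" .
  qed (rule htrunc_measurable)
  have "(\<Sum>n. tsumE p n) \<le> ennreal (2 * (c + 2 * m))"
  proof (rule suminf_le_const)
    fix L :: nat
    have "(\<Sum>n<L. tsumE p n)
      \<le> (\<Sum>n\<in>{0..L}. tsumE p n)"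
      by (intro sum_mono2) auto
    also have "... = (\<Sum>n\<in>{1..L}. tsumE p n)"
      by (intro sum.mono_neutral_right) (auto simp: not_less_eq_eq)
    also have "... = (\<integral>\<^sup>+w. ennreal (blk (htrunc p) {1..L} (path w) 0 L) \<partial>M)"
      unfolding blk_htrunc by (simp add: nn_integral_sum[symmetric])
    finally show "(\<Sum>n<L. tsumE p n) \<le> ennreal (2 * (c + 2 * m))"
      using B[of L] by (rule order_trans)
  qed simp
  then show ?thesis by (rule order.strict_trans1) simp
qed

lemma cond_i_iff_tsum:
  assumes "0 < p"
  shows "cond_i M Xs p \<longleftrightarrow> (\<integral>\<^sup>+w. ennreal (\<bar>X w\<bar> powr p) \<partial>M) < \<infinity> \<and>
    (\<Sum>n. tsumE p n) < \<infinity>"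
  using assms cond_i_moment cond_i_tsum cond_i_of_tsum by blast

end

subsection \<open>Expected absolute values of partial sums\<close>

context iid_seq begin

section \<open>Layer-cake formulas and sums over blocks of indices\<close>

lemma tail_measurable:
  fixes V :: "'a \<Rightarrow> real"
  assumes "V \<in> borel_measurable M"
  shows "(\<lambda>t. \<P>(w in M. V w > t)) \<in> borel_measurable borel"
proof -
  have "mono (\<lambda>t. - \<P>(w in M. V w > t))"
    using assms by (intro monoI) (auto intro!: finite_measure_mono)
  then have "(\<lambda>t. - \<P>(w in M. V w > t)) \<in> borel_measurable borel" by (rule borel_measurable_mono)
  then show ?thesis by (simp add: borel_measurable_uminus_eq)
qed

text \<open>Tonelli on the region 0 \<le> t < V(w). The weight g is carried along for the
  logarithmic weights at p = 1.\<close>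

lemma layer_cake:
  fixes g :: "real \<Rightarrow> ennreal"
  assumes V: "V \<in> borel_measurable M" and g: "g \<in> borel_measurable borel"
  shows "tint (\<lambda>t. g t * ennreal (\<P>(w in M. V w > t)))
    = (\<integral>\<^sup>+w. (\<integral>\<^sup>+t. g t * indicator {0..<V w} t \<partial>lborel) \<partial>M)"
proof -
  note [measurable] = V g
  interpret P: pair_sigma_finite lborel M ..
  have "(\<integral>\<^sup>+w. (\<integral>\<^sup>+t. g t * indicator {0..<V w} t \<partial>lborel) \<partial>M)
    = (\<integral>\<^sup>+t. (\<integral>\<^sup>+w. g t * indicator {0..<V w} t \<partial>M) \<partial>lborel)"
  proof (rule P.Fubini')
    have "(\<lambda>(t, w). g t * indicator {0..<V w} t) = (\<lambda>x. g (fst x) * (if 0 \<le> fst x \<and> fst x < V (snd x) then 1 else 0))"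
      by (auto simp: fun_eq_iff indicator_def)
    also have "... \<in> borel_measurable (lborel \<Otimes>\<^sub>M M)" by measurable
    finally show "(\<lambda>(t, w). g t * indicator {0..<V w} t) \<in> borel_measurable (lborel \<Otimes>\<^sub>M M)" .
  qed
  also have "... = tint (\<lambda>t. g t * ennreal (\<P>(w in M. V w > t)))"
  proof (intro nn_integral_cong)
    fix t :: real
    have "(\<integral>\<^sup>+w. g t * indicator {0..<V w} t \<partial>M)
      = (\<integral>\<^sup>+w. (g t * indicator {0..} t) * indicator {w\<in>space M. V w > t} w \<partial>M)"
      by (intro nn_integral_cong) (auto simp: indicator_def)
    also have "... = (g t * indicator {0..} t) * emeasure M {w\<in>space M. V w > t}"
      by (rule nn_integral_cmult_indicator) measurable
    finally show "(\<integral>\<^sup>+w. g t * indicator {0..<V w} t \<partial>M) = g t * ennreal (\<P>(w in M. V w > t)) * indicator {0..} t"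
      by (simp add: emeasure_eq_measure mult_ac)
  qed
  finally show ?thesis ..
qed

text \<open>Negative values of V count as 0 on both sides, so the formula yields the mean of the
  positive part; it is applied in this way to a maximum minus a constant.\<close>

lemma layer_cake_1:
  assumes V: "V \<in> borel_measurable M"
  shows "tint (\<lambda>t. ennreal (\<P>(w in M. V w > t))) = (\<integral>\<^sup>+w. ennreal (V w) \<partial>M)"
proof -
  have "(\<integral>\<^sup>+t. indicator {0..<v} t \<partial>lborel) = ennreal v" for v :: real
    by (cases "v \<ge> 0") (auto simp: ennreal_neg)
  then show ?thesis using layer_cake[OF V, of "\<lambda>_. 1"] by simp
qed

definition fsum :: "(real \<Rightarrow> real) \<Rightarrow> nat \<Rightarrow> nat \<Rightarrow> 'a \<Rightarrow> real" where
  "fsum f J K w = (\<Sum>j\<in>{J<..K}. f (Xs j w))"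

lemma rv_fsum: "f \<in> borel_measurable borel \<Longrightarrow> (\<lambda>w. fsum f J K w) \<in> borel_measurable M"
  unfolding fsum_def by (intro borel_measurable_sum rv_comp) auto

lemma fsum_split: "J \<le> K \<Longrightarrow> fsum f 0 K w = fsum f 0 J w + fsum f J K w"
  unfolding fsum_def by (rule sum_greaterThanAtMost_split)

lemma blk_fsum: "blk (\<lambda>_ _. f) {0} (path w) J K = \<bar>fsum f J K w\<bar>"
  by (simp add: blk_def fsum_def)

lemma indep_fsum:
  fixes u v :: "real \<Rightarrow> real"
  assumes f: "f \<in> borel_measurable borel" and u: "u \<in> borel_measurable borel" and v: "v \<in> borel_measurable borel"
  shows "indep_var borel (\<lambda>w. u (fsum f 0 J w)) borel (\<lambda>w. v (fsum f J L w))"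
proof -
  have iv: "indep_var (PiM {0<..J} (\<lambda>_. borel)) (\<lambda>w. restrict (path w) {0<..J})
      (PiM {J<..L} (\<lambda>_. borel)) (\<lambda>w. restrict (path w) {J<..L})"
    by (rule indep_var_restrict[OF indep]) auto
  have m: "(\<lambda>x. c (\<Sum>j\<in>A. f (x j))) \<in> borel_measurable (PiM A (\<lambda>_. borel :: real measure))"
    if "c \<in> borel_measurable borel" for c :: "real \<Rightarrow> real" and A :: "nat set"
  proof (rule measurable_compose[OF _ that], rule borel_measurable_sum)
    fix j assume "j \<in> A"
    then have "(\<lambda>x. x j) \<in> borel_measurable (PiM A (\<lambda>_. borel :: real measure))"
      by (rule measurable_component_singleton)
    then show "(\<lambda>x. f (x j)) \<in> borel_measurable (PiM A (\<lambda>_. borel :: real measure))"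
      by (rule measurable_compose[OF _ f])
  qed
  have "indep_var borel ((\<lambda>x. u (\<Sum>j\<in>{0<..J}. f (x j))) \<circ> (\<lambda>w. restrict (path w) {0<..J}))
    borel ((\<lambda>x. v (\<Sum>j\<in>{J<..L}. f (x j))) \<circ> (\<lambda>w. restrict (path w) {J<..L}))"
    by (rule indep_var_compose[OF iv m[OF u] m[OF v]])
  moreover have "(\<Sum>j\<in>A. f (restrict x A j)) = (\<Sum>j\<in>A. f (x j))" for x :: "nat \<Rightarrow> real" and A
    by (intro sum.cong) auto
  ultimately show ?thesis unfolding fsum_def comp_def by (simp only:)
qed

lemma ident_integral:
  assumes "j \<ge> 1" "f \<in> borel_measurable borel"
  shows "expectation (\<lambda>w. f (Xs j w)) = expectation (\<lambda>w. f (X w) :: real)"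
    and "integrable M (\<lambda>w. f (Xs j w)) \<longleftrightarrow> integrable M (\<lambda>w. f (X w))"
proof -
  have "integral\<^sup>L (distr M borel (Xs j)) f = integral\<^sup>L (distr M borel X) f"
    "integrable (distr M borel (Xs j)) f \<longleftrightarrow> integrable (distr M borel X) f"
    using ident[OF assms(1)] by simp_all
  then show "expectation (\<lambda>w. f (Xs j w)) = expectation (\<lambda>w. f (X w))"
    "integrable M (\<lambda>w. f (Xs j w)) \<longleftrightarrow> integrable M (\<lambda>w. f (X w))"
    using assms(2) rv_Xs[OF assms(1)] by (simp_all add: integral_distr integrable_distr_eq)
qed

lemma fsum_integrable:
  assumes "f \<in> borel_measurable borel" "integrable M (\<lambda>w. f (X w))"
  shows "integrable M (fsum f J K)"
  unfolding fsum_def using assms ident_integral(2)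
  by (intro Bochner_Integration.integrable_sum) auto

lemma fsum_expectation:
  assumes "f \<in> borel_measurable borel" "integrable M (\<lambda>w. f (X w))"
  shows "expectation (fsum f J K) = real (K - J) * expectation (\<lambda>w. f (X w))"
proof -
  have "expectation (fsum f J K) = (\<Sum>j\<in>{J<..K}. expectation (\<lambda>w. f (Xs j w)))"
    unfolding fsum_def using assms ident_integral(2) by (intro Bochner_Integration.integral_sum) auto
  also have "... = (\<Sum>j\<in>{J<..K}. expectation (\<lambda>w. f (X w)))"
    using assms by (intro sum.cong ident_integral(1)) auto
  finally show ?thesis by simp
qed

text \<open>Let U and V be the sums over the two blocks. Then E|U| = E sgn(U) U = E sgn(U) (U + V)
  \<le> E|U + V|, because sgn(U) is independent of the centred V. This replaces conditional Jensen,
  and exchanging U and V gives the second bound.\<close>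

lemma expectation_abs_fsum_mono:
  assumes f: "f \<in> borel_measurable borel" and i: "integrable M (\<lambda>w. f (X w))"
    and z: "expectation (\<lambda>w. f (X w)) = 0" and J: "J \<le> L"
  shows "expectation (\<lambda>w. \<bar>fsum f 0 J w\<bar>) \<le> expectation (\<lambda>w. \<bar>fsum f 0 L w\<bar>)"
    and "expectation (\<lambda>w. \<bar>fsum f J L w\<bar>) \<le> expectation (\<lambda>w. \<bar>fsum f 0 L w\<bar>)"
proof -
  note [measurable] = rv_fsum[OF f] f
  let ?U = "fsum f 0 J" and ?V = "fsum f J L"
  have int: "integrable M (fsum f K K')" for K K' by (rule fsum_integrable[OF f i])
  have e0: "expectation (fsum f K K') = 0" for K K' using fsum_expectation[OF f i] z by simp
  have sgn_bd: "integrable M (\<lambda>w. sgn (fsum f K K' w))" for K K'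
    by (rule integrable_const_bound[where B=1]) (auto simp: sgn_real_def)
  have sgn_prod: "integrable M (\<lambda>w. sgn (fsum f K K' w) * fsum f I I' w)" for K K' I I'
    by (rule Bochner_Integration.integrable_bound[OF int[of I I']]) (auto simp: sgn_real_def)
  have le: "a \<le> b" if "a = expectation (\<lambda>w. sgn (W w) * fsum f 0 L w)" "b = expectation (\<lambda>w. \<bar>fsum f 0 L w\<bar>)"
    "integrable M (\<lambda>w. sgn (W w) * fsum f 0 L w)" for a b and W :: "'a \<Rightarrow> real"
    unfolding that(1,2)
    by (rule integral_mono[OF that(3)]) (use int[of 0 L] in \<open>auto simp: sgn_real_def\<close>)
  have split: "fsum f 0 L w = ?U w + ?V w" for w by (rule fsum_split[OF J])
  have "expectation (\<lambda>w. sgn (?U w) * ?V w) = expectation (\<lambda>w. sgn (?U w)) * expectation ?V"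
    by (rule indep_var_lebesgue_integral[OF indep_fsum[OF f, of sgn "\<lambda>x. x"] sgn_bd int]) measurable
  then have 1: "expectation (\<lambda>w. sgn (?U w) * ?V w) = 0" by (simp add: e0)
  have "expectation (\<lambda>w. ?U w * sgn (?V w)) = expectation ?U * expectation (\<lambda>w. sgn (?V w))"
    by (rule indep_var_lebesgue_integral[OF indep_fsum[OF f, of "\<lambda>x. x" sgn] int sgn_bd]) measurable
  then have 2: "expectation (\<lambda>w. sgn (?V w) * ?U w) = 0" by (simp add: e0 mult.commute)
  have as: "\<bar>x\<bar> = sgn x * x" for x :: real by (simp add: sgn_real_def)
  have "expectation (\<lambda>w. \<bar>?U w\<bar>) = expectation (\<lambda>w. sgn (?U w) * fsum f 0 L w)"
    unfolding split as distrib_left using 1 sgn_prod by (subst Bochner_Integration.integral_add) auto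
  then show "expectation (\<lambda>w. \<bar>?U w\<bar>) \<le> expectation (\<lambda>w. \<bar>fsum f 0 L w\<bar>)"
    by (rule le[OF _ refl sgn_prod])
  have "expectation (\<lambda>w. \<bar>?V w\<bar>) = expectation (\<lambda>w. sgn (?V w) * fsum f 0 L w)"
    unfolding split as distrib_left using 2 sgn_prod by (subst Bochner_Integration.integral_add) auto
  then show "expectation (\<lambda>w. \<bar>?V w\<bar>) \<le> expectation (\<lambda>w. \<bar>fsum f 0 L w\<bar>)"
    by (rule le[OF _ refl sgn_prod])
qed

text \<open>Including J = 0 keeps the set nonempty and the maximum nonnegative.\<close>

definition fmax :: "(real \<Rightarrow> real) \<Rightarrow> nat \<Rightarrow> 'a \<Rightarrow> real" where
  "fmax f n w = Max ((\<lambda>J. \<bar>fsum f 0 J w\<bar>) ` {0..n})"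

lemma rv_fmax: "f \<in> borel_measurable borel \<Longrightarrow> (\<lambda>w. fmax f n w) \<in> borel_measurable M"
  unfolding fmax_def by (intro borel_measurable_Max borel_measurable_abs rv_fsum) auto

lemma fmax_ge: "J \<le> n \<Longrightarrow> \<bar>fsum f 0 J w\<bar> \<le> fmax f n w"
  unfolding fmax_def by (intro Max_ge) auto

lemma fmax_nonneg: "0 \<le> fmax f n w"
  using fmax_ge[of 0 n f w] by simp

lemma fmax_mono: "n \<le> m \<Longrightarrow> fmax f n w \<le> fmax f m w"
  unfolding fmax_def by (intro Max_mono) auto

text \<open>With e = E|S(n)|, every increment to time n has mean modulus at most e, so Markov gives
  q = 1/2 at level 2e. Ottaviani then yields P(max > t + 2e) \<le> 2 P(|S(n)| > t), and integrating
  over t gives 2e + 2e.\<close>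

lemma expectation_fmax:
  assumes f: "f \<in> borel_measurable borel" and i: "integrable M (\<lambda>w. f (X w))"
    and z: "expectation (\<lambda>w. f (X w)) = 0"
  shows "(\<integral>\<^sup>+w. ennreal (fmax f n w) \<partial>M) \<le> ennreal (4 * expectation (\<lambda>w. \<bar>fsum f 0 n w\<bar>))"
proof -
  note [measurable] = rv_fsum[OF f] rv_fmax[OF f]
  define e where "e = expectation (\<lambda>w. \<bar>fsum f 0 n w\<bar>)"
  have e: "e \<ge> 0" by (simp add: e_def)
  have int: "integrable M (\<lambda>w. \<bar>fsum f K K' w\<bar>)" for K K'
    by (intro integrable_abs fsum_integrable[OF f i])
  have q: "\<P>(w in M. blk (\<lambda>_ _. f) {0} (path w) J n > 2 * e) \<le> 1 / 2" if "J \<in> {1..n}" for J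
  proof -
    have le_e: "expectation (\<lambda>w. \<bar>fsum f J n w\<bar>) \<le> e"
      unfolding e_def using that by (intro expectation_abs_fsum_mono[OF f i z]) auto
    show ?thesis
    proof (cases "e = 0")
      \<comment> \<open>Markov at level 2e would divide by zero; here the increments vanish almost
        surely.\<close>
      case True
      then have "expectation (\<lambda>w. \<bar>fsum f J n w\<bar>) = 0"
        using le_e by (intro antisym) auto
      then have "AE w in M. \<bar>fsum f J n w\<bar> = 0"
        using int by (subst (asm) integral_nonneg_eq_0_iff_AE) auto
      then have "\<P>(w in M. \<bar>fsum f J n w\<bar> > 0) = 0"
        by (subst prob_eq_0) (auto elim!: eventually_mono)
      then show ?thesis using True by (simp add: blk_fsum)
    next
      case False
      have "\<P>(w in M. \<bar>fsum f J n w\<bar> > 2 * e) \<le> \<P>(w in M. \<bar>fsum f J n w\<bar> \<ge> 2 * e)"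
        by (intro finite_measure_mono) auto
      also have "... \<le> expectation (\<lambda>w. \<bar>fsum f J n w\<bar>) / (2 * e)"
        using False e by (intro integral_Markov_inequality_measure[where A="{}"] int) auto
      also have "... \<le> 1 / 2" using le_e False e by (simp add: field_simps)
      finally show ?thesis by (simp add: blk_fsum)
    qed
  qed
  have ott: "\<P>(w in M. fmax f n w - 2 * e > t) \<le> 2 * \<P>(w in M. \<bar>fsum f 0 n w\<bar> > t)" if t: "t \<ge> 0" for t
  proof -
    have "(1 - 1/2) * \<P>(w in M. \<exists>J\<in>{1..n}. blk (\<lambda>_ _. f) {0} (path w) 0 J > t + 2 * e)
      \<le> \<P>(w in M. blk (\<lambda>_ _. f) {0} (path w) 0 n > t)"
      by (rule ottaviani[OF f q])
    moreover have "{w\<in>space M. fmax f n w - 2 * e > t} = {w\<in>space M. \<exists>J\<in>{1..n}. \<bar>fsum f 0 J w\<bar> > t + 2 * e}"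
    proof -
      have "fmax f n w - 2 * e > t \<longleftrightarrow> (\<exists>J\<in>{1..n}. \<bar>fsum f 0 J w\<bar> > t + 2 * e)" for w
      proof -
        have "fmax f n w - 2 * e > t \<longleftrightarrow> t + 2 * e < fmax f n w" by auto
        also have "... \<longleftrightarrow> (\<exists>J\<in>{0..n}. \<bar>fsum f 0 J w\<bar> > t + 2 * e)"
          unfolding fmax_def by (subst Max_gr_iff) auto
        also have "... \<longleftrightarrow> (\<exists>J\<in>{1..n}. \<bar>fsum f 0 J w\<bar> > t + 2 * e)"
        proof
          assume "\<exists>J\<in>{0..n}. \<bar>fsum f 0 J w\<bar> > t + 2 * e"
          then obtain J where J: "J \<le> n" "\<bar>fsum f 0 J w\<bar> > t + 2 * e" by auto
          have "J \<noteq> 0"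
          proof
            assume "J = 0"
            then show False using J e t by (simp add: fsum_def)
          qed
          then show "\<exists>J\<in>{1..n}. \<bar>fsum f 0 J w\<bar> > t + 2 * e" using J by auto
        qed auto
        finally show ?thesis .
      qed
      then show ?thesis by simp
    qed
    ultimately show ?thesis by (simp add: blk_fsum)
  qed
  have "(\<integral>\<^sup>+w. ennreal (fmax f n w) \<partial>M) \<le> (\<integral>\<^sup>+w. ennreal (2 * e) + ennreal (fmax f n w - 2 * e) \<partial>M)"
  proof (rule nn_integral_mono)
    fix w
    have "ennreal (fmax f n w) \<le> ennreal (2 * e + max 0 (fmax f n w - 2 * e))" by (rule ennreal_leI) simp
    also have "... = ennreal (2 * e) + ennreal (max 0 (fmax f n w - 2 * e))" using e by (intro ennreal_plus) auto
    also have "ennreal (max 0 (fmax f n w - 2 * e)) = ennreal (fmax f n w - 2 * e)"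
      by (cases "fmax f n w - 2 * e \<ge> 0") (auto simp: ennreal_neg)
    finally show "ennreal (fmax f n w) \<le> ennreal (2 * e) + ennreal (fmax f n w - 2 * e)" .
  qed
  also have "... = ennreal (2 * e) + (\<integral>\<^sup>+w. ennreal (fmax f n w - 2 * e) \<partial>M)"
    by (subst nn_integral_add) (auto simp: emeasure_space_1)
  also have "(\<integral>\<^sup>+w. ennreal (fmax f n w - 2 * e) \<partial>M)
    = tint (\<lambda>t. ennreal (\<P>(w in M. fmax f n w - 2 * e > t)))"
    by (rule layer_cake_1[symmetric]) measurable
  also have "... \<le> (\<integral>\<^sup>+t. 2 * (ennreal (\<P>(w in M. \<bar>fsum f 0 n w\<bar> > t)) * indicator {0..} t) \<partial>lborel)"
  proof (rule nn_integral_mono)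
    fix t :: real
    show "ennreal (\<P>(w in M. fmax f n w - 2 * e > t)) * indicator {0..} t
      \<le> 2 * (ennreal (\<P>(w in M. \<bar>fsum f 0 n w\<bar> > t)) * indicator {0..} t)"
    proof (cases "t \<ge> 0")
      case True
      have "ennreal (\<P>(w in M. fmax f n w - 2 * e > t)) \<le> ennreal (2 * \<P>(w in M. \<bar>fsum f 0 n w\<bar> > t))"
        by (rule ennreal_leI[OF ott[OF True]])
      then show ?thesis using True by (simp add: ennreal_mult)
    qed simp
  qed
  also have "... = 2 * tint (\<lambda>t. ennreal (\<P>(w in M. \<bar>fsum f 0 n w\<bar> > t)))"
  proof (rule nn_integral_cmult)
    have "(\<lambda>t. \<P>(w in M. \<bar>fsum f 0 n w\<bar> > t)) \<in> borel_measurable borel"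
      by (rule tail_measurable) measurable
    then show "(\<lambda>t. ennreal (\<P>(w in M. \<bar>fsum f 0 n w\<bar> > t)) * indicator {0..} t) \<in> borel_measurable lborel"
      by measurable
  qed
  also have "tint (\<lambda>t. ennreal (\<P>(w in M. \<bar>fsum f 0 n w\<bar> > t))) = ennreal e"
    unfolding e_def by (subst layer_cake_1) (auto intro!: nn_integral_eq_integral int)
  also have "ennreal (2 * e) + 2 * ennreal e = ennreal (4 * e)"
    using e by (simp add: ennreal_plus[symmetric] ennreal_mult[symmetric] del: ennreal_plus flip: ennreal_numeral)
  finally show ?thesis by (simp add: e_def)
qed

lemma half_min_le: "x \<ge> 0 \<Longrightarrow> min 1 x / 2 \<le> 1 - exp (- x :: real)"
proof -
  assume x: "x \<ge> 0"
  have "exp (- x) \<le> 1 / (1 + x)"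
    using exp_ge_add_one_self[of x] x by (simp add: exp_minus inverse_eq_divide frac_le)
  moreover have "min 1 x / 2 \<le> 1 - 1 / (1 + x)"
    using x mult_left_le[of x x] by (auto simp: min_def field_simps)
  ultimately show ?thesis by linarith
qed

text \<open>Each |f(X(j))| is at most V, built from the maximal centred sum, while
  \<open>half_min_le\<close> and \<open>prob_ex\<close> bound min(1, nq) by 2 P(V > t). The constant
  34 is 2 (2 * 4 * 2 + 1): centring at most doubles e, the maximal inequality costs 4, a summand is
  a difference of two partial sums, and the mean adds e once.\<close>

lemma tail_integral_le_sum:
  assumes f: "f \<in> borel_measurable borel" and i: "integrable M (\<lambda>w. f (X w))" and n: "n \<ge> 1"
  shows "tint (\<lambda>t. ennreal (min 1 (real n * \<P>(w in M. \<bar>f (X w)\<bar> > t))))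
    \<le> 34 * absE (fsum f 0 n)"
proof -
  note [measurable] = f rv_fsum[OF f] 
  define \<mu> where "\<mu> = expectation (\<lambda>w. f (X w))"
  define g where "g x = f x - \<mu>" for x
  have g[measurable]: "g \<in> borel_measurable borel" unfolding g_def by measurable
  have gi: "integrable M (\<lambda>w. g (X w))" using i by (simp add: g_def)
  have gz: "expectation (\<lambda>w. g (X w)) = 0" using i by (simp add: g_def \<mu>_def prob_space)
  note [measurable] = rv_fsum[OF g] rv_fmax[OF g]
  define e where "e = expectation (\<lambda>w. \<bar>fsum f 0 n w\<bar>)"
  have e: "e \<ge> 0" by (simp add: e_def)
  have gf: "fsum g 0 K w = fsum f 0 K w - real K * \<mu>" for K w
    by (simp add: fsum_def g_def sum_subtractf)
  have intf: "integrable M (fsum f J K)" for J K by (rule fsum_integrable[OF f i])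
  have intg: "integrable M (fsum g J K)" for J K by (rule fsum_integrable[OF g gi])
  \<comment> \<open>f need not have mean zero, but |E S(n)| \<le> E|S(n)| makes the centring cost at
    most e.\<close>
  have n\<mu>: "real n * \<bar>\<mu>\<bar> \<le> e"
  proof -
    have "real n * \<bar>\<mu>\<bar> = \<bar>expectation (fsum f 0 n)\<bar>"
      by (simp add: fsum_expectation[OF f i] \<mu>_def abs_mult)
    also have "... \<le> e" unfolding e_def by (rule integral_abs_bound)
    finally show ?thesis .
  qed
  have \<mu>e: "\<bar>\<mu>\<bar> \<le> e" using n\<mu> n mult_right_mono[of 1 "real n" "\<bar>\<mu>\<bar>"] by simp
  have eg: "expectation (\<lambda>w. \<bar>fsum g 0 n w\<bar>) \<le> 2 * e"
  proof -
    have "expectation (\<lambda>w. \<bar>fsum g 0 n w\<bar>) \<le> expectation (\<lambda>w. \<bar>fsum f 0 n w\<bar> + real n * \<bar>\<mu>\<bar>)"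
      using intf intg by (intro integral_mono) (auto simp: gf abs_mult intro: order_trans[OF abs_triangle_ineq4])
    also have "... = e + real n * \<bar>\<mu>\<bar>" using intf by (simp add: e_def prob_space)
    finally show ?thesis using n\<mu> by simp
  qed
  define V where "V w = 2 * fmax g n w + \<bar>\<mu>\<bar>" for w
  have [measurable]: "V \<in> borel_measurable M" unfolding V_def by measurable
  have V: "\<bar>f (Xs j w)\<bar> \<le> V w" if "j \<in> {1..n}" for j w
  proof -
    have "{j - 1<..j} = {j}" using that by auto
    then have "f (Xs j w) = fsum g 0 j w - fsum g 0 (j - 1) w + \<mu>"
      using fsum_split[of "j - 1" j g w] by (simp add: fsum_def g_def)
    moreover have "\<bar>fsum g 0 j w\<bar> \<le> fmax g n w" "\<bar>fsum g 0 (j - 1) w\<bar> \<le> fmax g n w"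
      using that by (intro fmax_ge; force)+
    ultimately show ?thesis unfolding V_def by linarith
  qed
  have "ennreal (min 1 (real n * \<P>(w in M. \<bar>f (X w)\<bar> > t))) \<le> 2 * ennreal (\<P>(w in M. V w > t))" for t
  proof -
    let ?q = "\<P>(w in M. \<bar>f (X w)\<bar> > t)"
    have "min 1 (real n * ?q) / 2 \<le> 1 - exp (- (real n * ?q))" by (rule half_min_le) simp
    also have "... = 1 - exp (- (\<Sum>j=1..n. \<P>(w in M. X w \<in> {x. \<bar>f x\<bar> > t})))" by simp
    also have "... \<le> \<P>(w in M. \<exists>j\<in>{1..n}. Xs j w \<in> {x. \<bar>f x\<bar> > t})"
      by (rule prob_ex) measurable
    also have "... \<le> \<P>(w in M. V w > t)"
    proof (rule finite_measure_mono)
      show "{w\<in>space M. \<exists>j\<in>{1..n}. Xs j w \<in> {x. \<bar>f x\<bar> > t}} \<subseteq> {w\<in>space M. V w > t}"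
        using V by (auto intro: less_le_trans)
    qed measurable
    finally have "min 1 (real n * ?q) \<le> 2 * \<P>(w in M. V w > t)" by simp
    then have "ennreal (min 1 (real n * ?q)) \<le> ennreal (2 * \<P>(w in M. V w > t))" by (rule ennreal_leI)
    then show ?thesis by (simp add: ennreal_mult)
  qed
  then have "tint (\<lambda>t. ennreal (min 1 (real n * \<P>(w in M. \<bar>f (X w)\<bar> > t))))
    \<le> (\<integral>\<^sup>+t. 2 * (ennreal (\<P>(w in M. V w > t)) * indicator {0..} t) \<partial>lborel)"
    by (intro nn_integral_mono) (auto simp: indicator_def)
  also have "... = 2 * tint (\<lambda>t. ennreal (\<P>(w in M. V w > t)))"
  proof (rule nn_integral_cmult)
    show "(\<lambda>t. ennreal (\<P>(w in M. V w > t)) * indicator {0..} t) \<in> borel_measurable lborel"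
      using tail_measurable[of V] by measurable
  qed
  also have "tint (\<lambda>t. ennreal (\<P>(w in M. V w > t))) = (\<integral>\<^sup>+w. ennreal (V w) \<partial>M)"
    by (rule layer_cake_1) measurable
  also have "... = 2 * (\<integral>\<^sup>+w. ennreal (fmax g n w) \<partial>M) + ennreal \<bar>\<mu>\<bar>"
    by (simp add: V_def fmax_nonneg ennreal_plus ennreal_mult nn_integral_add nn_integral_cmult emeasure_space_1)
  also have "... \<le> 2 * ennreal (4 * (2 * e)) + ennreal e"
  proof (intro add_mono mult_left_mono ennreal_leI)
    show "(\<integral>\<^sup>+w. ennreal (fmax g n w) \<partial>M) \<le> ennreal (4 * (2 * e))"
      using expectation_fmax[OF g gi gz, of n] by (rule order_trans) (use eg in \<open>intro ennreal_leI, simp\<close>)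
  qed (use \<mu>e in auto)
  also have "... = 17 * ennreal e"
    using e by (simp add: ennreal_plus[symmetric] ennreal_mult[symmetric] del: ennreal_plus flip: ennreal_numeral)
  also have "ennreal e = absE (fsum f 0 n)"
    unfolding e_def using intf by (intro nn_integral_eq_integral[symmetric]) auto
  finally show ?thesis by (simp add: mult.assoc[symmetric] mult_left_mono)
qed


section \<open>Upper bound for centred sums by integration over levels\<close>

lemma fsum_bound:
  assumes "\<And>x. \<bar>f x\<bar> \<le> B"
  shows "\<bar>fsum f J K w\<bar> \<le> real (K - J) * B"
proof -
  have "\<bar>fsum f J K w\<bar> \<le> (\<Sum>j\<in>{J<..K}. \<bar>f (Xs j w)\<bar>)" unfolding fsum_def by (rule sum_abs)
  also have "... \<le> (\<Sum>j\<in>{J<..K}. B)" using assms by (intro sum_mono) auto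
  finally show ?thesis by simp
qed

lemma expectation_fsum_square:
  assumes k: "k \<in> borel_measurable borel" and B: "\<And>x. \<bar>k x\<bar> \<le> B"
    and z: "expectation (\<lambda>w. k (X w)) = 0"
  shows "expectation (\<lambda>w. (fsum k 0 n w)\<^sup>2) = real n * expectation (\<lambda>w. (k (X w))\<^sup>2)"
proof (induction n)
  case 0
  then show ?case by (simp add: fsum_def)
next
  case (Suc n)
  note [measurable] = rv_fsum[OF k] k
  have ik: "integrable M (\<lambda>w. k (X w))"
    by (rule integrable_const_bound[where B=B]) (use B in auto)
  have int: "integrable M (fsum k J K)" for J K by (rule fsum_integrable[OF k ik])
  have int2: "integrable M (\<lambda>w. fsum k J K w * fsum k J' K' w)" for J K J' K'
  proof (rule integrable_const_bound[where B="(real (K - J) * B) * (real (K' - J') * B)"])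
    show "AE w in M. norm (fsum k J K w * fsum k J' K' w) \<le> (real (K - J) * B) * (real (K' - J') * B)"
      using fsum_bound[of k B, OF B] B[of 0] by (intro AE_I2) (auto simp: abs_mult intro!: mult_mono)
  qed measurable
  have s: "fsum k 0 (Suc n) w = fsum k 0 n w + fsum k n (Suc n) w" for w by (rule fsum_split) simp
  have cross: "expectation (\<lambda>w. fsum k 0 n w * fsum k n (Suc n) w) = 0"
    using indep_var_lebesgue_integral[OF indep_fsum[OF k, of "\<lambda>x. x" "\<lambda>x. x" n "Suc n"] int int]
      fsum_expectation[OF k ik] z by simp
  have one: "expectation (\<lambda>w. fsum k n (Suc n) w * fsum k n (Suc n) w) = expectation (\<lambda>w. (k (X w))\<^sup>2)"
  proof -
    have "{n<..Suc n} = {Suc n}" by auto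
    then show ?thesis using ident_integral(1)[of "Suc n" "\<lambda>x. (k x)\<^sup>2"] by (simp add: fsum_def power2_eq_square)
  qed
  have "expectation (\<lambda>w. (fsum k 0 (Suc n) w)\<^sup>2) =
    expectation (\<lambda>w. fsum k 0 n w * fsum k 0 n w + 2 * (fsum k 0 n w * fsum k n (Suc n) w)
      + fsum k n (Suc n) w * fsum k n (Suc n) w)"
    unfolding s by (simp add: power2_eq_square algebra_simps)
  also have "... = expectation (\<lambda>w. fsum k 0 n w * fsum k 0 n w) + 2 * expectation (\<lambda>w. fsum k 0 n w * fsum k n (Suc n) w)
      + expectation (\<lambda>w. fsum k n (Suc n) w * fsum k n (Suc n) w)"
    using int2 by simp
  also have "... = real n * expectation (\<lambda>w. (k (X w))\<^sup>2) + expectation (\<lambda>w. (k (X w))\<^sup>2)"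
    using Suc cross one by (simp add: power2_eq_square)
  finally show ?case by (simp add: algebra_simps)
qed

text \<open>The mean of the modulus is at most the standard deviation, variances of independent
  summands add, and a variance is at most the second moment.\<close>

lemma expectation_abs_centered_le:
  assumes g: "g \<in> borel_measurable borel" and B: "\<And>x. \<bar>g x\<bar> \<le> 1"
  shows "expectation (\<lambda>w. \<bar>fsum g 0 n w - real n * expectation (\<lambda>w. g (X w))\<bar>)
    \<le> sqrt (real n * expectation (\<lambda>w. (g (X w))\<^sup>2))"
proof -
  note [measurable] = g
  define m where "m = expectation (\<lambda>w. g (X w))"
  define k where "k x = g x - m" for x
  have k [measurable]: "k \<in> borel_measurable borel" unfolding k_def by measurable
  have gi: "integrable M (\<lambda>w. g (X w))"
    by (rule integrable_const_bound[where B=1]) (use B in auto)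
  have gi2: "integrable M (\<lambda>w. (g (X w))\<^sup>2)"
    by (rule integrable_const_bound[where B=1]) (use B in \<open>auto simp: abs_square_le_1\<close>)
  have kB: "\<bar>k x\<bar> \<le> 1 + \<bar>m\<bar>" for x using B[of x] unfolding k_def by linarith
  have ki: "integrable M (\<lambda>w. k (X w))" unfolding k_def using gi by simp
  have kz: "expectation (\<lambda>w. k (X w)) = 0" unfolding k_def using gi by (simp add: m_def prob_space)
  note [measurable] = rv_fsum[OF k]
  have kg: "fsum k 0 n w = fsum g 0 n w - real n * m" for w
    by (simp add: fsum_def k_def sum_subtractf)
  let ?W = "\<lambda>w. \<bar>fsum k 0 n w\<bar>"
  have iW: "integrable M ?W" by (intro integrable_abs fsum_integrable[OF k ki])
  have iW2: "integrable M (\<lambda>w. (?W w)\<^sup>2)"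
    by (rule integrable_const_bound[where B="(real (n - 0) * (1 + \<bar>m\<bar>))\<^sup>2"])
      (use fsum_bound[of k "1 + \<bar>m\<bar>" 0 n, OF kB] in \<open>auto simp: abs_le_square_iff[symmetric]\<close>)
  have "(expectation ?W)\<^sup>2 \<le> expectation (\<lambda>w. (?W w)\<^sup>2)"
    using variance_positive[of ?W] variance_eq[OF iW iW2] by simp
  also have "... = real n * expectation (\<lambda>w. (k (X w))\<^sup>2)"
    using expectation_fsum_square[OF k kB kz, of n] by simp
  also have "... \<le> real n * expectation (\<lambda>w. (g (X w))\<^sup>2)"
  proof (rule mult_left_mono)
    have "expectation (\<lambda>w. (k (X w))\<^sup>2) = expectation (\<lambda>w. (g (X w))\<^sup>2) - m\<^sup>2"
      using variance_eq[OF gi gi2] by (simp add: k_def m_def)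
    then show "expectation (\<lambda>w. (k (X w))\<^sup>2) \<le> expectation (\<lambda>w. (g (X w))\<^sup>2)" by simp
  qed simp
  finally have "expectation ?W \<le> sqrt (real n * expectation (\<lambda>w. (g (X w))\<^sup>2))" by (rule real_le_rsqrt)
  then show ?thesis by (simp add: kg m_def)
qed

text \<open>The variance argument is applied separately at each level t, where the summands are
  bounded by 1 and have second moment q(t). This produces a square root although f(X) is merely
  integrable; the triangle inequality gives the linear alternative.\<close>

lemma centered_sum_le_tail_integral:
  assumes f: "f \<in> borel_measurable borel" and i: "integrable M (\<lambda>w. f (X w))"
  defines "q \<equiv> \<lambda>t. \<P>(w in M. \<bar>f (X w)\<bar> > t)"
  shows "(\<integral>\<^sup>+w. ennreal \<bar>fsum f 0 n w - real n * expectation (\<lambda>w. f (X w))\<bar> \<partial>M)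
    \<le> tint (\<lambda>t. ennreal (min (2 * real n * q t) (sqrt (real n * q t))))"
proof -
  note [measurable] = f
  interpret P: pair_sigma_finite lborel M ..
  define \<phi> where "\<phi> t y = (if t < \<bar>f y\<bar> then sgn (f y) else 0)" for t y
  define ind where "ind t = (indicator {0..} t :: real)" for t :: real
  have [measurable]: "ind \<in> borel_measurable borel" unfolding ind_def by measurable
  define m where "m t = expectation (\<lambda>w. \<phi> t (X w))" for t
  have \<phi>m [measurable]: "\<phi> t \<in> borel_measurable borel" for t unfolding \<phi>_def by measurable
  have \<phi>B: "\<bar>\<phi> t y\<bar> \<le> 1" for t y by (auto simp: \<phi>_def sgn_real_def)
  have pm: "(\<lambda>x. \<phi> (fst x) (Y (snd x))) \<in> borel_measurable (lborel \<Otimes>\<^sub>M M)"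
    if [measurable]: "Y \<in> borel_measurable M" for Y
    unfolding \<phi>_def by measurable
  have mm [measurable]: "m \<in> borel_measurable borel"
  proof -
    have "(\<lambda>(t, w). \<phi> t (X w)) \<in> borel_measurable (lborel \<Otimes>\<^sub>M M)"
      using pm[OF rv_X] by (simp add: case_prod_beta')
    then have "(\<lambda>t. expectation (\<lambda>w. \<phi> t (X w))) \<in> borel_measurable lborel"
      by (rule borel_measurable_lebesgue_integral)
    then show ?thesis by (simp add: m_def[abs_def])
  qed
  have sl: "indicator {0..<v} t = ind t * (if t < v then 1 else 0)" for t v :: real
    by (auto simp: ind_def indicator_def)
  have il: "integrable lborel (\<lambda>t. ind t * \<phi> t y)" and el: "(LINT t|lborel. ind t * \<phi> t y) = f y" for y
  proof -
    have e: "ind t * \<phi> t y = sgn (f y) * indicator {0..<\<bar>f y\<bar>} t" for t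
      by (simp add: sl \<phi>_def)
    show "integrable lborel (\<lambda>t. ind t * \<phi> t y)" unfolding e by (intro integrable_mult_right integrable_real_indicator) auto
    show "(LINT t|lborel. ind t * \<phi> t y) = f y" unfolding e by (simp add: sgn_mult_abs)
  qed
  \<comment> \<open>Joint integrability, with total mass at most E|f(X)|, lets the mean pass inside
    the level integral.\<close>
  have prodint: "integrable (lborel \<Otimes>\<^sub>M M) (\<lambda>(t, w). ind t * \<phi> t (X w))"
  proof (rule integrableI_bounded)
    show pmeas: "(\<lambda>(t, w). ind t * \<phi> t (X w)) \<in> borel_measurable (lborel \<Otimes>\<^sub>M M)"
      using pm[OF rv_X, measurable] unfolding case_prod_beta' by measurable
    have "(\<integral>\<^sup>+x. ennreal (norm (case x of (t, w) \<Rightarrow> ind t * \<phi> t (X w))) \<partial>(lborel \<Otimes>\<^sub>M M))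
      = (\<integral>\<^sup>+w. \<integral>\<^sup>+t. ennreal (norm (ind t * \<phi> t (X w))) \<partial>lborel \<partial>M)"
      using pmeas by (subst P.nn_integral_snd[symmetric]) (auto simp: case_prod_beta')
    also have "... \<le> (\<integral>\<^sup>+w. ennreal (norm (f (X w))) \<partial>M)"
    proof (rule nn_integral_mono)
      fix w
      have "(\<integral>\<^sup>+t. ennreal (norm (ind t * \<phi> t (X w))) \<partial>lborel) \<le> (\<integral>\<^sup>+t. indicator {0..<\<bar>f (X w)\<bar>} t \<partial>lborel)"
        by (intro nn_integral_mono) (auto simp: ind_def \<phi>_def indicator_def sgn_real_def)
      then show "(\<integral>\<^sup>+t. ennreal (norm (ind t * \<phi> t (X w))) \<partial>lborel) \<le> ennreal (norm (f (X w)))" by simp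
    qed
    also have "... < \<infinity>" using i by (simp add: integrable_iff_bounded)
    finally show "(\<integral>\<^sup>+x. ennreal (norm (case x of (t, w) \<Rightarrow> ind t * \<phi> t (X w))) \<partial>(lborel \<Otimes>\<^sub>M M)) < \<infinity>" .
  qed
  have im: "integrable lborel (\<lambda>t. ind t * m t)"
    using P.integrable_fst'[OF prodint] by (simp add: m_def)
  have em: "(LINT t|lborel. ind t * m t) = expectation (\<lambda>w. f (X w))"
    using P.Fubini_integral[OF prodint] by (simp add: el m_def)
  \<comment> \<open>The centred sum at level t; its integral over t \<ge> 0 is the centred sum of
    f.\<close>
  define W where "W t w = fsum (\<phi> t) 0 n w - real n * m t" for t w
  have rep: "(LINT t|lborel. ind t * W t w) = fsum f 0 n w - real n * expectation (\<lambda>w. f (X w))"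
    and repi: "integrable lborel (\<lambda>t. ind t * W t w)" for w
  proof -
    have e: "ind t * W t w = (\<Sum>j\<in>{0<..n}. ind t * \<phi> t (Xs j w)) - real n * (ind t * m t)" for t
      by (simp add: W_def fsum_def sum_distrib_left right_diff_distrib)
    show "integrable lborel (\<lambda>t. ind t * W t w)" unfolding e using il im by auto
    show "(LINT t|lborel. ind t * W t w) = fsum f 0 n w - real n * expectation (\<lambda>w. f (X w))"
      unfolding e using il im
      by (subst Bochner_Integration.integral_diff) (auto simp: Bochner_Integration.integral_sum el em fsum_def)
  qed
  have Wm: "(\<lambda>x. ind (fst x) * W (fst x) (snd x)) \<in> borel_measurable (lborel \<Otimes>\<^sub>M M)"
  proof -
    have "(\<lambda>x. \<Sum>j\<in>{0<..n}. \<phi> (fst x) (Xs j (snd x))) \<in> borel_measurable (lborel \<Otimes>\<^sub>M M)"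
      by (intro borel_measurable_sum pm rv_Xs) auto
    then show ?thesis unfolding W_def fsum_def by measurable
  qed
  have "(\<integral>\<^sup>+w. ennreal \<bar>fsum f 0 n w - real n * expectation (\<lambda>w. f (X w))\<bar> \<partial>M)
    \<le> (\<integral>\<^sup>+w. \<integral>\<^sup>+t. ennreal \<bar>ind t * W t w\<bar> \<partial>lborel \<partial>M)"
    using integral_norm_bound_ennreal[OF repi] unfolding rep by (intro nn_integral_mono) auto
  also have "... = (\<integral>\<^sup>+t. \<integral>\<^sup>+w. ennreal \<bar>ind t * W t w\<bar> \<partial>M \<partial>lborel)"
    using Wm by (intro P.Fubini') (auto simp: case_prod_beta')
  also have "... \<le> tint (\<lambda>t. ennreal (min (2 * real n * q t) (sqrt (real n * q t))))"
  proof (rule nn_integral_mono)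
    fix t :: real
    note [measurable] = rv_fsum[OF \<phi>m]
    have \<phi>i: "integrable M (\<lambda>w. \<phi> t (X w))"
      by (rule integrable_const_bound[where B=1]) (use \<phi>B in auto)
    have Wi: "integrable M (W t)" unfolding W_def using fsum_integrable[OF \<phi>m \<phi>i] by auto
    show "(\<integral>\<^sup>+w. ennreal \<bar>ind t * W t w\<bar> \<partial>M) \<le> ennreal (min (2 * real n * q t) (sqrt (real n * q t))) * indicator {0..} t"
    proof (cases "t \<ge> 0")
      case True
      have Eq: "expectation (\<lambda>w. (\<phi> t (X w))\<^sup>2) = q t" "expectation (\<lambda>w. \<bar>\<phi> t (X w)\<bar>) = q t"
      proof -
        let ?A = "{w\<in>space M. \<bar>f (X w)\<bar> > t}"
        have "?A \<in> events" by measurable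
        have "expectation (\<lambda>w. (\<phi> t (X w))\<^sup>2) = expectation (indicator ?A)"
          "expectation (\<lambda>w. \<bar>\<phi> t (X w)\<bar>) = expectation (indicator ?A)"
          using True by (intro Bochner_Integration.integral_cong; auto simp: \<phi>_def sgn_real_def)+
        then show "expectation (\<lambda>w. (\<phi> t (X w))\<^sup>2) = q t" "expectation (\<lambda>w. \<bar>\<phi> t (X w)\<bar>) = q t"
          using \<open>?A \<in> events\<close> by (simp_all add: q_def)
      qed
      have 1: "expectation (\<lambda>w. \<bar>W t w\<bar>) \<le> sqrt (real n * q t)"
        using expectation_abs_centered_le[OF \<phi>m \<phi>B, of t n] by (simp add: W_def m_def Eq)
      have 2: "expectation (\<lambda>w. \<bar>W t w\<bar>) \<le> 2 * real n * q t"
      proof -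
        have ab: "\<bar>m t\<bar> \<le> q t" unfolding m_def Eq(2)[symmetric] by (rule integral_abs_bound)
        have \<phi>a: "(\<lambda>x. \<bar>\<phi> t x\<bar>) \<in> borel_measurable borel" by measurable
        have \<phi>ai: "integrable M (\<lambda>w. \<bar>\<phi> t (X w)\<bar>)" using \<phi>i by simp
        have "expectation (\<lambda>w. \<bar>W t w\<bar>) \<le> expectation (\<lambda>w. fsum (\<lambda>x. \<bar>\<phi> t x\<bar>) 0 n w + real n * q t)"
        proof (rule integral_mono)
          show "integrable M (\<lambda>w. fsum (\<lambda>x. \<bar>\<phi> t x\<bar>) 0 n w + real n * q t)"
            using fsum_integrable[OF \<phi>a \<phi>ai] by auto
          fix w
          have "\<bar>W t w\<bar> \<le> \<bar>fsum (\<phi> t) 0 n w\<bar> + \<bar>real n * m t\<bar>" unfolding W_def by (rule abs_triangle_ineq4)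
          also have "\<bar>fsum (\<phi> t) 0 n w\<bar> \<le> fsum (\<lambda>x. \<bar>\<phi> t x\<bar>) 0 n w" unfolding fsum_def by (rule sum_abs)
          also have "\<bar>real n * m t\<bar> \<le> real n * q t" using ab by (simp add: abs_mult mult_left_mono)
          finally show "\<bar>W t w\<bar> \<le> fsum (\<lambda>x. \<bar>\<phi> t x\<bar>) 0 n w + real n * q t" by simp
        qed (use Wi in auto)
        also have "... = 2 * real n * q t"
          using fsum_integrable[OF \<phi>a \<phi>ai] fsum_expectation[OF \<phi>a \<phi>ai, of 0 n] by (simp add: Eq prob_space)
        finally show ?thesis .
      qed
      have "(\<integral>\<^sup>+w. ennreal \<bar>ind t * W t w\<bar> \<partial>M) = ennreal (expectation (\<lambda>w. \<bar>W t w\<bar>))"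
        using True Wi by (subst nn_integral_eq_integral) (auto simp: ind_def)
      also have "... \<le> ennreal (min (2 * real n * q t) (sqrt (real n * q t)))"
        using 1 2 by (intro ennreal_leI) auto
      finally show ?thesis using True by simp
    qed (simp add: ind_def)
  qed
  finally show ?thesis .
qed

end

subsection \<open>The cases p < 1 and 1 < p < 2\<close>

lemma suminf_two_le:
  fixes f g h :: "nat \<Rightarrow> real"
  assumes le: "\<And>n. f n \<le> a * g n + b * h n" and nn: "\<And>n. 0 \<le> g n" "\<And>n. 0 \<le> h n"
    and ab: "0 \<le> a" "0 \<le> b" "0 \<le> G" "0 \<le> H"
    and G: "(\<Sum>n. ennreal (g n)) \<le> ennreal G" and H: "(\<Sum>n. ennreal (h n)) \<le> ennreal H"
  shows "(\<Sum>n. ennreal (f n)) \<le> ennreal (a * G + b * H)"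
proof -
  have "(\<Sum>n. ennreal (f n)) \<le> (\<Sum>n. ennreal a * ennreal (g n) + ennreal b * ennreal (h n))"
  proof (rule suminf_le)
    fix n
    have "ennreal (f n) \<le> ennreal (a * g n + b * h n)" by (rule ennreal_leI[OF le])
    also have "... = ennreal a * ennreal (g n) + ennreal b * ennreal (h n)"
      using nn ab by (simp add: ennreal_plus ennreal_mult)
    finally show "ennreal (f n) \<le> ennreal a * ennreal (g n) + ennreal b * ennreal (h n)" .
  qed (rule summableI)+
  also have "... = ennreal a * (\<Sum>n. ennreal (g n)) + ennreal b * (\<Sum>n. ennreal (h n))"
    by (simp add: suminf_add[OF summableI summableI, symmetric] ennreal_suminf_cmult)
  also have "... \<le> ennreal a * ennreal G + ennreal b * ennreal H"
    using G H by (intro add_mono mult_left_mono) auto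
  also have "... = ennreal (a * G + b * H)" using ab by (simp add: ennreal_plus ennreal_mult)
  finally show ?thesis .
qed

lemma wt_times_n: "wt p n * real n = real n powr (- (1 / p))"
  by (cases "n = 0") (simp_all add: wt_def powr_diff powr_minus field_simps)

lemma wt_times_sqrt: "wt p n * sqrt (real n) = real n powr (- (1 / 2 + 1 / p))"
proof (cases "n = 0")
  case False
  have "wt p n * sqrt (real n) = real n powr (-1 - 1 / p + 1 / 2)"
    unfolding wt_def powr_half_sqrt[OF of_nat_0_le_iff, symmetric] by (simp only: powr_add)
  also have "-1 - 1 / p + 1 / 2 = - (1 / 2 + 1 / p)" by simp
  finally show ?thesis .
qed simp

text \<open>The cut is y = 1/P. Below it the linear bound sums n^(-1/p), of order y^(1-1/p) since p
  > 1; above it the root bound sums n^(-1/2-1/p), convergent since p < 2. Both pieces scale exactly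
  like P^(1/p).\<close>

lemma sum_min_le:
  fixes p P :: real
  assumes p: "1 < p" "p < 2" and P: "0 \<le> P"
  shows "(\<Sum>n. ennreal (wt p n * min (2 * real n * P) (sqrt (real n * P))))
    \<le> ennreal ((2 / (1 - 1 / p) + 2 powr (1 / 2 + 1 / p) / ((1 / 2 + 1 / p) - 1)) * P powr (1 / p))"
proof (cases "P = 0")
  case False
  then have P0: "P > 0" using P by simp
  define \<beta> where "\<beta> = 1 - 1 / p"
  define \<alpha> where "\<alpha> = 1 / 2 + 1 / p"
  have \<beta>: "0 < \<beta>" "\<beta> < 1" and \<alpha>: "1 < \<alpha>" using p by (auto simp: \<beta>_def \<alpha>_def field_simps)
  define y where "y = 1 / P"
  have y: "y > 0" using P0 by (simp add: y_def)
  have "(\<Sum>n. ennreal (wt p n * min (2 * real n * P) (sqrt (real n * P))))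
    \<le> ennreal ((2 * P) * (1 / \<beta> * y powr \<beta>) + sqrt P * (2 powr \<alpha> / (\<alpha> - 1) * y powr (1 - \<alpha>)))"
  proof (rule suminf_two_le)
    show "(\<Sum>n. ennreal (real n powr (\<beta> - 1) * indicator {..y} (real n))) \<le> ennreal (1 / \<beta> * y powr \<beta>)"
      using \<beta> y by (intro sum_powr_head) auto
    show "(\<Sum>n. ennreal (real n powr (-\<alpha>) * indicator {y..} (real n))) \<le> ennreal (2 powr \<alpha> / (\<alpha> - 1) * y powr (1 - \<alpha>))"
      using \<alpha> y by (intro sum_powr_tail) auto
    fix n :: nat
    have 1: "wt p n * (2 * real n * P) = 2 * P * real n powr (\<beta> - 1)"
      using wt_times_n[of p n] by (simp add: \<beta>_def mult_ac)
    have 2: "wt p n * sqrt (real n * P) = sqrt P * real n powr (-\<alpha>)"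
      using wt_times_sqrt[of p n] by (simp add: \<alpha>_def real_sqrt_mult mult_ac)
    show "wt p n * min (2 * real n * P) (sqrt (real n * P))
      \<le> 2 * P * (real n powr (\<beta> - 1) * indicator {..y} (real n)) + sqrt P * (real n powr (-\<alpha>) * indicator {y..} (real n))"
    proof (cases "real n \<le> y")
      case True
      have "wt p n * min (2 * real n * P) (sqrt (real n * P)) \<le> wt p n * (2 * real n * P)"
        by (intro mult_left_mono) auto
      then show ?thesis using True P unfolding 1 by (simp add: add_increasing2)
    next
      case False
      have "wt p n * min (2 * real n * P) (sqrt (real n * P)) \<le> wt p n * sqrt (real n * P)"
        by (intro mult_left_mono) auto
      then show ?thesis using False P unfolding 2 by simp
    qed
  qed (use P \<beta> \<alpha> in auto)
  also have "(2 * P) * (1 / \<beta> * y powr \<beta>) + sqrt P * (2 powr \<alpha> / (\<alpha> - 1) * y powr (1 - \<alpha>))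
    = (2 / \<beta> + 2 powr \<alpha> / (\<alpha> - 1)) * P powr (1 / p)"
  proof -
    have yp: "y powr z = P powr (- z)" for z
      unfolding y_def using P0 by (simp add: powr_divide powr_minus_divide)
    have "P * y powr \<beta> = P powr 1 * P powr (- \<beta>)" using P0 yp by simp
    also have "... = P powr (1 / p)" unfolding powr_add[symmetric] by (simp add: \<beta>_def)
    finally have 1: "P * y powr \<beta> = P powr (1 / p)" .
    have "sqrt P * y powr (1 - \<alpha>) = P powr (1 / 2) * P powr (- (1 - \<alpha>))"
      using P yp by (simp add: powr_half_sqrt)
    also have "... = P powr (1 / p)" unfolding powr_add[symmetric] by (simp add: \<alpha>_def)
    finally have 2: "sqrt P * y powr (1 - \<alpha>) = P powr (1 / p)" .
    have "(2 * P) * (1 / \<beta> * y powr \<beta>) + sqrt P * (2 powr \<alpha> / (\<alpha> - 1) * y powr (1 - \<alpha>))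
      = 2 / \<beta> * (P * y powr \<beta>) + 2 powr \<alpha> / (\<alpha> - 1) * (sqrt P * y powr (1 - \<alpha>))" by (simp add: mult_ac)
    then show ?thesis unfolding 1 2 by (simp only: distrib_right)
  qed
  finally show ?thesis unfolding \<alpha>_def \<beta>_def .
qed simp

text \<open>One block {N..2N} starting at N = ceiling(1/P) suffices, since the minimum is 1 on it. P
  \<le> 1 gives N \<le> 2/P, so the block has weight of order P^(1/p).\<close>

lemma sum_min_one_ge:
  fixes p P :: real
  assumes p: "0 < p" and P: "0 \<le> P" "P \<le> 1"
  shows "ennreal (2 powr (-1 - 1 / p) * 2 powr (- (1 / p)) * P powr (1 / p)) \<le> (\<Sum>n. ennreal (wt p n * min 1 (real n * P)))"
proof (cases "P = 0")
  case False
  then have P0: "P > 0" using P by simp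
  define N where "N = nat \<lceil>1 / P\<rceil>"
  have P1: "1 \<le> 1 / P" using P P0 by simp
  have "real N \<ge> 1 / P" unfolding N_def by (rule real_nat_ceiling_ge)
  moreover have "real N \<le> 1 / P + 1" unfolding N_def using P1 by linarith
  ultimately have N: "real N \<ge> 1 / P" "real N \<le> 2 * (1 / P)" "N \<ge> 1" using P1 by linarith+
  have "2 powr (- (1 / p)) * P powr (1 / p) = (2 * (1 / P)) powr (- (1 / p))"
    using P0 by (simp add: powr_mult powr_divide powr_minus field_simps)
  also have "... \<le> real N powr (- (1 / p))"
    using N p by (intro powr_mono2') auto
  finally have "2 powr (-1 - 1 / p) * (2 powr (- (1 / p)) * P powr (1 / p)) \<le> 2 powr (-1 - 1 / p) * real N powr (- (1 / p))"
    by (intro mult_left_mono) auto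
  also have "... \<le> (\<Sum>n=N..2*N. wt p n)"
    unfolding wt_def using N p by (intro powr_block_lower) auto
  also have "... = (\<Sum>n=N..2*N. wt p n * min 1 (real n * P))"
  proof (rule sum.cong[OF refl])
    fix n assume "n \<in> {N..2*N}"
    then have "1 / P \<le> real n" using N by (auto intro: order_trans)
    then have "1 \<le> real n * P" using P0 by (simp add: field_simps)
    then show "wt p n = wt p n * min 1 (real n * P)" by simp
  qed
  finally have "ennreal (2 powr (-1 - 1 / p) * 2 powr (- (1 / p)) * P powr (1 / p)) \<le> ennreal (\<Sum>n=N..2*N. wt p n * min 1 (real n * P))"
    by (intro ennreal_leI) (simp add: mult.assoc)
  also have "... = (\<Sum>n=N..2*N. ennreal (wt p n * min 1 (real n * P)))"
    using P by (intro sum_ennreal[symmetric]) auto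
  also have "... \<le> (\<Sum>n. ennreal (wt p n * min 1 (real n * P)))" by (intro sum_le_suminf) auto
  finally show ?thesis .
qed simp

lemma suminf_inverse_top: "(\<Sum>n. ennreal (1 / real n)) = \<infinity>"
proof (rule ccontr)
  assume "\<not> ?thesis"
  then have "summable (\<lambda>n. 1 / real n)" by (intro summable_suminf_not_top) auto
  then have "summable (\<lambda>n. inverse (of_nat n) :: real)" by (simp add: inverse_eq_divide)
  then show False using not_summable_harmonic by blast
qed

section \<open>Series of expected absolute values as integrals over the tail of X\<close>

context iid_seq begin

lemma cond_iii_iff:
  "cond_iii M Xs p \<longleftrightarrow> (\<Sum>n. ennreal (wt p n) * absE (psum Xs n)) < \<infinity>"
proof -
  have "ennreal (1 / real n) * (E / ennreal (real n powr (1 / p))) = ennreal (wt p n) * E" for n and E :: ennreal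
  proof (cases "n = 0")
    case False
    have "ennreal (1 / real n) * (E / ennreal (real n powr (1 / p)))
      = ennreal (1 / real n) * (E * ennreal (1 / real n powr (1 / p)))"
      using False by (simp add: divide_ennreal_def inverse_ennreal inverse_eq_divide)
    also have "... = ennreal (1 / real n * (1 / real n powr (1 / p))) * E"
      using False by (subst ennreal_mult) (auto simp: mult_ac)
    finally show ?thesis by (simp only: wt_eq mult_1_right)
  qed simp
  then show ?thesis by (simp only: cond_iii_def)
qed

lemma fsum_id: "fsum (\<lambda>x. x) 0 n w = psum Xs n w"
  by (simp add: fsum_def psum_def atLeastSucAtMost_greaterThanAtMost[symmetric])

lemma fsum_trunc: "fsum (trunc p n) 0 n w = tsum p n w"
  by (simp add: fsum_def tsum_def atLeastSucAtMost_greaterThanAtMost[symmetric])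

lemma nn_fsum_le:
  assumes [measurable]: "f \<in> borel_measurable borel"
  shows "absE (fsum f 0 n) \<le> of_nat n * (\<integral>\<^sup>+w. ennreal \<bar>f (X w)\<bar> \<partial>M)"
proof -
  have [measurable]: "j \<in> {0<..n} \<Longrightarrow> (\<lambda>w. f (Xs j w)) \<in> borel_measurable M" for j
    by (rule rv_comp) auto
  have "absE (fsum f 0 n) \<le> (\<integral>\<^sup>+w. (\<Sum>j\<in>{0<..n}. ennreal \<bar>f (Xs j w)\<bar>) \<partial>M)"
    unfolding fsum_def by (intro nn_integral_mono) (simp add: ennreal_leI sum_abs)
  also have "... = (\<Sum>j\<in>{0<..n}. \<integral>\<^sup>+w. ennreal \<bar>f (Xs j w)\<bar> \<partial>M)"
    by (intro nn_integral_sum) measurable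
  also have "... = (\<Sum>j\<in>{0<..n}. \<integral>\<^sup>+w. ennreal \<bar>f (X w)\<bar> \<partial>M)"
    by (intro sum.cong refl ident_nn[of _ "\<lambda>x. ennreal \<bar>f x\<bar>"]) auto
  finally show ?thesis by simp
qed

lemma tailp_nonneg [simp]: "0 \<le> pX t" and tailp_le_1 [simp]: "pX t \<le> 1"
  by (simp_all add: tailp_def)

lemma tailp_measurable [measurable]: "tailp M X \<in> borel_measurable borel"
  using tail_measurable[of "\<lambda>w. \<bar>X w\<bar>"] by (simp add: tailp_def[abs_def])

lemma swap_sum_integral:
  fixes F :: "nat \<Rightarrow> real \<Rightarrow> real"
  assumes [measurable]: "\<And>n. F n \<in> borel_measurable borel" and nn: "\<And>n t. 0 \<le> F n t"
  shows "(\<Sum>n. ennreal (wt p n) * tint (\<lambda>t. ennreal (F n t)))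
    = tint (\<lambda>t. (\<Sum>n. ennreal (wt p n * F n t)))"
proof -
  have "(\<Sum>n. ennreal (wt p n) * tint (\<lambda>t. ennreal (F n t)))
    = (\<Sum>n. \<integral>\<^sup>+t. ennreal (wt p n * F n t) * indicator {0..} t \<partial>lborel)"
  proof (rule suminf_cong)
    fix n
    have "(\<integral>\<^sup>+t. ennreal (wt p n) * (ennreal (F n t) * indicator {0..} t) \<partial>lborel)
      = ennreal (wt p n) * tint (\<lambda>t. ennreal (F n t))"
      by (rule nn_integral_cmult) measurable
    then show "ennreal (wt p n) * tint (\<lambda>t. ennreal (F n t))
      = tint (\<lambda>t. ennreal (wt p n * F n t))"
      using nn by (simp add: ennreal_mult mult.assoc)
  qed
  also have "... = (\<integral>\<^sup>+t. (\<Sum>n. ennreal (wt p n * F n t) * indicator {0..} t) \<partial>lborel)"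
    by (rule nn_integral_suminf[symmetric]) measurable
  finally show ?thesis by (simp add: ennreal_suminf_multc)
qed

lemma cond_iii_imp_i:
  assumes "cond_iii M Xs p"
  shows "cond_i M Xs p"
proof -
  note rv_psum[measurable]
  have "(\<integral>\<^sup>+w. (\<Sum>n. ennreal (wt p n * \<bar>psum Xs n w\<bar>)) \<partial>M)
    = (\<Sum>n. ennreal (wt p n) * absE (psum Xs n))"
    by (subst nn_integral_suminf) (auto simp: ennreal_mult nn_integral_cmult)
  then have "AE w in M. (\<Sum>n. ennreal (wt p n * \<bar>psum Xs n w\<bar>)) \<noteq> \<infinity>"
    using assms unfolding cond_iii_iff by (intro nn_integral_PInf_AE) auto
  then have "AE w in M. summable (\<lambda>n. wt p n * \<bar>psum Xs n w\<bar>)"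
    by eventually_elim (auto intro!: summable_suminf_not_top)
  then show ?thesis unfolding cond_i_def wt_eq .
qed

text \<open>The term n = 1 alone is E|X|, as its weight is 1.\<close>

lemma cond_iii_integrable:
  assumes "cond_iii M Xs p"
  shows "integrable M X"
proof -
  let ?f = "\<lambda>n. ennreal (wt p n) * absE (psum Xs n)"
  have "?f 1 \<le> (\<Sum>n. ?f n)"
    using sum_le_suminf[of ?f "{1}"] by simp
  then have "?f 1 < \<infinity>" using assms unfolding cond_iii_iff by (rule order.strict_trans1)
  moreover have "?f 1 = absE X"
    using ident_nn[of 1 "\<lambda>x. ennreal \<bar>x\<bar>"] by (simp add: wt_def psum_def)
  ultimately show ?thesis by (simp add: integrable_iff_bounded)
qed

lemma nn_abs_finite: "integrable M X \<Longrightarrow> absE X < \<infinity>"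
  by (simp add: integrable_iff_bounded)

text \<open>E|S(n)| \<ge> n |E X|, and for p \<ge> 1 the weight times n is at least 1/n, so a
  nonzero mean would bound the series below by a harmonic one.\<close>

lemma cond_iii_imp_mean_zero:
  assumes "cond_iii M Xs p" "1 \<le> p"
  shows "expectation X = 0"
proof (rule ccontr)
  assume ne: "expectation X \<noteq> 0"
  note i = cond_iii_integrable[OF assms(1)]
  have "(\<Sum>n. ennreal \<bar>expectation X\<bar> * ennreal (1 / real n))
    \<le> (\<Sum>n. ennreal (wt p n) * absE (psum Xs n))"
  proof (rule suminf_le)
    fix n
    have "1 / real n \<le> wt p n * real n"
    proof (cases "n = 0")
      case False
      then have "1 / real n = real n powr - 1" using powr_neg_one[of "real n"] by simp
      also have "... \<le> real n powr (- (1 / p))" using assms(2) False by (intro powr_mono) auto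
      finally show ?thesis unfolding wt_times_n .
    qed simp
    then have "ennreal (\<bar>expectation X\<bar> * (1 / real n)) \<le> ennreal (\<bar>expectation X\<bar> * (wt p n * real n))"
      by (intro ennreal_leI mult_left_mono) auto
    also have "... = ennreal (wt p n) * ennreal \<bar>expectation (psum Xs n)\<bar>"
      using fsum_expectation[of "\<lambda>x. x" 0 n] i
      by (simp add: fsum_id[abs_def, symmetric] abs_mult ennreal_mult mult_ac)
    also have "... \<le> ennreal (wt p n) * absE (psum Xs n)"
      using integral_norm_bound_ennreal[of M "psum Xs n"] fsum_integrable[of "\<lambda>x. x" 0 n] i
      by (intro mult_left_mono) (auto simp: fsum_id[abs_def])
    finally show "ennreal \<bar>expectation X\<bar> * ennreal (1 / real n) \<le> ennreal (wt p n) * absE (psum Xs n)"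
      by (simp add: ennreal_mult[symmetric])
  qed (rule summableI)+
  also have "... < \<infinity>" using assms(1) unfolding cond_iii_iff .
  finally show False using ne by (simp add: suminf_inverse_top ennreal_mult_top)
qed

lemma cond_iii_min_integral:
  assumes "cond_iii M Xs p"
  shows "tint (\<lambda>t. (\<Sum>n. ennreal (wt p n * min 1 (real n * pX t)))) < \<infinity>"
proof -
  note i = cond_iii_integrable[OF assms]
  have "tint (\<lambda>t. (\<Sum>n. ennreal (wt p n * min 1 (real n * pX t))))
    = (\<Sum>n. ennreal (wt p n) * tint (\<lambda>t. ennreal (min 1 (real n * pX t))))"
    by (rule swap_sum_integral[symmetric]) auto
  also have "... \<le> (\<Sum>n. 34 * (ennreal (wt p n) * absE (psum Xs n)))"
  proof (rule suminf_le)
    fix n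
    show "ennreal (wt p n) * tint (\<lambda>t. ennreal (min 1 (real n * pX t)))
      \<le> 34 * (ennreal (wt p n) * absE (psum Xs n))"
    proof (cases "n = 0")
      case False
      then have "tint (\<lambda>t. ennreal (min 1 (real n * pX t)))
        \<le> 34 * absE (psum Xs n)"
        using tail_integral_le_sum[of "\<lambda>x. x" n] i by (simp add: tailp_def fsum_id)
      then have "ennreal (wt p n) * tint (\<lambda>t. ennreal (min 1 (real n * pX t)))
        \<le> ennreal (wt p n) * (34 * absE (psum Xs n))" by (rule mult_left_mono) simp
      then show ?thesis by (simp add: mult_ac)
    qed simp
  qed (rule summableI)+
  also have "... = 34 * (\<Sum>n. ennreal (wt p n) * absE (psum Xs n))" by simp
  also have "... < \<infinity>" using assms unfolding cond_iii_iff by (simp add: ennreal_mult_less_top)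
  finally show ?thesis .
qed

lemma cond_iii_of_min_integral:
  assumes i: "integrable M X" and z: "expectation X = 0"
    and fin: "tint (\<lambda>t. (\<Sum>n. ennreal (wt p n * min (2 * real n * pX t) (sqrt (real n * pX t))))) < \<infinity>"
  shows "cond_iii M Xs p"
proof -
  have "(\<Sum>n. ennreal (wt p n) * absE (psum Xs n))
    \<le> (\<Sum>n. ennreal (wt p n) * tint (\<lambda>t. ennreal (min (2 * real n * pX t) (sqrt (real n * pX t)))))"
  proof (rule suminf_le)
    fix n
    show "ennreal (wt p n) * absE (psum Xs n)
      \<le> ennreal (wt p n) * tint (\<lambda>t. ennreal (min (2 * real n * pX t) (sqrt (real n * pX t))))"
      using centered_sum_le_tail_integral[of "\<lambda>x. x" n] i z
      by (intro mult_left_mono) (auto simp: tailp_def fsum_id)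
  qed (rule summableI)+
  also have "... = tint (\<lambda>t. (\<Sum>n. ennreal (wt p n * min (2 * real n * pX t) (sqrt (real n * pX t)))))"
    by (rule swap_sum_integral) auto
  also have "... < \<infinity>" by (rule fin)
  finally show ?thesis unfolding cond_iii_iff .
qed

text \<open>For fixed t, the sums over n of the upper and of the lower bound for E|S(n)| are both
  comparable with P^(1/p), so the two directions meet.\<close>

lemma cond_iii_iff_iv_gt1:
  assumes p: "1 < p" "p < 2"
  shows "cond_iii M Xs p \<longleftrightarrow> cond_iv M X p"
proof
  assume iv: "cond_iv M X p"
  then have i: "integrable M X" and z: "expectation X = 0"
    and fin: "tint (\<lambda>t. ennreal (pX t powr (1 / p))) < \<infinity>"
    using p by (auto simp: cond_iv_def)
  define C where "C = 2 / (1 - 1 / p) + 2 powr (1 / 2 + 1 / p) / ((1 / 2 + 1 / p) - 1)"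
  have C: "C \<ge> 0" unfolding C_def using p by (intro add_nonneg_nonneg divide_nonneg_nonneg) (auto simp: field_simps)
  show "cond_iii M Xs p"
  proof (rule cond_iii_of_min_integral[OF i z])
    have "tint (\<lambda>t. (\<Sum>n. ennreal (wt p n * min (2 * real n * pX t) (sqrt (real n * pX t)))))
      \<le> (\<integral>\<^sup>+t. ennreal C * (ennreal (pX t powr (1 / p)) * indicator {0..} t) \<partial>lborel)"
    proof (rule nn_integral_mono)
      fix t
      have "(\<Sum>n. ennreal (wt p n * min (2 * real n * pX t) (sqrt (real n * pX t)))) \<le> ennreal (C * pX t powr (1 / p))"
        unfolding C_def by (rule sum_min_le[OF p]) simp
      then show "(\<Sum>n. ennreal (wt p n * min (2 * real n * pX t) (sqrt (real n * pX t)))) * indicator {0..} t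
        \<le> ennreal C * (ennreal (pX t powr (1 / p)) * indicator {0..} t)"
        using C by (simp add: ennreal_mult indicator_def)
    qed
    also have "... = ennreal C * tint (\<lambda>t. ennreal (pX t powr (1 / p)))"
      by (rule nn_integral_cmult) measurable
    also have "... < \<infinity>" using fin by (simp add: ennreal_mult_less_top)
    finally show "tint (\<lambda>t. (\<Sum>n. ennreal (wt p n * min (2 * real n * pX t) (sqrt (real n * pX t))))) < \<infinity>" .
  qed
next
  assume iii: "cond_iii M Xs p"
  define c where "c = 2 powr (-1 - 1 / p) * 2 powr (- (1 / p))"
  have c: "c > 0" by (simp add: c_def)
  have "ennreal c * tint (\<lambda>t. ennreal (pX t powr (1 / p)))
    = (\<integral>\<^sup>+t. ennreal c * (ennreal (pX t powr (1 / p)) * indicator {0..} t) \<partial>lborel)"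
    by (rule nn_integral_cmult[symmetric]) measurable
  also have "... \<le> tint (\<lambda>t. (\<Sum>n. ennreal (wt p n * min 1 (real n * pX t))))"
  proof (rule nn_integral_mono)
    fix t
    have "ennreal (c * pX t powr (1 / p)) \<le> (\<Sum>n. ennreal (wt p n * min 1 (real n * pX t)))"
      unfolding c_def using p by (intro sum_min_one_ge) auto
    then show "ennreal c * (ennreal (pX t powr (1 / p)) * indicator {0..} t)
      \<le> (\<Sum>n. ennreal (wt p n * min 1 (real n * pX t))) * indicator {0..} t"
      using c by (simp add: ennreal_mult indicator_def)
  qed
  also have "... < \<infinity>" by (rule cond_iii_min_integral[OF iii])
  finally have "tint (\<lambda>t. ennreal (pX t powr (1 / p))) < \<infinity>"
    using c by (auto simp: ennreal_mult_less_top)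
  then show "cond_iv M X p"
    using p cond_iii_integrable[OF iii] cond_iii_imp_mean_zero[OF iii] by (simp add: cond_iv_def)
qed

text \<open>The discarded part of x lives on n < |x|^p, where the terms n^(-1/p) |x| add up to order
  |x|^p because p > 1. Its expected contribution is therefore controlled by the p-th moment that (i)
  provides.\<close>

lemma cond_i_imp_iii_gt1:
  assumes p: "1 < p" and ci: "cond_i M Xs p"
  shows "cond_iii M Xs p"
proof -
  have p0: "0 < p" using p by simp
  have mom: "(\<integral>\<^sup>+w. ennreal (\<bar>X w\<bar> powr p) \<partial>M) < \<infinity>"
    and ts: "(\<Sum>n. tsumE p n) < \<infinity>"
    using ci p0 by (auto simp: cond_i_iff_tsum)
  note [measurable] = rv_tsum rv_psum
  define r where "r n x = x - trunc p n x" for n x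
  have r [measurable]: "r n \<in> borel_measurable borel" for n unfolding r_def by measurable
  note [measurable] = rv_fsum[OF r]
  define \<beta> where "\<beta> = 1 - 1 / p"
  have \<beta>: "0 < \<beta>" "\<beta> < 1" using p by (auto simp: \<beta>_def)
  have pw: "(\<Sum>n. ennreal (wt p n * real n * \<bar>r n x\<bar>)) \<le> ennreal (1 / \<beta> * \<bar>x\<bar> powr p)" for x
  proof -
    have "wt p n * real n * \<bar>r n x\<bar> \<le> \<bar>x\<bar> * (real n powr (\<beta> - 1) * indicator {..\<bar>x\<bar> powr p} (real n))" for n
      unfolding wt_times_n r_def trunc_eq[OF p0] by (auto simp: indicator_def \<beta>_def)
    \<comment> \<open>The second series of \<open>suminf_two_le\<close> is taken to be zero, hence
      the summand 0 * 0.\<close>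
    then have "(\<Sum>n. ennreal (wt p n * real n * \<bar>r n x\<bar>)) \<le> ennreal (\<bar>x\<bar> * (1 / \<beta> * (\<bar>x\<bar> powr p) powr \<beta>) + 0 * 0)"
      using \<beta> by (intro suminf_two_le[where h="\<lambda>_. 0", OF _ _ _ _ _ _ _ sum_powr_head]) auto
    also have "\<bar>x\<bar> * (1 / \<beta> * (\<bar>x\<bar> powr p) powr \<beta>) + 0 * 0 = 1 / \<beta> * \<bar>x\<bar> powr p"
    proof (cases "x = 0")
      case False
      have "\<bar>x\<bar> * (\<bar>x\<bar> powr p) powr \<beta> = \<bar>x\<bar> powr 1 * \<bar>x\<bar> powr (p * \<beta>)" using False by (simp add: powr_powr)
      also have "... = \<bar>x\<bar> powr p" unfolding powr_add[symmetric] using p0 by (simp add: \<beta>_def right_diff_distrib)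
      finally show ?thesis by simp
    qed simp
    finally show ?thesis .
  qed
  have "(\<Sum>n. ennreal (wt p n) * absE (psum Xs n))
    \<le> (\<Sum>n. tsumE p n + (\<integral>\<^sup>+w. ennreal (wt p n * real n * \<bar>r n (X w)\<bar>) \<partial>M))"
  proof (rule suminf_le)
    fix n
    have "psum Xs n w = tsum p n w + fsum (r n) 0 n w" for w
      by (simp add: fsum_id[symmetric] fsum_trunc[symmetric]) (simp add: fsum_def r_def sum.distrib[symmetric])
    then have "ennreal \<bar>psum Xs n w\<bar> \<le> ennreal \<bar>tsum p n w\<bar> + ennreal \<bar>fsum (r n) 0 n w\<bar>" for w
      by (simp add: ennreal_plus[symmetric] ennreal_leI abs_triangle_ineq del: ennreal_plus)
    then have "absE (psum Xs n) \<le> (\<integral>\<^sup>+w. ennreal \<bar>tsum p n w\<bar> + ennreal \<bar>fsum (r n) 0 n w\<bar> \<partial>M)"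
      by (intro nn_integral_mono)
    also have "... = absE (tsum p n) + absE (fsum (r n) 0 n)"
      by (rule nn_integral_add) measurable
    also have "... \<le> absE (tsum p n) + of_nat n * (\<integral>\<^sup>+w. ennreal \<bar>r n (X w)\<bar> \<partial>M)"
      by (intro add_mono order_refl nn_fsum_le) measurable
    finally have "ennreal (wt p n) * absE (psum Xs n)
      \<le> ennreal (wt p n) * (absE (tsum p n) + of_nat n * (\<integral>\<^sup>+w. ennreal \<bar>r n (X w)\<bar> \<partial>M))"
      by (rule mult_left_mono) simp
    also have "... = tsumE p n + (\<integral>\<^sup>+w. ennreal (wt p n * real n * \<bar>r n (X w)\<bar>) \<partial>M)"
      by (simp add: distrib_left ennreal_mult nn_integral_cmult ennreal_of_nat_eq_real_of_nat mult.assoc)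
    finally show "ennreal (wt p n) * absE (psum Xs n)
      \<le> tsumE p n + (\<integral>\<^sup>+w. ennreal (wt p n * real n * \<bar>r n (X w)\<bar>) \<partial>M)" .
  qed (rule summableI)+
  also have "... = (\<Sum>n. tsumE p n) + (\<Sum>n. \<integral>\<^sup>+w. ennreal (wt p n * real n * \<bar>r n (X w)\<bar>) \<partial>M)"
    by (rule suminf_add[symmetric]) (rule summableI)+
  also have "(\<Sum>n. \<integral>\<^sup>+w. ennreal (wt p n * real n * \<bar>r n (X w)\<bar>) \<partial>M) = (\<integral>\<^sup>+w. (\<Sum>n. ennreal (wt p n * real n * \<bar>r n (X w)\<bar>)) \<partial>M)"
    by (rule nn_integral_suminf[symmetric]) measurable
  also have "... \<le> (\<integral>\<^sup>+w. ennreal (1 / \<beta> * \<bar>X w\<bar> powr p) \<partial>M)" by (intro nn_integral_mono pw)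
  also have "... = ennreal (1 / \<beta>) * (\<integral>\<^sup>+w. ennreal (\<bar>X w\<bar> powr p) \<partial>M)"
    using \<beta> by (simp add: ennreal_mult'[of "1 / \<beta>"] nn_integral_cmult del: times_divide_eq_left)
  finally show ?thesis unfolding cond_iii_iff using ts mom
    by (simp add: add_left_mono ennreal_mult_less_top order.strict_trans1)
qed

lemma cond_ii_iff_iv_gt1: "1 < p \<Longrightarrow> cond_ii M X p \<longleftrightarrow> cond_iv M X p"
  by (simp add: cond_ii_def cond_iv_def)

text \<open>Maxima have means comparable with those of the sums, so the weighted series of maxima
  converges almost surely as well. Maxima increase in n, so the block {k..2k} of that series
  dominates a multiple of |S(k)| / k^(1/p); blocks of a convergent series tend to 0.\<close>

lemma cond_iii_slln:
  assumes p: "1 < p" and iii: "cond_iii M Xs p"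
  shows "AE w in M. (\<lambda>n. psum Xs n w / real n powr (1 / p)) \<longlonglongrightarrow> 0"
proof -
  have i: "integrable M X" and z: "expectation X = 0"
    using cond_iii_integrable[OF iii] cond_iii_imp_mean_zero[OF iii] p by auto
  let ?m = "fmax (\<lambda>x. x)"
  have [measurable]: "?m n \<in> borel_measurable M" for n using rv_fmax[of "\<lambda>x. x"] by simp
  have "(\<integral>\<^sup>+w. (\<Sum>n. ennreal (wt p n * ?m n w)) \<partial>M) = (\<Sum>n. ennreal (wt p n) * (\<integral>\<^sup>+w. ennreal (?m n w) \<partial>M))"
    by (subst nn_integral_suminf) (auto simp: ennreal_mult fmax_nonneg nn_integral_cmult)
  also have "... \<le> (\<Sum>n. 4 * (ennreal (wt p n) * absE (psum Xs n)))"
  proof (rule suminf_le)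
    fix n
    have "(\<integral>\<^sup>+w. ennreal (?m n w) \<partial>M) \<le> ennreal (4 * expectation (\<lambda>w. \<bar>psum Xs n w\<bar>))"
      using expectation_fmax[of "\<lambda>x. x" n] i z by (simp add: fsum_id)
    also have "... = 4 * ennreal (expectation (\<lambda>w. \<bar>psum Xs n w\<bar>))" by (simp add: ennreal_mult)
    also have "ennreal (expectation (\<lambda>w. \<bar>psum Xs n w\<bar>)) = absE (psum Xs n)"
      using fsum_integrable[of "\<lambda>x. x" 0 n] i
      by (intro nn_integral_eq_integral[symmetric]) (auto simp: fsum_id[abs_def])
    finally have "ennreal (wt p n) * (\<integral>\<^sup>+w. ennreal (?m n w) \<partial>M) \<le> ennreal (wt p n) * (4 * absE (psum Xs n))"
      by (rule mult_left_mono) simp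
    then show "ennreal (wt p n) * (\<integral>\<^sup>+w. ennreal (?m n w) \<partial>M) \<le> 4 * (ennreal (wt p n) * absE (psum Xs n))"
      by (simp add: mult_ac)
  qed (rule summableI)+
  also have "... = 4 * (\<Sum>n. ennreal (wt p n) * absE (psum Xs n))" by simp
  also have "... < \<infinity>" using iii unfolding cond_iii_iff by (simp add: ennreal_mult_less_top)
  finally have "AE w in M. (\<Sum>n. ennreal (wt p n * ?m n w)) \<noteq> \<infinity>"
    by (intro nn_integral_PInf_AE) auto
  then show ?thesis
  proof eventually_elim
    case (elim w)
    define a where "a n = wt p n * ?m n w" for n
    have "summable a" unfolding a_def using elim by (intro summable_suminf_not_top) (auto simp: fmax_nonneg)
    then have S: "(\<lambda>n. sum a {..<n}) \<longlonglongrightarrow> suminf a" by (rule summable_LIMSEQ)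
    have "(\<lambda>k. sum a {..<2 * k + 1} - sum a {..<k}) \<longlonglongrightarrow> suminf a - suminf a"
    proof (intro tendsto_diff S)
      have "filterlim (\<lambda>k::nat. 2 * k + 1) sequentially sequentially"
        by (rule filterlim_subseq) (auto simp: strict_mono_def)
      from filterlim_compose[OF S this] show "(\<lambda>k. sum a {..<2 * k + 1}) \<longlonglongrightarrow> suminf a" .
    qed
    then have T: "(\<lambda>k. (1 / 2 powr (-1 - 1 / p)) * (sum a {..<2 * k + 1} - sum a {..<k})) \<longlonglongrightarrow> 0"
      by (intro tendsto_mult_right_zero) simp
    show ?case
    proof (rule Lim_null_comparison[OF _ T], rule eventually_sequentiallyI[of 1])
      fix k :: nat assume k: "1 \<le> k"
      have eq: "sum a {..<2 * k + 1} - sum a {..<k} = sum a {k..2 * k}"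
      proof -
        have "{..<2 * k + 1} = {..<k} \<union> {k..2 * k}" by auto
        then have "sum a {..<2 * k + 1} = sum a {..<k} + sum a {k..2 * k}"
          by (simp add: sum.union_disjoint ivl_disj_int)
        then show ?thesis by simp
      qed
      have "\<bar>psum Xs k w\<bar> * (2 powr (-1 - 1 / p) * real k powr (- (1 / p))) \<le> ?m k w * (\<Sum>n=k..2*k. wt p n)"
        using fmax_ge[of k k "\<lambda>x. x" w] powr_block_lower[OF k, of "1 / p"] p
        by (intro mult_mono) (auto simp: fsum_id wt_def fmax_nonneg)
      also have "... \<le> sum a {k..2 * k}"
        unfolding sum_distrib_left a_def
        by (intro sum_mono) (auto simp: mult.commute intro!: mult_left_mono fmax_mono)
      finally show "norm (psum Xs k w / real k powr (1 / p))
        \<le> (1 / 2 powr (-1 - 1 / p)) * (sum a {..<2 * k + 1} - sum a {..<k})"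
        unfolding eq using k by (simp add: powr_minus field_simps)
    qed
  qed
qed

text \<open>E|S(n)| \<le> n E|X| leaves the series of n^(-1/p), which converges because 1/p >
  1.\<close>

lemma cond_iii_iff_iv_lt1:
  assumes p: "0 < p" "p < 1"
  shows "cond_iii M Xs p \<longleftrightarrow> cond_iv M X p"
proof
  assume "cond_iii M Xs p"
  then show "cond_iv M X p" using p cond_iii_integrable by (simp add: cond_iv_def)
next
  assume "cond_iv M X p"
  then have i: "integrable M X" using p by (simp add: cond_iv_def)
  have a: "1 < 1 / p" using p by simp
  have "(\<Sum>n. ennreal (wt p n) * absE (psum Xs n))
    \<le> (\<Sum>n. ennreal (real n powr (- (1 / p)) * indicator {1..} (real n)) * absE X)"
  proof (rule suminf_le)
    fix n
    have "ennreal (wt p n) * absE (psum Xs n) \<le> ennreal (wt p n) * (of_nat n * absE X)"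
      using nn_fsum_le[of "\<lambda>x. x" n] by (intro mult_left_mono) (auto simp: fsum_id)
    also have "... = ennreal (wt p n * real n) * absE X"
      by (simp add: ennreal_mult ennreal_of_nat_eq_real_of_nat mult.assoc)
    also have "wt p n * real n = real n powr (- (1 / p)) * indicator {1..} (real n)"
      unfolding wt_times_n by (cases "n = 0") auto
    finally show "ennreal (wt p n) * absE (psum Xs n)
      \<le> ennreal (real n powr (- (1 / p)) * indicator {1..} (real n)) * absE X" .
  qed (rule summableI)+
  also have "... = (\<Sum>n. ennreal (real n powr (- (1 / p)) * indicator {1..} (real n))) * absE X"
    by (rule ennreal_suminf_multc)
  also have "... < \<infinity>"
  proof -
    have "(\<Sum>n. ennreal (real n powr (- (1 / p)) * indicator {1..} (real n))) < \<infinity>"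
      by (rule order.strict_trans1[OF sum_powr_tail[OF a]]) simp_all
    with nn_abs_finite[OF i] show ?thesis unfolding infinity_ennreal_def ennreal_mult_less_top by blast
  qed
  finally show "cond_iii M Xs p" unfolding cond_iii_iff .
qed

text \<open>For p < 1 the surviving terms n^(-1/p) |x| over n \<ge> |x|^p already add up to order
  |x|^p, so the truncated sums are summable in mean without any cancellation.\<close>

lemma cond_i_iff_ii_lt1:
  assumes p: "0 < p" "p < 1"
  shows "cond_i M Xs p \<longleftrightarrow> cond_ii M X p"
proof -
  have mom_iff: "cond_ii M X p \<longleftrightarrow> (\<integral>\<^sup>+w. ennreal (\<bar>X w\<bar> powr p) \<partial>M) < \<infinity>"
    using p by (simp add: cond_ii_def integrable_iff_bounded)
  show ?thesis
  proof
    assume "cond_i M Xs p"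
    then show "cond_ii M X p" using p mom_iff cond_i_moment by blast
  next
    assume "cond_ii M X p"
    then have mom: "(\<integral>\<^sup>+w. ennreal (\<bar>X w\<bar> powr p) \<partial>M) < \<infinity>" using mom_iff by simp
    have a: "1 < 1 / p" using p by simp
    define C where "C = 2 powr (1 / p) / (1 / p - 1)"
    have C: "C \<ge> 0" using a by (simp add: C_def)
    note [measurable] = rv_tsum
    have pw: "(\<Sum>n. ennreal (wt p n * real n * \<bar>trunc p n x\<bar>)) \<le> ennreal (C * \<bar>x\<bar> powr p)" for x
    proof (cases "x = 0")
      case True
      then show ?thesis by (simp add: trunc_def)
    next
      case False
      have "wt p n * real n * \<bar>trunc p n x\<bar> \<le> \<bar>x\<bar> * (real n powr (- (1 / p)) * indicator {\<bar>x\<bar> powr p..} (real n))" for n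
        unfolding wt_times_n trunc_eq[OF p(1)] by (auto simp: indicator_def)
      then have "(\<Sum>n. ennreal (wt p n * real n * \<bar>trunc p n x\<bar>)) \<le> ennreal (\<bar>x\<bar> * (2 powr (1 / p) / (1 / p - 1) * (\<bar>x\<bar> powr p) powr (1 - 1 / p)) + 0 * 0)"
        using a False by (intro suminf_two_le[where h="\<lambda>_. 0", OF _ _ _ _ _ _ _ sum_powr_tail]) auto
      also have "\<bar>x\<bar> * (2 powr (1 / p) / (1 / p - 1) * (\<bar>x\<bar> powr p) powr (1 - 1 / p)) + 0 * 0 = C * \<bar>x\<bar> powr p"
      proof -
        have "\<bar>x\<bar> * (\<bar>x\<bar> powr p) powr (1 - 1 / p) = \<bar>x\<bar> powr 1 * \<bar>x\<bar> powr (p * (1 - 1 / p))" using False by (simp add: powr_powr)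
        also have "... = \<bar>x\<bar> powr p" unfolding powr_add[symmetric] using p by (simp add: right_diff_distrib)
        finally have e: "\<bar>x\<bar> * (\<bar>x\<bar> powr p) powr (1 - 1 / p) = \<bar>x\<bar> powr p" .
        have "\<bar>x\<bar> * (2 powr (1 / p) / (1 / p - 1) * (\<bar>x\<bar> powr p) powr (1 - 1 / p)) + 0 * 0
          = 2 powr (1 / p) / (1 / p - 1) * (\<bar>x\<bar> * (\<bar>x\<bar> powr p) powr (1 - 1 / p))" by (simp only: mult.left_commute mult_zero_left add_0_right)
        then show ?thesis unfolding e C_def .
      qed
      finally show ?thesis .
    qed
    show "cond_i M Xs p"
    proof (rule cond_i_of_tsum[OF p(1) mom])
      have "(\<Sum>n. tsumE p n) \<le> (\<Sum>n. \<integral>\<^sup>+w. ennreal (wt p n * real n * \<bar>trunc p n (X w)\<bar>) \<partial>M)"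
      proof (rule suminf_le)
        fix n
        have "tsumE p n = ennreal (wt p n) * absE (tsum p n)"
          by (simp add: ennreal_mult nn_integral_cmult)
        also have "... \<le> ennreal (wt p n) * (of_nat n * (\<integral>\<^sup>+w. ennreal \<bar>trunc p n (X w)\<bar> \<partial>M))"
          using nn_fsum_le[of "trunc p n" n] by (intro mult_left_mono) (auto simp: fsum_trunc)
        also have "... = (\<integral>\<^sup>+w. ennreal (wt p n * real n * \<bar>trunc p n (X w)\<bar>) \<partial>M)"
          by (simp add: ennreal_mult nn_integral_cmult ennreal_of_nat_eq_real_of_nat mult.assoc)
        finally show "tsumE p n \<le> (\<integral>\<^sup>+w. ennreal (wt p n * real n * \<bar>trunc p n (X w)\<bar>) \<partial>M)" .
      qed (rule summableI)+
      also have "... = (\<integral>\<^sup>+w. (\<Sum>n. ennreal (wt p n * real n * \<bar>trunc p n (X w)\<bar>)) \<partial>M)"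
        by (rule nn_integral_suminf[symmetric]) measurable
      also have "... \<le> (\<integral>\<^sup>+w. ennreal C * ennreal (\<bar>X w\<bar> powr p) \<partial>M)"
        using pw C by (intro nn_integral_mono) (simp add: ennreal_mult)
      also have "... = ennreal C * (\<integral>\<^sup>+w. ennreal (\<bar>X w\<bar> powr p) \<partial>M)" by (rule nn_integral_cmult) measurable
      also have "... < \<infinity>" using mom by (simp add: ennreal_mult_less_top)
      finally show "(\<Sum>n. tsumE p n) < \<infinity>" .
    qed
  qed
qed

end

subsection \<open>The case p = 1\<close>

lemma wt_1: "wt 1 n = 1 / (real n)\<^sup>2"
proof (cases "n = 0")
  case False
  have "wt 1 n = real n powr (- 2)" by (simp add: wt_def)
  also have "... = 1 / real n powr 2" by (rule powr_minus_divide)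
  also have "real n powr 2 = (real n)\<^sup>2" using False by (intro powr_numeral) simp
  finally show ?thesis .
qed simp

lemma sum_sqrt_tail:
  assumes P: "0 \<le> P" and Y: "0 < Y"
  shows "(\<Sum>n. ennreal (wt 1 n * sqrt (real n * P) * indicator {Y..} (real n)))
    \<le> ennreal (2 powr (3 / 2) / (1 / 2) * (sqrt P * Y powr (- (1 / 2))))"
proof -
  have a: "1 < (3 / 2 :: real)" by simp
  have e: "(3 / 2 :: real) - 1 = 1 / 2" "1 - (3 / 2 :: real) = - (1 / 2)" "1 / 2 + 1 / 1 = (3 / 2 :: real)" by simp_all
  have "wt 1 n * sqrt (real n * P) = sqrt P * real n powr - (3 / 2)" for n
    using wt_times_sqrt[of 1 n, unfolded e] by (simp add: real_sqrt_mult mult_ac)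
  then have "(\<Sum>n. ennreal (wt 1 n * sqrt (real n * P) * indicator {Y..} (real n)))
    = ennreal (sqrt P) * (\<Sum>n. ennreal (real n powr - (3 / 2) * indicator {Y..} (real n)))"
    using P by (simp add: ennreal_mult mult.assoc)
  also have "... \<le> ennreal (sqrt P) * ennreal (2 powr (3 / 2) / (1 / 2) * Y powr (- (1 / 2)))"
    using sum_powr_tail[OF a Y] unfolding e by (intro mult_left_mono) simp_all
  also have "... = ennreal (2 powr (3 / 2) / (1 / 2) * (sqrt P * Y powr (- (1 / 2))))"
    using P by (simp add: ennreal_mult[symmetric] mult_ac)
  finally show ?thesis .
qed

text \<open>The cut-off between the two bounds in the minimum is placed at n = y (1 + t); the parameter y
  is chosen as a function of t below.\<close>

lemma sum_min_one_le:
  fixes t y P :: real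
  assumes t: "0 \<le> t" and y: "1 \<le> y" and P: "0 \<le> P"
  defines "C \<equiv> 2 powr (3 / 2) / (1 / 2)"
  shows "(\<Sum>n. ennreal (wt 1 n * (if t < real n then min (2 * real n * P) (sqrt (real n * P)) else 0)))
    \<le> ennreal ((4 * ln (4 * y) + C) * P + C * (1 / (y * (1 + t))))"
proof -
  define Y where "Y = y * (1 + t)"
  have Y: "Y > 0" using t y by (simp add: Y_def)
  have C: "C \<ge> 0" by (simp add: C_def)
  have l: "ln (4 * y) \<ge> 0" using y by simp
  have "(\<Sum>n. ennreal (wt 1 n * (if t < real n then min (2 * real n * P) (sqrt (real n * P)) else 0)))
    \<le> ennreal ((2 * P) * (2 * ln (4 * y)) + 1 * (C * (sqrt P * Y powr (- (1 / 2)))))"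
  proof (rule suminf_two_le)
    show "(\<Sum>n. ennreal (1 / real n * indicator {t<..Y} (real n))) \<le> ennreal (2 * ln (4 * y))"
      unfolding Y_def by (rule sum_inverse_between[OF t y])
    show "(\<Sum>n. ennreal (wt 1 n * sqrt (real n * P) * indicator {Y..} (real n))) \<le> ennreal (C * (sqrt P * Y powr (- (1 / 2))))"
      unfolding C_def by (rule sum_sqrt_tail[OF P Y])
    fix n :: nat
    have 1: "wt 1 n * (2 * real n * P) = 2 * P * (1 / real n)"
      by (simp add: wt_1 power2_eq_square)
    consider "\<not> t < real n" | "t < real n" "real n \<le> Y" | "t < real n" "Y < real n" by linarith
    then show "wt 1 n * (if t < real n then min (2 * real n * P) (sqrt (real n * P)) else 0)
      \<le> 2 * P * (1 / real n * indicator {t<..Y} (real n)) + 1 * (wt 1 n * sqrt (real n * P) * indicator {Y..} (real n))"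
    proof cases
      case 1
      then show ?thesis using P by simp
    next
      case 2
      have "wt 1 n * min (2 * real n * P) (sqrt (real n * P)) \<le> wt 1 n * (2 * real n * P)"
        by (intro mult_left_mono) auto
      then show ?thesis using 2 P unfolding 1 by (simp add: add_increasing2)
    next
      case 3
      have "wt 1 n * min (2 * real n * P) (sqrt (real n * P)) \<le> wt 1 n * sqrt (real n * P)"
        by (intro mult_left_mono) auto
      then show ?thesis using 3 P by simp
    qed
  qed (use P l C in auto)
  also have "... \<le> ennreal ((4 * ln (4 * y) + C) * P + C * (1 / Y))"
  proof (rule ennreal_leI)
    \<comment> \<open>The inequality of arithmetic and geometric means separates sqrt(P/Y) into a
      term linear in P, to be absorbed by a moment, and 1/Y, which involves t alone.\<close>
    have "0 \<le> (sqrt P - Y powr (- (1 / 2)))\<^sup>2" by simp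
    then have "2 * (sqrt P * Y powr (- (1 / 2))) \<le> P + (Y powr (- (1 / 2)))\<^sup>2"
      using P by (simp add: power2_diff)
    also have "(Y powr (- (1 / 2)))\<^sup>2 = 1 / Y"
    proof -
      have "(Y powr (- (1 / 2)))\<^sup>2 = Y powr (- (1 / 2) + - (1 / 2))" unfolding powr_add by (rule power2_eq_square)
      also have "... = Y powr - 1" by simp
      also have "... = 1 / Y" using Y by (rule powr_neg_one)
      finally show ?thesis .
    qed
    finally have "sqrt P * Y powr (- (1 / 2)) \<le> P + 1 / Y" using P Y
      by (smt (verit) divide_nonneg_pos)
    then have "C * (sqrt P * Y powr (- (1 / 2))) \<le> C * (P + 1 / Y)" by (rule mult_left_mono[OF _ C])
    then show "(2 * P) * (2 * ln (4 * y)) + 1 * (C * (sqrt P * Y powr (- (1 / 2)))) \<le> (4 * ln (4 * y) + C) * P + C * (1 / Y)"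
      by (simp add: algebra_simps)
  qed
  finally show ?thesis unfolding Y_def .
qed

lemma nn_integral_inverse_square: "tint (\<lambda>t. ennreal (1 / (1 + t)\<^sup>2)) < \<infinity>"
proof -
  have "((\<lambda>t::real. - 1 / (1 + t)) \<longlongrightarrow> 0) at_top"
    by (rule real_tendsto_divide_at_top[OF tendsto_const], rule filterlim_tendsto_add_at_top[OF tendsto_const filterlim_ident])
  then have "tint (\<lambda>t. ennreal (1 / (1 + t)\<^sup>2)) = ennreal (0 - (- 1 / (1 + 0)))"
    by (intro nn_integral_FTC_atLeast) (auto intro!: derivative_eq_intros simp: power2_eq_square field_simps)
  then show ?thesis by simp
qed

text \<open>arctan(ln(1 + t)) is an antiderivative; the summand 1 beside the squared logarithm
  removes the singularity at t = 0.\<close>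

lemma nn_integral_inverse_ln_square:
  "tint (\<lambda>t. ennreal (1 / ((1 + (ln (1 + t))\<^sup>2) * (1 + t)))) < \<infinity>"
proof -
  have lim: "((\<lambda>t::real. arctan (ln (1 + t))) \<longlongrightarrow> pi / 2) at_top"
  proof (rule filterlim_compose[OF tendsto_arctan_at_top])
    show "filterlim (\<lambda>t::real. ln (1 + t)) at_top at_top"
      by (rule filterlim_compose[OF ln_at_top filterlim_tendsto_add_at_top[OF tendsto_const filterlim_ident]])
  qed
  have "tint (\<lambda>t. ennreal (1 / ((1 + (ln (1 + t))\<^sup>2) * (1 + t))))
    = ennreal (pi / 2 - arctan (ln (1 + 0)))"
  proof (rule nn_integral_FTC_atLeast[OF _ _ _ lim])
    fix x :: real assume x: "0 \<le> x"
    show "((\<lambda>t. arctan (ln (1 + t))) has_real_derivative 1 / ((1 + (ln (1 + x))\<^sup>2) * (1 + x))) (at x)"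
      using x by (auto intro!: derivative_eq_intros simp: inverse_eq_divide)
    show "0 \<le> 1 / ((1 + (ln (1 + x))\<^sup>2) * (1 + x))" using x by simp
  qed measurable
  then show ?thesis by simp
qed

context iid_seq begin

lemma weighted_tail_le:
  assumes g [measurable]: "g \<in> borel_measurable borel"
    and mono: "\<And>s t. 0 \<le> s \<Longrightarrow> s \<le> t \<Longrightarrow> g s \<le> g t" and nn: "\<And>t. 0 \<le> t \<Longrightarrow> 0 \<le> g t"
  shows "tint (\<lambda>t. ennreal (g t * pX t)) \<le> (\<integral>\<^sup>+w. ennreal (\<bar>X w\<bar> * g \<bar>X w\<bar>) \<partial>M)"
proof -
  have "tint (\<lambda>t. ennreal (g t * pX t))
    = tint (\<lambda>t. ennreal (g t) * ennreal (\<P>(w in M. \<bar>X w\<bar> > t)))"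
    by (intro nn_integral_cong) (auto simp: tailp_def indicator_def ennreal_mult' nn)
  also have "... = (\<integral>\<^sup>+w. (\<integral>\<^sup>+t. ennreal (g t) * indicator {0..<\<bar>X w\<bar>} t \<partial>lborel) \<partial>M)"
    by (rule layer_cake) measurable
  also have "... \<le> (\<integral>\<^sup>+w. ennreal (\<bar>X w\<bar> * g \<bar>X w\<bar>) \<partial>M)"
  proof (rule nn_integral_mono)
    fix w
    have "(\<integral>\<^sup>+t. ennreal (g t) * indicator {0..<\<bar>X w\<bar>} t \<partial>lborel) \<le> (\<integral>\<^sup>+t. ennreal (g \<bar>X w\<bar>) * indicator {0..<\<bar>X w\<bar>} t \<partial>lborel)"
      by (intro nn_integral_mono) (auto simp: indicator_def intro!: ennreal_leI mono)
    also have "... = ennreal (g \<bar>X w\<bar>) * ennreal \<bar>X w\<bar>"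
      by (subst nn_integral_cmult_indicator) auto
    finally show "(\<integral>\<^sup>+t. ennreal (g t) * indicator {0..<\<bar>X w\<bar>} t \<partial>lborel) \<le> ennreal (\<bar>X w\<bar> * g \<bar>X w\<bar>)"
      by (simp add: ennreal_mult' mult.commute)
  qed
  finally show ?thesis .
qed

text \<open>Common frame of both sufficient conditions at p = 1. The part weighted by h is a moment
  of X by the layer-cake formula with increasing h, and the remainder k is integrable by
  itself.\<close>

lemma min_integral_finite:
  assumes h [measurable]: "h \<in> borel_measurable borel"
    and mono: "\<And>s t. 0 \<le> s \<Longrightarrow> s \<le> t \<Longrightarrow> h s \<le> h t" and nn: "\<And>t. 0 \<le> t \<Longrightarrow> 0 \<le> h t"
    and i: "integrable M (\<lambda>w. \<bar>X w\<bar> * h \<bar>X w\<bar>)"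
    and k [measurable]: "k \<in> borel_measurable borel" and kn: "\<And>t. 0 \<le> t \<Longrightarrow> 0 \<le> k t"
    and kf: "tint (\<lambda>t. ennreal (k t)) < \<infinity>" and C: "0 \<le> C"
    and le: "\<And>t. 0 \<le> t \<Longrightarrow> F t \<le> ennreal (h t * pX t + C * k t)"
  shows "tint (\<lambda>t. F t) < \<infinity>"
proof -
  have "tint (\<lambda>t. F t)
    \<le> (\<integral>\<^sup>+t. ennreal (h t * pX t) * indicator {0..} t + ennreal C * (ennreal (k t) * indicator {0..} t) \<partial>lborel)"
  proof (rule nn_integral_mono)
    fix t :: real
    show "F t * indicator {0..} t \<le> ennreal (h t * pX t) * indicator {0..} t + ennreal C * (ennreal (k t) * indicator {0..} t)"
    proof (cases "0 \<le> t")
      case True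
      then show ?thesis using le[OF True] nn[OF True] kn[OF True] C by (simp add: ennreal_plus ennreal_mult)
    qed simp
  qed
  also have "... = tint (\<lambda>t. ennreal (h t * pX t))
    + ennreal C * tint (\<lambda>t. ennreal (k t))"
    by (simp add: nn_integral_add nn_integral_cmult)
  also have "... < \<infinity>"
  proof -
    have "tint (\<lambda>t. ennreal (h t * pX t)) \<le> (\<integral>\<^sup>+w. ennreal (\<bar>X w\<bar> * h \<bar>X w\<bar>) \<partial>M)"
      by (rule weighted_tail_le[OF h mono nn])
    also have "... = (\<integral>\<^sup>+w. ennreal (norm (\<bar>X w\<bar> * h \<bar>X w\<bar>)) \<partial>M)"
      using nn by (intro nn_integral_cong) simp
    also have "... < \<infinity>" using i unfolding integrable_iff_bounded by simp
    finally show ?thesis using kf by (simp add: ennreal_mult_less_top)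
  qed
  finally show ?thesis .
qed

text \<open>The cut at (1 + t)^2 costs a factor of order 1 + ln(1 + t), matched by the assumed
  moment, and leaves the integrable remainder 1 / (1 + t)^2.\<close>

lemma cond_iv_imp_iii_1:
  assumes iv: "cond_iv M X 1"
  shows "cond_iii M Xs 1"
proof -
  have i: "integrable M X" and z: "expectation X = 0" and il: "integrable M (\<lambda>w. \<bar>X w\<bar> * ln (1 + \<bar>X w\<bar>))"
    using iv by (auto simp: cond_iv_def)
  define C where "C = (2 powr (3 / 2) / (1 / 2) :: real)"
  define h where "h t = 4 * ln 4 + 8 * ln (1 + t) + C" for t :: real
  have C: "C \<ge> 0" by (simp add: C_def)
  show ?thesis
  proof (rule cond_iii_of_min_integral[OF i z],
      rule min_integral_finite[where h=h and C=C and k="\<lambda>t. 1 / (1 + t)\<^sup>2"])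
    show "h \<in> borel_measurable borel" unfolding h_def by measurable
    show "h s \<le> h t" if "0 \<le> s" "s \<le> t" for s t using that by (simp add: h_def)
    show "0 \<le> h t" if "0 \<le> t" for t using that C by (simp add: h_def)
    have "(\<lambda>w. \<bar>X w\<bar> * h \<bar>X w\<bar>) = (\<lambda>w. (4 * ln 4 + C) * \<bar>X w\<bar> + 8 * (\<bar>X w\<bar> * ln (1 + \<bar>X w\<bar>)))"
      by (simp add: h_def fun_eq_iff algebra_simps)
    then show "integrable M (\<lambda>w. \<bar>X w\<bar> * h \<bar>X w\<bar>)" using i il by simp
    show "(\<lambda>t::real. 1 / (1 + t)\<^sup>2) \<in> borel_measurable borel" by measurable
    show "tint (\<lambda>t. ennreal (1 / (1 + t)\<^sup>2)) < \<infinity>" by (rule nn_integral_inverse_square)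
    show "0 \<le> C" by (rule C)
    fix t :: real assume t: "0 \<le> t"
    have y: "1 \<le> (1 + t)\<^sup>2" using t by (intro one_le_power) simp
    have eq: "(if 0 < real n then min (2 * real n * P) (sqrt (real n * P)) else 0) = min (2 * real n * P) (sqrt (real n * P))" for n P
      by simp
    have "ln (4 * (1 + t)\<^sup>2) = ln 4 + 2 * ln (1 + t)" using t by (simp add: ln_mult_pos ln_realpow)
    then have hh: "4 * ln (4 * (1 + t)\<^sup>2) + C = h t" unfolding h_def by linarith
    \<comment> \<open>The lower limit of that lemma is set to 0 since the sums are not truncated
      here; its y carries the whole dependence on t.\<close>
    from sum_min_one_le[OF order_refl y tailp_nonneg[of t]]
    show "(\<Sum>n. ennreal (wt 1 n * min (2 * real n * pX t) (sqrt (real n * pX t))))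
      \<le> ennreal (h t * pX t + C * (1 / (1 + t)\<^sup>2))"
      unfolding eq C_def[symmetric] hh by (simp only: add_0_right mult_1_right)
  qed simp
qed

text \<open>Markov gives P \<le> m/t, so nP \<le> 1 for all n \<le> t/m. There the weighted minimum
  equals P/n, and the harmonic sum up to t/m yields the weight ln(t/m) on the tail.\<close>

lemma cond_iii_imp_iv_1:
  assumes iii: "cond_iii M Xs 1"
  shows "cond_iv M X 1"
proof -
  note i = cond_iii_integrable[OF iii]
  \<comment> \<open>The 1 keeps m positive even when X vanishes almost surely.\<close>
  define m where "m = expectation (\<lambda>w. \<bar>X w\<bar>) + 1"
  have m: "m > 0" unfolding m_def by (intro add_nonneg_pos) auto
  define g where "g t = ln (max 1 (t / m))" for t
  have [measurable]: "g \<in> borel_measurable borel" unfolding g_def by measurable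
  have g0: "g t \<ge> 0" for t by (simp add: g_def)
  have gmono: "g s \<le> g t" if "s \<le> t" for s t
    using that m unfolding g_def by (intro ln_mono) (auto simp: divide_right_mono max.coboundedI2)
  have tl: "pX t * t \<le> m" if t: "t > 0" for t
  proof -
    have "pX t \<le> \<P>(w in M. \<bar>X w\<bar> \<ge> t)"
      unfolding tailp_def by (intro finite_measure_mono) auto
    also have "... \<le> expectation (\<lambda>w. \<bar>X w\<bar>) / t"
      using t i by (intro integral_Markov_inequality_measure[where A="{}"]) auto
    finally show ?thesis using t by (simp add: m_def field_simps)
  qed
  have low: "ennreal (g t * pX t) \<le> (\<Sum>n. ennreal (wt 1 n * min 1 (real n * pX t)))" for t
  proof (cases "t \<ge> m")
    case True
    then have y: "1 \<le> t / m" using m by simp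
    let ?P = "pX t"
    have "ennreal (g t * ?P) = ennreal ?P * ennreal (ln (t / m))"
      using y by (simp add: g_def ennreal_mult mult.commute max_absorb2)
    also have "... \<le> ennreal ?P * (\<Sum>n. ennreal (1 / real n * indicator {..t / m} (real n)))"
      by (intro mult_left_mono ln_le_sum_inverse y) simp
    also have "... = (\<Sum>n. ennreal (?P * (1 / real n * indicator {..t / m} (real n))))"
      unfolding ennreal_suminf_cmult[symmetric] by (intro suminf_cong ennreal_mult[symmetric]) auto
    also have "... \<le> (\<Sum>n. ennreal (wt 1 n * min 1 (real n * ?P)))"
    proof (intro suminf_le summableI ennreal_leI)
      fix n :: nat
      show "?P * (1 / real n * indicator {..t / m} (real n)) \<le> wt 1 n * min 1 (real n * ?P)"
      proof (cases "real n \<le> t / m")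
        case le: True
        have "real n * ?P \<le> t / m * ?P" using le by (intro mult_right_mono) auto
        also have "... \<le> 1" using tl[of t] True m by (simp add: field_simps)
        finally show ?thesis using le by (simp add: wt_1 power2_eq_square)
      qed simp
    qed
    finally show ?thesis .
  next
    case False
    then show ?thesis using m by (simp add: g_def max_absorb1)
  qed
  \<comment> \<open>Keeping only t in [v/2, v) and using monotonicity of g avoids an antiderivative;
    halving v changes the logarithm by a constant only.\<close>
  have pw: "ennreal (v / 2 * g (v / 2)) \<le> (\<integral>\<^sup>+t. ennreal (g t) * indicator {0..<v} t \<partial>lborel)" if v: "v \<ge> 0" for v
  proof -
    have "ennreal (v / 2 * g (v / 2)) = (\<integral>\<^sup>+t. ennreal (g (v / 2)) * indicator {v / 2..<v} t \<partial>lborel)"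
      using v by (subst nn_integral_cmult_indicator) (auto simp: ennreal_mult[symmetric] g0 mult.commute)
    also have "... \<le> (\<integral>\<^sup>+t. ennreal (g t) * indicator {0..<v} t \<partial>lborel)"
      using v by (intro nn_integral_mono) (auto simp: indicator_def intro!: ennreal_leI gmono)
    finally show ?thesis .
  qed
  have "(\<integral>\<^sup>+w. ennreal (\<bar>X w\<bar> / 2 * g (\<bar>X w\<bar> / 2)) \<partial>M)
    \<le> (\<integral>\<^sup>+w. (\<integral>\<^sup>+t. ennreal (g t) * indicator {0..<\<bar>X w\<bar>} t \<partial>lborel) \<partial>M)"
    by (intro nn_integral_mono pw) simp
  also have "... = tint (\<lambda>t. ennreal (g t) * ennreal (\<P>(w in M. \<bar>X w\<bar> > t)))"
    by (rule layer_cake[symmetric]) measurable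
  also have "... \<le> tint (\<lambda>t. (\<Sum>n. ennreal (wt 1 n * min 1 (real n * pX t))))"
    using low by (intro nn_integral_mono mult_right_mono) (auto simp: tailp_def ennreal_mult g0)
  also have "... < \<infinity>" by (rule cond_iii_min_integral[OF iii])
  finally have fin: "(\<integral>\<^sup>+w. ennreal (\<bar>X w\<bar> / 2 * g (\<bar>X w\<bar> / 2)) \<partial>M) < \<infinity>" .
  have ig: "integrable M (\<lambda>w. \<bar>X w\<bar> / 2 * g (\<bar>X w\<bar> / 2))"
    by (rule integrableI_bounded) (use fin g0 in auto)
  have "integrable M (\<lambda>w. \<bar>X w\<bar> * ln (1 + \<bar>X w\<bar>))"
  proof (rule Bochner_Integration.integrable_bound)
    show "integrable M (\<lambda>w. 2 * (\<bar>X w\<bar> / 2 * g (\<bar>X w\<bar> / 2)) + ln (1 + 2 * m) * \<bar>X w\<bar>)"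
      using i by (intro Bochner_Integration.integrable_add integrable_mult_right ig integrable_abs) auto
    show "AE w in M. norm (\<bar>X w\<bar> * ln (1 + \<bar>X w\<bar>)) \<le> norm (2 * (\<bar>X w\<bar> / 2 * g (\<bar>X w\<bar> / 2)) + ln (1 + 2 * m) * \<bar>X w\<bar>)"
    proof (rule AE_I2)
      fix w
      define v where "v = \<bar>X w\<bar>"
      have v: "v \<ge> 0" by (simp add: v_def)
      \<comment> \<open>So that ln b = g(v/2); 1 + v \<le> b (1 + 2m) then compares the two
        logarithms for small and large v alike.\<close>
      define b where "b = max 1 (v / 2 / m)"
      have b: "b \<ge> 1" "v \<le> 2 * m * b" using m by (auto simp: b_def max_def field_simps)
      have "1 + v \<le> b * (1 + 2 * m)" using b by (simp add: distrib_left mult_ac)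
      then have "ln (1 + v) \<le> ln (b * (1 + 2 * m))" using v by (intro ln_mono) auto
      also have "... = g (v / 2) + ln (1 + 2 * m)" using b m by (subst ln_mult_pos) (auto simp: g_def b_def)
      finally have "v * ln (1 + v) \<le> v * (g (v / 2) + ln (1 + 2 * m))" using v by (rule mult_left_mono)
      moreover have "0 \<le> v * ln (1 + v)" using v by simp
      moreover have "0 \<le> v * (g (v / 2) + ln (1 + 2 * m))" using v g0 m by simp
      ultimately have "norm (v * ln (1 + v)) \<le> norm (v * (g (v / 2) + ln (1 + 2 * m)))" by simp
      then show "norm (\<bar>X w\<bar> * ln (1 + \<bar>X w\<bar>)) \<le> norm (2 * (\<bar>X w\<bar> / 2 * g (\<bar>X w\<bar> / 2)) + ln (1 + 2 * m) * \<bar>X w\<bar>)"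
        unfolding v_def by (simp add: distrib_left mult.commute)
    qed
  qed measurable
  then show ?thesis using i cond_iii_imp_mean_zero[OF iii] by (simp add: cond_iv_def)
qed

lemma trunc_1: "trunc 1 n x = x * indicator {y. \<bar>y\<bar> \<le> real n} x"
  by (cases "n = 0") (auto simp: trunc_def)

lemma trunc_1_integrable: "integrable M X \<Longrightarrow> integrable M (\<lambda>w. trunc 1 n (X w))"
  by (rule Bochner_Integration.integrable_bound[of M X]) (auto simp: trunc_1 indicator_def)

lemma wt_1_mult_n: "wt 1 n * real n = 1 / real n"
  by (simp add: wt_1 power2_eq_square)

text \<open>Centring the truncated sum splits its mean modulus into a fluctuation and n times the
  modulus of the truncated mean; the weight turns the latter into a term over n. In the fluctuation
  the tail of the truncated variable is at most that of X and vanishes for t \<ge> n, whence the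
  restriction t < n.\<close>

lemma cond_i_1_criterion:
  assumes i: "integrable M X"
    and c: "(\<Sum>n. ennreal (\<bar>expectation (\<lambda>w. trunc 1 n (X w))\<bar> / real n)) < \<infinity>"
    and fin: "tint (\<lambda>t. (\<Sum>n. ennreal (wt 1 n * (if t < real n then min (2 * real n * pX t) (sqrt (real n * pX t)) else 0)))
       ) < \<infinity>"
  shows "cond_i M Xs 1"
proof (rule cond_i_of_tsum)
  show "(\<integral>\<^sup>+w. ennreal (\<bar>X w\<bar> powr 1) \<partial>M) < \<infinity>" using nn_abs_finite[OF i] by simp
  note [measurable] = rv_tsum
  define \<mu> where "\<mu> n = expectation (\<lambda>w. trunc 1 n (X w))" for n
  let ?F = "\<lambda>n t. if t < real n then min (2 * real n * pX t) (sqrt (real n * pX t)) else 0"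
  have "(\<Sum>n. tsumE 1 n)
    \<le> (\<Sum>n. ennreal (wt 1 n) * tint (\<lambda>t. ennreal (?F n t)) + ennreal (\<bar>\<mu> n\<bar> / real n))"
  proof (rule suminf_le)
    fix n
    let ?q = "\<lambda>t. \<P>(w in M. \<bar>trunc 1 n (X w)\<bar> > t)"
    have "absE (tsum 1 n) \<le> (\<integral>\<^sup>+w. ennreal \<bar>tsum 1 n w - real n * \<mu> n\<bar> + ennreal (real n * \<bar>\<mu> n\<bar>) \<partial>M)"
    proof (rule nn_integral_mono)
      fix w
      have "\<bar>tsum 1 n w\<bar> \<le> \<bar>tsum 1 n w - real n * \<mu> n\<bar> + \<bar>real n * \<mu> n\<bar>" by linarith
      then show "ennreal \<bar>tsum 1 n w\<bar> \<le> ennreal \<bar>tsum 1 n w - real n * \<mu> n\<bar> + ennreal (real n * \<bar>\<mu> n\<bar>)"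
        by (simp add: ennreal_plus[symmetric] ennreal_leI abs_mult del: ennreal_plus)
    qed
    also have "... = (\<integral>\<^sup>+w. ennreal \<bar>tsum 1 n w - real n * \<mu> n\<bar> \<partial>M) + ennreal (real n * \<bar>\<mu> n\<bar>)"
      by (simp add: nn_integral_add emeasure_space_1)
    also have "(\<integral>\<^sup>+w. ennreal \<bar>tsum 1 n w - real n * \<mu> n\<bar> \<partial>M)
      \<le> tint (\<lambda>t. ennreal (min (2 * real n * ?q t) (sqrt (real n * ?q t))))"
      using centered_sum_le_tail_integral[of "trunc 1 n" n] trunc_1_integrable[OF i]
      by (simp add: fsum_trunc \<mu>_def)
    also have "... \<le> tint (\<lambda>t. ennreal (?F n t))"
    proof (rule nn_integral_mono)
      fix t :: real
      show "ennreal (min (2 * real n * ?q t) (sqrt (real n * ?q t))) * indicator {0..} t \<le> ennreal (?F n t) * indicator {0..} t"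
      proof (cases "0 \<le> t \<and> t < real n")
        case True
        have "?q t \<le> pX t" unfolding tailp_def using True
          by (intro finite_measure_mono) (auto simp: trunc_1 indicator_def split: if_splits)
        then have "min (2 * real n * ?q t) (sqrt (real n * ?q t)) \<le> min (2 * real n * pX t) (sqrt (real n * pX t))"
          by (intro min.mono mult_left_mono real_sqrt_le_mono) auto
        then show ?thesis using True by (auto simp: indicator_def intro: ennreal_leI)
      next
        case False
        have "?q t = 0" if "0 \<le> t"
        proof -
          have "{w\<in>space M. \<bar>trunc 1 n (X w)\<bar> > t} = {}"
            using that False by (auto simp: trunc_1 indicator_def)
          then show ?thesis by (simp only: measure_empty)
        qed
        then show ?thesis by (cases "0 \<le> t") simp_all
      qed
    qed
    finally have "ennreal (wt 1 n) * absE (tsum 1 n)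
      \<le> ennreal (wt 1 n) * ((tint (\<lambda>t. ennreal (?F n t))) + ennreal (real n * \<bar>\<mu> n\<bar>))"
      by (simp add: add_right_mono mult_left_mono)
    also have "... = ennreal (wt 1 n) * tint (\<lambda>t. ennreal (?F n t)) + ennreal (wt 1 n * real n * \<bar>\<mu> n\<bar>)"
      by (simp add: distrib_left ennreal_mult mult.assoc)
    also have "wt 1 n * real n * \<bar>\<mu> n\<bar> = \<bar>\<mu> n\<bar> / real n" unfolding wt_1_mult_n by simp
    finally show "tsumE 1 n
      \<le> ennreal (wt 1 n) * tint (\<lambda>t. ennreal (?F n t)) + ennreal (\<bar>\<mu> n\<bar> / real n)"
      by (simp add: ennreal_mult nn_integral_cmult)
  qed (rule summableI)+
  also have "... = (\<Sum>n. ennreal (wt 1 n) * tint (\<lambda>t. ennreal (?F n t))) + (\<Sum>n. ennreal (\<bar>\<mu> n\<bar> / real n))"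
    by (rule suminf_add[symmetric]) (rule summableI)+
  also have "(\<Sum>n. ennreal (wt 1 n) * tint (\<lambda>t. ennreal (?F n t)))
    = tint (\<lambda>t. (\<Sum>n. ennreal (wt 1 n * ?F n t)))"
    by (rule swap_sum_integral) auto
  also have "... + (\<Sum>n. ennreal (\<bar>\<mu> n\<bar> / real n)) < \<infinity>"
    using fin c unfolding \<mu>_def by simp
  finally show "(\<Sum>n. tsumE 1 n) < \<infinity>" .
qed simp

lemma ln_square_bound:
  fixes s \<delta> :: real
  assumes s: "0 \<le> s" and d: "0 < \<delta>"
  shows "ln (1 + s\<^sup>2) \<le> 2 * (2 powr \<delta> / \<delta>) * (1 + s powr \<delta>)"
proof -
  have "ln (1 + s\<^sup>2) \<le> ln ((1 + s)\<^sup>2)" using s by (intro ln_mono) (auto simp: power2_eq_square algebra_simps add_pos_nonneg)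
  also have "... = 2 * ln (1 + s)" using s by (simp add: ln_realpow)
  also have "... \<le> 2 * ((1 + s) powr \<delta> / \<delta>)" using s d by (intro mult_left_mono ln_powr_bound) auto
  also have "(1 + s) powr \<delta> \<le> (2 * max 1 s) powr \<delta>" using s d by (intro powr_mono2) auto
  also have "... = 2 powr \<delta> * (max 1 s) powr \<delta>" using s by (simp add: powr_mult)
  also have "(max 1 s) powr \<delta> \<le> 1 + s powr \<delta>" by (auto simp: max_def)
  finally show ?thesis using d by (simp add: divide_right_mono)
qed

text \<open>Symmetry makes all truncated means vanish, so only the fluctuation remains. The factor y
  = 1 + ln(1 + t)^2 is just large enough for 1 / (y (1 + t)) to be integrable, while ln y is
  dominated by any positive power of ln(1 + t).\<close>

lemma symmetric_imp_cond_i_1: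
  assumes sym: "distr M borel X = distr M borel (\<lambda>w. - X w)" and d: "0 < \<delta>"
    and id: "integrable M (\<lambda>w. \<bar>X w\<bar> * ln (1 + \<bar>X w\<bar>) powr \<delta>)"
  shows "cond_i M Xs 1"
proof -
  have i: "integrable M X"
  proof (rule Bochner_Integration.integrable_bound)
    show "integrable M (\<lambda>w. 2 + \<bar>X w\<bar> * ln (1 + \<bar>X w\<bar>) powr \<delta>)" using id by simp
    show "AE w in M. norm (X w) \<le> norm (2 + \<bar>X w\<bar> * ln (1 + \<bar>X w\<bar>) powr \<delta>)"
    proof (rule AE_I2)
      fix w
      have "\<bar>X w\<bar> \<le> 2 + \<bar>X w\<bar> * ln (1 + \<bar>X w\<bar>) powr \<delta>"
      proof (cases "\<bar>X w\<bar> \<le> 2")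
        case False
        \<comment> \<open>Beyond 2 the logarithm is at least 1, since e \<le> 3, so the weighted
          moment dominates |X| there.\<close>
        have "exp 1 \<le> 1 + \<bar>X w\<bar>" using exp_le False by linarith
        then have "ln (exp 1) \<le> ln (1 + \<bar>X w\<bar>)" by (intro ln_mono) auto
        then have "1 \<le> ln (1 + \<bar>X w\<bar>)" by simp
        then have "1 \<le> ln (1 + \<bar>X w\<bar>) powr \<delta>" using d by (intro ge_one_powr_ge_zero) auto
        then have "\<bar>X w\<bar> * 1 \<le> \<bar>X w\<bar> * ln (1 + \<bar>X w\<bar>) powr \<delta>" by (intro mult_left_mono) auto
        then show ?thesis by simp
      qed (simp add: add_increasing2)
      then show "norm (X w) \<le> norm (2 + \<bar>X w\<bar> * ln (1 + \<bar>X w\<bar>) powr \<delta>)" by simp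
    qed
  qed measurable
  show ?thesis
  proof (rule cond_i_1_criterion[OF i])
    have "expectation (\<lambda>w. trunc 1 n (X w)) = 0" for n
    proof -
      have "expectation (\<lambda>w. trunc 1 n (X w)) = integral\<^sup>L (distr M borel X) (trunc 1 n)"
        by (rule integral_distr[symmetric]) measurable
      also have "... = expectation (\<lambda>w. trunc 1 n (- X w))"
        unfolding sym by (rule integral_distr) measurable
      also have "... = - expectation (\<lambda>w. trunc 1 n (X w))"
        by (simp add: trunc_1 indicator_def)
      finally show ?thesis by simp
    qed
    then show "(\<Sum>n. ennreal (\<bar>expectation (\<lambda>w. trunc 1 n (X w))\<bar> / real n)) < \<infinity>" by simp
    define C where "C = (2 powr (3 / 2) / (1 / 2) :: real)"
    define K where "K = 2 * (2 powr \<delta> / \<delta>)"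
    define h where "h t = 4 * ln 4 + 4 * K * (1 + ln (1 + t) powr \<delta>) + C" for t :: real
    have C: "C \<ge> 0" by (simp add: C_def)
    have K: "K \<ge> 0" using d by (simp add: K_def)
    show "tint (\<lambda>t. (\<Sum>n. ennreal (wt 1 n * (if t < real n then min (2 * real n * pX t) (sqrt (real n * pX t)) else 0)))
       ) < \<infinity>"
    proof (rule min_integral_finite[where h=h and C=C and k="\<lambda>t. 1 / ((1 + (ln (1 + t))\<^sup>2) * (1 + t))"])
      show "h \<in> borel_measurable borel" unfolding h_def by measurable
      show "h s \<le> h t" if "0 \<le> s" "s \<le> t" for s t
        using that K d by (auto simp: h_def intro!: mult_left_mono powr_mono2)
      show "0 \<le> h t" if "0 \<le> t" for t using that C K by (simp add: h_def)
      have "(\<lambda>w. \<bar>X w\<bar> * h \<bar>X w\<bar>) = (\<lambda>w. (4 * ln 4 + 4 * K + C) * \<bar>X w\<bar> + 4 * K * (\<bar>X w\<bar> * ln (1 + \<bar>X w\<bar>) powr \<delta>))"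
        by (simp add: h_def fun_eq_iff algebra_simps)
      then show "integrable M (\<lambda>w. \<bar>X w\<bar> * h \<bar>X w\<bar>)" using i id by simp
      show "(\<lambda>t::real. 1 / ((1 + (ln (1 + t))\<^sup>2) * (1 + t))) \<in> borel_measurable borel" by measurable
      show "tint (\<lambda>t. ennreal (1 / ((1 + (ln (1 + t))\<^sup>2) * (1 + t)))) < \<infinity>"
        by (rule nn_integral_inverse_ln_square)
      show "0 \<le> C" by (rule C)
      fix t :: real assume t: "0 \<le> t"
      show "0 \<le> 1 / ((1 + (ln (1 + t))\<^sup>2) * (1 + t))" using t by simp
      define y where "y = 1 + (ln (1 + t))\<^sup>2"
      have y: "1 \<le> y" by (simp add: y_def)
      have "ln (4 * y) = ln 4 + ln y" using y by (intro ln_mult_pos) auto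
      also have "ln y \<le> K * (1 + ln (1 + t) powr \<delta>)"
        unfolding y_def K_def using t d by (intro ln_square_bound) auto
      finally have "4 * ln (4 * y) + C \<le> h t" by (simp add: h_def)
      then have "(4 * ln (4 * y) + C) * pX t + C * (1 / (y * (1 + t))) \<le> h t * pX t + C * (1 / (y * (1 + t)))"
        by (intro add_right_mono mult_right_mono) auto
      then show "(\<Sum>n. ennreal (wt 1 n * (if t < real n then min (2 * real n * pX t) (sqrt (real n * pX t)) else 0)))
        \<le> ennreal (h t * pX t + C * (1 / ((1 + (ln (1 + t))\<^sup>2) * (1 + t))))"
        unfolding y_def[symmetric]
        by (rule order_trans[OF sum_min_one_le[OF t y tailp_nonneg, folded C_def] ennreal_leI])
    qed
  qed
qed

end

lemma suminf_ennreal_finite: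
  assumes "summable f" "\<And>n. 0 \<le> f n"
  shows "(\<Sum>n. ennreal (f n)) < \<infinity>"
  unfolding suminf_ennreal2[OF assms(2,1)] infinity_ennreal_def by (rule ennreal_less_top)

lemma nn_integral_add_cmult:
  fixes f g :: "'b \<Rightarrow> ennreal"
  assumes "f \<in> borel_measurable N" "g \<in> borel_measurable N"
  shows "(\<integral>\<^sup>+x. f x + c * g x \<partial>N) = (\<integral>\<^sup>+x. f x \<partial>N) + c * (\<integral>\<^sup>+x. g x \<partial>N)"
  using assms by (simp add: nn_integral_add nn_integral_cmult)

text \<open>Only n \<ge> 1/P contribute for P > 0, and the tail of n^(-3/2) from there is of order
  sqrt P; the other factor sqrt P makes this linear in P, with no logarithm.\<close>

lemma sum_sqrt_large_le:
  assumes P: "0 \<le> P"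
  shows "(\<Sum>n. ennreal (wt 1 n * (if 1 / real n \<le> P then sqrt (real n * P) else 0))) \<le> ennreal (2 powr (3 / 2) / (1 / 2) * P)"
proof (cases "P = 0")
  case True
  then show ?thesis by (simp cong: if_cong)
next
  case False
  then have P0: "P > 0" using P by simp
  have "(\<Sum>n. ennreal (wt 1 n * (if 1 / real n \<le> P then sqrt (real n * P) else 0)))
    \<le> (\<Sum>n. ennreal (wt 1 n * sqrt (real n * P) * indicator {1 / P..} (real n)))"
  proof (intro suminf_le summableI ennreal_leI)
    fix n :: nat
    show "wt 1 n * (if 1 / real n \<le> P then sqrt (real n * P) else 0) \<le> wt 1 n * sqrt (real n * P) * indicator {1 / P..} (real n)"
    proof (cases "n = 0")
      case False
      then have "1 / real n \<le> P \<longleftrightarrow> 1 / P \<le> real n" using P0 by (auto simp: field_simps)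
      then show ?thesis by (simp add: indicator_def)
    qed simp
  qed
  also have "... \<le> ennreal (2 powr (3 / 2) / (1 / 2) * (sqrt P * (1 / P) powr (- (1 / 2))))"
    using P0 by (intro sum_sqrt_tail) auto
  also have "sqrt P * (1 / P) powr (- (1 / 2)) = P"
  proof -
    have "(1 / P) powr (- (1 / 2)) = P powr (1 / 2)"
      using P0 by (simp add: powr_divide powr_minus_divide)
    then show ?thesis using P0 by (simp add: powr_half_sqrt)
  qed
  finally show ?thesis .
qed

section \<open>Quantiles of |X| and the equivalence with \<open>cond_ii\<close> at p = 1\<close>

context iid_seq begin

lemma tailp_less_0: "t < 0 \<Longrightarrow> pX t = 1"
proof -
  assume "t < 0"
  then have "{w\<in>space M. \<bar>X w\<bar> > t} = space M" by (auto intro: less_le_trans)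
  then show ?thesis by (simp add: tailp_def prob_space)
qed

lemma tailp_antimono: "s \<le> t \<Longrightarrow> pX t \<le> pX s"
  unfolding tailp_def by (intro finite_measure_mono) auto

text \<open>These facts make \<open>uq\<close> a genuine nonnegative infimum for n \<ge> 1: the tail
  is 1 at negative levels and tends to 0 by tightness. At n = 0 the set would be empty.\<close>

lemma uq_set:
  assumes "n \<ge> 1"
  shows "t \<in> {t. pX t < 1 / real n} \<Longrightarrow> 0 \<le> t"
    and "bdd_below {t. pX t < 1 / real n}"
    and "{t. pX t < 1 / real n} \<noteq> {}"
proof -
  show 1: "0 \<le> t" if "t \<in> {t. pX t < 1 / real n}" for t
  proof (rule ccontr)
    assume "\<not> 0 \<le> t"
    then have "pX t = 1" by (intro tailp_less_0) simp
    moreover have "1 / real n \<le> 1" using assms by simp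
    ultimately show False using that by simp
  qed
  then show "bdd_below {t. pX t < 1 / real n}" by (intro bdd_belowI) auto
  have "\<exists>s>0. \<P>(w in M. ennreal \<bar>X w\<bar> > ennreal s) \<le> 1 / (2 * real n)"
    using assms by (intro tight) auto
  then obtain s where s: "s > 0" "\<P>(w in M. ennreal \<bar>X w\<bar> > ennreal s) \<le> 1 / (2 * real n)" by auto
  then have "pX s \<le> 1 / (2 * real n)" by (simp add: tailp_def ennreal_less_iff)
  also have "... < 1 / real n" using assms by (simp add: field_simps)
  finally show "{t. pX t < 1 / real n} \<noteq> {}" by auto
qed

lemma uq_nonneg: "n \<ge> 1 \<Longrightarrow> 0 \<le> uq M X n"
  unfolding uq_def using uq_set by (intro cInf_greatest) auto

lemma less_uq: "n \<ge> 1 \<Longrightarrow> t < uq M X n \<Longrightarrow> 1 / real n \<le> pX t"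
  using cInf_lower[OF _ uq_set(2)[of n], of t] unfolding uq_def by force

lemma uq_less:
  assumes "n \<ge> 1" "uq M X n < t"
  shows "pX t < 1 / real n"
proof -
  obtain s where "s \<in> {t. pX t < 1 / real n}" "s < t"
    using cInf_lessD[OF uq_set(3)[OF assms(1)]] assms(2) unfolding uq_def by blast
  then show ?thesis using tailp_antimono[of s t] by simp
qed

lemma nn_tailp_interval:
  "(\<integral>\<^sup>+t. ennreal (pX t) * indicator {a..b} t \<partial>lborel) = ennreal (LINT t:{a..b}|lborel. pX t)"
proof -
  have "integrable lborel (\<lambda>t. indicator {a..b} t *\<^sub>R pX t)"
    by (rule Bochner_Integration.integrable_bound[of lborel "indicator {a..b} :: real \<Rightarrow> real"])
      (auto simp: indicator_def emeasure_lborel_Icc_eq)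
  then have "(\<integral>\<^sup>+t. ennreal (indicator {a..b} t *\<^sub>R pX t) \<partial>lborel) = ennreal (LINT t:{a..b}|lborel. pX t)"
    unfolding set_lebesgue_integral_def by (intro nn_integral_eq_integral) (auto simp: indicator_def)
  then show ?thesis by (simp add: ennreal_mult indicator_mult_ennreal mult.commute ennreal_indicator)
qed

lemma LINT_tailp_nonneg: "0 \<le> (LINT t:{a..b}|lborel. pX t)"
  unfolding set_lebesgue_integral_def by (intro integral_nonneg_AE) (auto simp: indicator_def)

lemma cond_ii_1_iff:
  "cond_ii M X 1 \<longleftrightarrow> integrable M X \<and> expectation X = 0
    \<and> summable (\<lambda>n. \<bar>expectation (\<lambda>w. X w * indicator {w. \<bar>X w\<bar> \<le> real n} w)\<bar> / real n)
    \<and> summable (\<lambda>n. (1 / real n) * (LINT t:{min (uq M X n) (real n)..real n}|lborel. pX t))"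
  unfolding cond_ii_def by (simp only: less_irrefl if_False if_True simp_thms)

text \<open>The minimum is split at u_n. Below it nP \<ge> 1, and the root bounds sum over n to a
  multiple of P, integrable in t. Between u_n and n the linear bound reproduces twice the tail
  integral of (ii).\<close>

lemma cond_ii_imp_i_1:
  assumes ii: "cond_ii M X 1"
  shows "cond_i M Xs 1"
proof -
  define T where "T n = 1 / real n * (LINT t:{min (uq M X n) (real n)..real n}|lborel. pX t)" for n
  note ii' = ii[unfolded cond_ii_1_iff]
  have i: "integrable M X" using ii' by (rule conjunct1)
  note c = ii'[THEN conjunct2, THEN conjunct2, THEN conjunct1]
  have T: "summable T" using ii' unfolding T_def[abs_def] by (elim conjE) assumption
  have T0: "0 \<le> T n" for n unfolding T_def using LINT_tailp_nonneg by simp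
  show ?thesis
  proof (rule cond_i_1_criterion[OF i])
    have e: "expectation (\<lambda>w. trunc 1 n (X w)) = expectation (\<lambda>w. X w * indicator {w. \<bar>X w\<bar> \<le> real n} w)" for n
      by (simp add: trunc_1 indicator_def)
    show "(\<Sum>n. ennreal (\<bar>expectation (\<lambda>w. trunc 1 n (X w))\<bar> / real n)) < \<infinity>"
      unfolding e by (rule suminf_ennreal_finite[OF c]) simp
    let ?F = "\<lambda>n t. if t < real n then min (2 * real n * pX t) (sqrt (real n * pX t)) else 0"
    let ?G = "\<lambda>n t. if 1 / real n \<le> pX t then sqrt (real n * pX t) else 0"
    let ?H = "\<lambda>n t. 2 * real n * pX t * indicator {min (uq M X n) (real n)..real n} t"
    define C where "C = (2 powr (3 / 2) / (1 / 2) :: real)"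
    have C: "0 \<le> C" by (simp add: C_def)
    have pw: "(\<Sum>n. ennreal (wt 1 n * ?F n t)) \<le> (\<Sum>n. ennreal (wt 1 n * ?H n t)) + ennreal (C * pX t)"
      if t: "0 \<le> t" for t
    proof -
      have "(\<Sum>n. ennreal (wt 1 n * ?F n t)) \<le> (\<Sum>n. ennreal (wt 1 n * ?H n t) + ennreal (wt 1 n * ?G n t))"
      proof (intro suminf_le summableI)
        fix n :: nat
        have "?F n t \<le> ?H n t + ?G n t"
        proof (cases "n \<ge> 1 \<and> t < real n")
          case True
          show ?thesis
          proof (cases "t < uq M X n")
            case lt: True
            then have "1 / real n \<le> pX t" using True by (intro less_uq) auto
            then show ?thesis using True by (simp add: add_increasing)
          next
            case False
            then show ?thesis using True by (auto simp: indicator_def intro: add_increasing2)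
          qed
        next
          case False
          then have "?F n t = 0" using t by (auto simp: not_le)
          then show ?thesis by simp
        qed
        then have "wt 1 n * ?F n t \<le> wt 1 n * ?H n t + wt 1 n * ?G n t"
          unfolding distrib_left[symmetric] by (rule mult_left_mono) simp
        then have "ennreal (wt 1 n * ?F n t) \<le> ennreal (wt 1 n * ?H n t + wt 1 n * ?G n t)" by (rule ennreal_leI)
        also have "... = ennreal (wt 1 n * ?H n t) + ennreal (wt 1 n * ?G n t)" by (intro ennreal_plus) auto
        finally show "ennreal (wt 1 n * ?F n t) \<le> ennreal (wt 1 n * ?H n t) + ennreal (wt 1 n * ?G n t)" .
      qed
      also have "... = (\<Sum>n. ennreal (wt 1 n * ?H n t)) + (\<Sum>n. ennreal (wt 1 n * ?G n t))"
        by (rule suminf_add[symmetric]) (rule summableI)+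
      also have "... \<le> (\<Sum>n. ennreal (wt 1 n * ?H n t)) + ennreal (C * pX t)"
        unfolding C_def by (intro add_left_mono sum_sqrt_large_le tailp_nonneg)
      finally show ?thesis .
    qed
    have "tint (\<lambda>t. (\<Sum>n. ennreal (wt 1 n * ?F n t)))
      \<le> (\<integral>\<^sup>+t. (\<Sum>n. ennreal (wt 1 n * ?H n t)) * indicator {0..} t + ennreal C * (ennreal (1 * pX t) * indicator {0..} t) \<partial>lborel)"
    proof (rule nn_integral_mono)
      fix t :: real
      show "(\<Sum>n. ennreal (wt 1 n * ?F n t)) * indicator {0..} t
        \<le> (\<Sum>n. ennreal (wt 1 n * ?H n t)) * indicator {0..} t + ennreal C * (ennreal (1 * pX t) * indicator {0..} t)"
      proof (cases "0 \<le> t")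
        case True
        then have e: "indicator {0..} t = (1 :: ennreal)" by simp
        have "ennreal (C * pX t) = ennreal C * ennreal (1 * pX t)" using C by (simp add: ennreal_mult)
        from pw[OF True, unfolded this] show ?thesis unfolding e mult_1_right .
      qed simp
    qed
    also have "... = tint (\<lambda>t. (\<Sum>n. ennreal (wt 1 n * ?H n t)))
      + ennreal C * tint (\<lambda>t. ennreal (1 * pX t))"
    proof (rule nn_integral_add_cmult)
      show "(\<lambda>t. (\<Sum>n. ennreal (wt 1 n * ?H n t)) * indicator {0..} t) \<in> borel_measurable lborel" by measurable
      show "(\<lambda>t. ennreal (1 * pX t) * indicator {0..} t) \<in> borel_measurable lborel" by measurable
    qed
    also have "... < \<infinity>"
    proof -
      have "tint (\<lambda>t. ennreal (1 * pX t)) \<le> (\<integral>\<^sup>+w. ennreal (\<bar>X w\<bar> * 1) \<partial>M)"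
        by (rule weighted_tail_le) auto
      also have "... < \<infinity>" using nn_abs_finite[OF i] by simp
      finally have 1: "ennreal C * tint (\<lambda>t. ennreal (1 * pX t)) < \<infinity>"
        by (simp add: ennreal_mult_less_top)
      have "tint (\<lambda>t. (\<Sum>n. ennreal (wt 1 n * ?H n t)))
        = (\<Sum>n. ennreal (wt 1 n) * tint (\<lambda>t. ennreal (?H n t)))"
      proof (rule swap_sum_integral[symmetric])
        show "?H n \<in> borel_measurable borel" for n by measurable
        show "0 \<le> ?H n t" for n t by simp
      qed
      also have "... \<le> (\<Sum>n. ennreal (2 * T n))"
      proof (intro suminf_le summableI)
        fix n :: nat
        have "tint (\<lambda>t. ennreal (?H n t))
          \<le> (\<integral>\<^sup>+t. ennreal (2 * real n) * (ennreal (pX t) * indicator {min (uq M X n) (real n)..real n} t) \<partial>lborel)"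
          by (intro nn_integral_mono) (auto simp: indicator_def ennreal_mult)
        also have "... = ennreal (2 * real n) * ennreal (LINT t:{min (uq M X n) (real n)..real n}|lborel. pX t)"
          unfolding nn_tailp_interval[symmetric] by (rule nn_integral_cmult) measurable
        finally have "ennreal (wt 1 n) * tint (\<lambda>t. ennreal (?H n t))
          \<le> ennreal (wt 1 n) * (ennreal (2 * real n) * ennreal (LINT t:{min (uq M X n) (real n)..real n}|lborel. pX t))"
          by (rule mult_left_mono) simp
        also have "... = ennreal (2 * (wt 1 n * real n) * (LINT t:{min (uq M X n) (real n)..real n}|lborel. pX t))"
          using LINT_tailp_nonneg by (simp add: ennreal_mult[symmetric] mult_ac)
        also have "... = ennreal (2 * T n)" unfolding wt_1_mult_n T_def by (simp add: mult_ac)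
        finally show "ennreal (wt 1 n) * tint (\<lambda>t. ennreal (?H n t)) \<le> ennreal (2 * T n)" .
      qed
      also have "... < \<infinity>" by (rule suminf_ennreal_finite[OF summable_mult[OF T]]) (simp add: T0)
      finally show ?thesis using 1 by simp
    qed
    finally show "tint (\<lambda>t. (\<Sum>n. ennreal (wt 1 n * ?F n t))) < \<infinity>" .
  qed
qed


text \<open>The moduli of the truncated means are bounded by the mean moduli of the truncated sums.
  They tend to |E X| by dominated convergence, so a nonzero mean would give a divergent harmonic
  series. Above u_n one has nP \<le> 1, so nP can be replaced by a minimum with 1 and estimated by
  \<open>tail_integral_le_sum\<close>. Passing from X to its truncation costs n P(|X| > n) at each
  level, in total P(|X| > n) after weighting, which is summable since E|X| is finite.\<close>

lemma cond_i_imp_ii_1: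
  assumes ci: "cond_i M Xs 1"
  shows "cond_ii M X 1"
proof -
  note [measurable] = rv_tsum
  have mom: "absE X < \<infinity>"
    using cond_i_moment[OF _ ci] by simp
  have ts: "(\<Sum>n. tsumE 1 n) < \<infinity>" by (rule cond_i_tsum[OF _ ci]) simp
  have i: "integrable M X" using mom by (simp add: integrable_iff_bounded)
  note ti = trunc_1_integrable[OF i]
  have tf: "fsum (trunc 1 n) 0 n = tsum 1 n" for n by (rule ext) (rule fsum_trunc)
  define \<mu> where "\<mu> n = expectation (\<lambda>w. trunc 1 n (X w))" for n
  have \<mu>_alt: "\<mu> n = expectation (\<lambda>w. X w * indicator {w. \<bar>X w\<bar> \<le> real n} w)" for n
    unfolding \<mu>_def by (simp add: trunc_1 indicator_def)
  have "(\<Sum>n. ennreal (\<bar>\<mu> n\<bar> / real n)) \<le> (\<Sum>n. tsumE 1 n)"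
  proof (intro suminf_le summableI)
    fix n :: nat
    have "\<bar>\<mu> n\<bar> / real n = wt 1 n * real n * \<bar>\<mu> n\<bar>" unfolding wt_1_mult_n by simp
    also have "... = wt 1 n * \<bar>expectation (tsum 1 n)\<bar>"
      using fsum_expectation[of "trunc 1 n" 0 n] ti by (simp add: tf \<mu>_def abs_mult)
    finally have "ennreal (\<bar>\<mu> n\<bar> / real n) = ennreal (wt 1 n) * ennreal \<bar>expectation (tsum 1 n)\<bar>"
      by (simp add: ennreal_mult)
    also have "... \<le> ennreal (wt 1 n) * absE (tsum 1 n)"
      using integral_norm_bound_ennreal[of M "tsum 1 n"] fsum_integrable[of "trunc 1 n" 0 n] ti
      by (intro mult_left_mono) (auto simp: tf)
    also have "... = tsumE 1 n"
      by (simp add: ennreal_mult nn_integral_cmult)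
    finally show "ennreal (\<bar>\<mu> n\<bar> / real n) \<le> tsumE 1 n" .
  qed
  then have sum_\<mu>: "summable (\<lambda>n. \<bar>\<mu> n\<bar> / real n)"
    using ts by (intro summable_suminf_not_top) (auto simp: top_unique)
  have lim: "\<mu> \<longlonglongrightarrow> expectation X"
    unfolding \<mu>_def
  proof (rule integral_dominated_convergence[where w="\<lambda>w. \<bar>X w\<bar>"])
    show "AE w in M. (\<lambda>n. trunc 1 n (X w)) \<longlonglongrightarrow> X w"
    proof (rule AE_I2)
      fix w
      have "eventually (\<lambda>n. trunc 1 n (X w) = X w) sequentially"
        using eventually_ge_at_top[of "nat \<lceil>\<bar>X w\<bar>\<rceil>"]
        by eventually_elim (auto simp: trunc_1 indicator_def nat_le_iff ceiling_le_iff)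
      then show "(\<lambda>n. trunc 1 n (X w)) \<longlonglongrightarrow> X w" by (rule tendsto_eventually)
    qed
  qed (use i in \<open>auto simp: trunc_1 indicator_def\<close>)
  have z: "expectation X = 0"
  proof (rule ccontr)
    assume ne: "expectation X \<noteq> 0"
    define d where "d = \<bar>expectation X\<bar> / 2"
    have d: "d > 0" "d < \<bar>expectation X\<bar>" using ne by (simp_all add: d_def)
    have "eventually (\<lambda>n. d < \<bar>\<mu> n\<bar>) sequentially"
      using tendsto_rabs[OF lim] d(2) by (rule order_tendstoD)
    then have "eventually (\<lambda>n. norm (d * (1 / real n)) \<le> \<bar>\<mu> n\<bar> / real n) sequentially"
      by eventually_elim (use d in \<open>auto simp: divide_right_mono\<close>)
    then have "summable (\<lambda>n. d * (1 / real n))" using sum_\<mu> by (rule summable_comparison_test_ev)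
    then have "summable (\<lambda>n. 1 / real n)" using d by (subst (asm) summable_cmult_iff) simp
    then have "(\<Sum>n. ennreal (1 / real n)) < \<infinity>" by (rule suminf_ennreal_finite) simp
    then show False unfolding suminf_inverse_top by simp
  qed
  define T where "T n = 1 / real n * (LINT t:{min (uq M X n) (real n)..real n}|lborel. pX t)" for n
  have T0: "0 \<le> T n" for n unfolding T_def using LINT_tailp_nonneg by simp
  have "(\<Sum>n. ennreal (T n)) \<le> (\<Sum>n. 34 * tsumE 1 n + ennreal (pX (real n)))"
  proof (intro suminf_le summableI)
    fix n :: nat
    let ?q = "\<lambda>t. \<P>(w in M. \<bar>trunc 1 n (X w)\<bar> > t)"
    let ?a = "min (uq M X n) (real n)"
    show "ennreal (T n) \<le> 34 * tsumE 1 n + ennreal (pX (real n))"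
    proof (cases "n = 0")
      case True
      then show ?thesis by (simp add: T_def)
    next
      case False
      then have n: "n \<ge> 1" by simp
      have [measurable]: "?q \<in> borel_measurable borel" by (rule tail_measurable) measurable
      have "(\<integral>\<^sup>+t. ennreal (real n) * (ennreal (pX t) * indicator {?a..real n} t) \<partial>lborel)
        \<le> (\<integral>\<^sup>+t. ennreal (min 1 (real n * ?q t)) * indicator {0..} t + ennreal (real n * pX (real n)) * indicator {0..real n} t \<partial>lborel)"
      \<comment> \<open>Two null points are removed: at u_n itself the bound nP < 1 is not
        guaranteed, and at t = n the truncated tail is 0. If u_n \<ge> n the interval is just the
        point n.\<close>
      proof (rule nn_integral_mono_AE, use AE_lborel_singleton[of "real n"] AE_lborel_singleton[of "uq M X n"] in eventually_elim)
        fix t :: real assume ne: "t \<noteq> real n" "t \<noteq> uq M X n"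
        show "ennreal (real n) * (ennreal (pX t) * indicator {?a..real n} t)
          \<le> ennreal (min 1 (real n * ?q t)) * indicator {0..} t + ennreal (real n * pX (real n)) * indicator {0..real n} t"
        proof (cases "t \<in> {?a..real n}")
          case True
          have t: "t < real n" "uq M X n < t" using True ne by (auto simp: min_def split: if_splits)
          have t0: "0 \<le> t" using t uq_nonneg[OF n] by simp
          have "real n * pX t \<le> 1" using uq_less[OF n t(2)] n by (simp add: field_simps)
          moreover have "pX t \<le> ?q t + pX (real n)"
          proof -
            have "pX t \<le> prob ({w\<in>space M. \<bar>trunc 1 n (X w)\<bar> > t} \<union> {w\<in>space M. \<bar>X w\<bar> > real n})"
              unfolding tailp_def by (intro finite_measure_mono) (auto simp: trunc_1 indicator_def)
            also have "... \<le> ?q t + pX (real n)"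
              unfolding tailp_def by (rule measure_Un_le) measurable
            finally show ?thesis .
          qed
          then have "real n * pX t \<le> real n * ?q t + real n * pX (real n)"
            unfolding distrib_left[symmetric] by (rule mult_left_mono) simp
          moreover have "0 \<le> real n * pX (real n)" by simp
          \<comment> \<open>Uses min(1, a + b) \<le> min(1, a) + b for b \<ge> 0.\<close>
          ultimately have "real n * pX t \<le> min 1 (real n * ?q t) + real n * pX (real n)" by linarith
          then have "ennreal (real n * pX t) \<le> ennreal (min 1 (real n * ?q t) + real n * pX (real n))"
            by (rule ennreal_leI)
          also have "... = ennreal (min 1 (real n * ?q t)) + ennreal (real n * pX (real n))"
            by (rule ennreal_plus) auto
          finally show ?thesis using True t t0 by (simp add: ennreal_mult)
        qed simp
      qed
      also have "... = tint (\<lambda>t. ennreal (min 1 (real n * ?q t)))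
        + (\<integral>\<^sup>+t. ennreal (real n * pX (real n)) * indicator {0..real n} t \<partial>lborel)"
        by (rule nn_integral_add) measurable
      also have "(\<integral>\<^sup>+t. ennreal (real n * pX (real n)) * indicator {0..real n} t \<partial>lborel)
        = ennreal (real n * pX (real n) * real n)"
        by (subst nn_integral_cmult_indicator) (auto simp: ennreal_mult)
      also have "tint (\<lambda>t. ennreal (min 1 (real n * ?q t))) \<le> 34 * absE (tsum 1 n)"
        using tail_integral_le_sum[of "trunc 1 n" n] ti n by (simp add: fsum_trunc)
      finally have main: "(\<integral>\<^sup>+t. ennreal (real n) * (ennreal (pX t) * indicator {?a..real n} t) \<partial>lborel)
        \<le> 34 * absE (tsum 1 n) + ennreal (real n * pX (real n) * real n)"
        by (simp add: add_right_mono)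
      have "ennreal (T n) = ennreal (wt 1 n) * (ennreal (real n) * ennreal (LINT t:{?a..real n}|lborel. pX t))"
        using LINT_tailp_nonneg unfolding T_def wt_1_mult_n[symmetric] by (simp add: ennreal_mult mult.assoc)
      also have "... = ennreal (wt 1 n) * (\<integral>\<^sup>+t. ennreal (real n) * (ennreal (pX t) * indicator {?a..real n} t) \<partial>lborel)"
        unfolding nn_tailp_interval[symmetric] by (subst nn_integral_cmult) measurable
      also have "... \<le> ennreal (wt 1 n) * (34 * absE (tsum 1 n) + ennreal (real n * pX (real n) * real n))"
        by (rule mult_left_mono[OF main]) simp
      also have "... = 34 * tsumE 1 n + ennreal (wt 1 n * (real n * pX (real n) * real n))"
      proof -
        have I: "tsumE 1 n = ennreal (wt 1 n) * absE (tsum 1 n)"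
          by (simp add: ennreal_mult nn_integral_cmult)
        have Z: "ennreal (wt 1 n * (real n * pX (real n) * real n)) = ennreal (wt 1 n) * ennreal (real n * pX (real n) * real n)"
          by (rule ennreal_mult) auto
        show ?thesis unfolding I Z distrib_left by (simp only: mult.left_commute)
      qed
      also have "wt 1 n * (real n * pX (real n) * real n) = pX (real n)"
        using n by (simp add: wt_1 power2_eq_square)
      finally show ?thesis .
    qed
  qed
  also have "... = (\<Sum>n. 34 * tsumE 1 n) + (\<Sum>n. ennreal (pX (real n)))"
    by (rule suminf_add[symmetric]) (rule summableI)+
  also have "... < \<infinity>"
  proof -
    have "(\<Sum>j. ennreal (pX (real (Suc j)))) \<le> absE X"
      using tail_sum_le_moment[of 1] unfolding tailp_def by (simp only: powr_one abs_ge_zero zero_less_one)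
    then have "(\<Sum>j. ennreal (pX (real (Suc j)))) < \<infinity>" using mom by (rule order.strict_trans1)
    then have "summable (\<lambda>j. pX (real (Suc j)))" by (intro summable_suminf_not_top) auto
    then have "summable (\<lambda>n. pX (real n))" by (subst (asm) summable_Suc_iff)
    then have "(\<Sum>n. ennreal (pX (real n))) < \<infinity>" by (rule suminf_ennreal_finite) simp
    then show ?thesis using ts by (simp add: ennreal_mult_less_top)
  qed
  finally have "summable T" using T0 by (intro summable_suminf_not_top) auto
  then show ?thesis
    using i z sum_\<mu> unfolding cond_ii_1_iff \<mu>_alt T_def[abs_def] by (intro conjI)
qed

end

theorem theorem2p5:
  fixes M :: "'a measure" and X :: "'a \<Rightarrow> real" and Xs :: "nat \<Rightarrow> 'a \<Rightarrow> real"
  assumes "prob_space M"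
    and "X \<in> borel_measurable M"
    and "\<And>n. n \<ge> 1 \<Longrightarrow> Xs n \<in> borel_measurable M"
    and "prob_space.indep_vars M (\<lambda>_. borel) Xs {1..}"
    and "\<And>n. n \<ge> 1 \<Longrightarrow> distr M borel (Xs n) = distr M borel X"
  shows
    "(\<forall>p. 0 < p \<and> p < 2 \<longrightarrow> (cond_i M Xs p \<longleftrightarrow> cond_ii M X p))
     \<and> (\<forall>p. 0 < p \<and> p < 2 \<longrightarrow> (cond_iii M Xs p \<longleftrightarrow> cond_iv M X p))
     \<and> (\<forall>p. 1 < p \<and> p < 2 \<longrightarrow>
          (cond_i M Xs p \<longleftrightarrow> cond_ii M X p) \<and> (cond_ii M X p \<longleftrightarrow> cond_iii M Xs p)
          \<and> (cond_i M Xs p \<longrightarrow>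
               (AE \<omega> in M. (\<lambda>n. psum Xs n \<omega> / real n powr (1 / p)) \<longlonglongrightarrow> 0)))
     \<and> (((distr M borel X = distr M borel (\<lambda>\<omega>. - X \<omega>)
           \<and> (\<exists>\<delta>>0. integrable M (\<lambda>\<omega>. \<bar>X \<omega>\<bar> * ln (1 + \<bar>X \<omega>\<bar>) powr \<delta>)))
         \<or> (integrable M X \<and> integral\<^sup>L M X = 0
            \<and> integrable M (\<lambda>\<omega>. \<bar>X \<omega>\<bar> * ln (1 + \<bar>X \<omega>\<bar>))))
        \<longrightarrow> cond_i M Xs 1)"
proof -
  interpret iid_seq M X Xs
    using assms by (intro iid_seq.intro iid_seq_axioms.intro)
  have gt1: "(cond_i M Xs p \<longleftrightarrow> cond_iii M Xs p) \<and> (cond_ii M X p \<longleftrightarrow> cond_iii M Xs p)" if "1 < p" "p < 2" for p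
    using that cond_i_imp_iii_gt1 cond_iii_imp_i cond_iii_iff_iv_gt1 cond_ii_iff_iv_gt1 by blast
  have i_ii: "cond_i M Xs p \<longleftrightarrow> cond_ii M X p" if "0 < p" "p < 2" for p
  proof -
    consider "p < 1" | "p = 1" | "1 < p" by linarith
    then show ?thesis
      using that cond_i_iff_ii_lt1 cond_i_imp_ii_1 cond_ii_imp_i_1 gt1 by cases blast+
  qed
  have iii_iv: "cond_iii M Xs p \<longleftrightarrow> cond_iv M X p" if "0 < p" "p < 2" for p
  proof -
    consider "p < 1" | "p = 1" | "1 < p" by linarith
    then show ?thesis
      using that cond_iii_iff_iv_lt1 cond_iii_imp_iv_1 cond_iv_imp_iii_1 cond_iii_iff_iv_gt1 by cases blast+
  qed
  have slln: "AE w in M. (\<lambda>n. psum Xs n w / real n powr (1 / p)) \<longlonglongrightarrow> 0"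
    if "1 < p" "p < 2" "cond_i M Xs p" for p
    using that gt1 cond_iii_slln by blast
  \<comment> \<open>The second sufficient condition is \<open>cond_iv\<close> at p = 1, so it passes
    through \<open>cond_iii\<close>.\<close>
  have "cond_i M Xs 1" if "integrable M X" "integral\<^sup>L M X = 0" "integrable M (\<lambda>w. \<bar>X w\<bar> * ln (1 + \<bar>X w\<bar>))"
    using that by (intro cond_iii_imp_i cond_iv_imp_iii_1) (simp add: cond_iv_def)
  then show ?thesis using i_ii iii_iv gt1 slln symmetric_imp_cond_i_1 by blast
qed

end
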